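(* For $2\le\alpha\le4$ put $\beta=5-\alpha$ and let $$\lvert\Psi_\alpha\rangle=\sqrt{\tfrac27}\,\lvert\Phi\rangle\lvert\Phi\rangle_E+\sqrt{\tfrac{\alpha}{21}}\sum_{i=0}^2\lvert i,i{+}1\rangle\lvert i,i{+}1\rangle_E+\sqrt{\tfrac{\beta}{21}}\sum_{i=0}^2\lvert i{+}1,i\rangle\lvert i{+}1,i\rangle_E$$ (indices modulo $3$, $\lvert\Phi\rangle=(\lvert00\rangle+\lvert11\rangle+\lvert22\rangle)/\sqrt3$ on $\mathbb C^3\otimes\mathbb C^3$) be the purification of the state $\sigma_\alpha=\frac27\lvert\Phi\rangle\langle\Phi\rvert+\frac{\alpha}{21}\sum_i\lvert i,i{+}1\rangle\langle i,i{+}1\rvert+\frac{\beta}{21}\sum_i\lvert i{+}1,i\rangle\langle i{+}1,i\rvert$, where the seven vectors on $E$, labelled $k\in\{\Phi,01,12,20,10,21,02\}$, are orthonormal. Let Alice and Bob use the binary POVMs with effects $A_0=\operatorname{diag}(0,\frac12,1)$, $A_1=\mathbf 1-A_0$ and $B_0=\operatorname{diag}(1,\frac12,0)$, $B_1=\mathbf1-B_0$, and let Eve use $E_z=\sum_kq_\alpha(z\mid k)\lvert k\rangle\langle k\rvert$, $z\in\{0,1,\bot\}$, where the nonzero values of $q_\alpha(0\mid\cdot)$ are $q_\alpha(0\mid20)=\frac1{10\alpha}$, $q_\alpha(0\mid10)=q_\alpha(0\mid21)=\frac1\beta$; the nonzero values of $q_\alpha(1\mid\cdot)$ are $q_\alpha(1\mid01)=q_\alpha(1\mid12)=\frac1\alpha$,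 $q_\alpha(1\mid02)=\frac1{10\beta}$; and $q_\alpha(\bot\mid k)=1-q_\alpha(0\mid k)-q_\alpha(1\mid k)$. Then for every $2\le\alpha\le4$ this is a valid POVM, and the outcome distribution $P(x,y,z)=\langle\Psi_\alpha\rvert A_x\otimes B_y\otimes E_z\lvert\Psi_\alpha\rangle$ of $(X,Y,Z)$ does not depend on $\alpha$: with $M_z=(P(x,y,z))_{x,y\in\{0,1\}}$, $$M_0=\begin{pmatrix}11/210&1/42\\1/42&0\end{pmatrix},\quad M_1=\begin{pmatrix}0&1/42\\1/42&11/210\end{pmatrix},\quad M_\bot=\begin{pmatrix}22/105&4/21\\4/21&22/105\end{pmatrix}.$$ Moreover this distribution has bound information: $$S(X;Y\Vert Z)=0<I(X;Y{\downarrow}Z)\le I_{\rm form}(X;Y\mid Z).$$ Thus both the bound-entangled members ($3<\alpha\le4$) and the separable members ($2\le\alpha\le3$) of the family $\sigma_\alpha$ admit measurements of a purification that produce this one bound-information distribution.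
   Context: All alphabets are finite and logarithms are base two. $I(\cdot;\cdot)$ and $I(\cdot;\cdot\mid\cdot)$ are (conditional) mutual information, $H$ is Shannon entropy. It is known (Horodecki et al.) that $\sigma_\alpha$ is separable for $2\le\alpha\le3$ and bound entangled for $3<\alpha\le4$. Secret-key rate. An $n$-copy protocol: Alice holds $X^n$, Bob holds $Y^n$, Eve holds $Z^n$, where $(X^n,Y^n,Z^n)$ are $n$ i.i.d. copies of $(X,Y,Z)$. Alice and Bob have private local randomness (independent of each other and of the source) and exchange an arbitrary finite number of rounds of public messages, each message being a function of the sender's data, the sender's private randomness and the previous messages; $F$ denotes the full public transcript. At the end Alice computes $K_A$ and Bob computes $K_B$, with values in a finite set $\mathcal K_n$, from their own data, randomness and $F$. A sequence of such protocols is admissible if, as $n\to\infty$, $\Pr[K_A=K_B]\to1$, $\log|\mathcal K_n|-H(K_A)\to0$, and $I(K_A;Z^n,F)\to0$; its rate is $\liminf_{n\to\infty}\frac1n\log|\mathcal K_n|$. $S(X;Y\Vert Z)$ is the supremum of the rates of admissible sequences. Intrinsic information. $I(X;Y{\downarrow}Z):=\inf_{P_{\bar Z\mid Z}}I(X;Y\mid\bar Z)$, the infimum over all channels (stochastic maps) from the alphabet of $Z$ to finite alphabets, where $\bar Z$ is obtained by applying the channel to $Z$. Formation cost. $I_{\rm form}(X;Y\mid Z)$ is the minimal rate of pre-shared secret bits needed to generate samples of $(X,Y)$ by public discussion while ensuring that the public transcript can be simulated from $Z$. Precisely: it is the infimum of all $R\ge0$ such that for every $\varepsilon>0$ and all sufficiently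 large $N$ there is an interactive public-discussion protocol in which Alice and Bob start with $\lfloor RN\rfloor$ shared uniform secret bits and private local randomness, exchange a public transcript $C$, and output $\tilde X^N$ and $\tilde Y^N$ respectively, and there is a channel $P_{\bar C\mid Z^N}$, such that the law of $(\tilde X^N,\tilde Y^N,C)$ is within total variation distance $\varepsilon$ of the law of $(X^N,Y^N,\bar C)$, where $(X^N,Y^N,Z^N)$ are $N$ i.i.d. copies of $(X,Y,Z)$ and $\bar C$ is obtained from $Z^N$ through this channel. *)

theory Defs
  imports "HOL-Probability.Probability"
begin

section \<open>Operators on finite-dimensional complex spaces\<close>

definition ket :: "'n \<Rightarrow> complex^'n" where
  "ket i = axis i 1"

definition tensor_vec :: "complex^'a \<Rightarrow> complex^'b \<Rightarrow> complex^('a \<times> 'b)" where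
  "tensor_vec v w = (\<chi> p. v $ fst p * w $ snd p)"

definition tensor :: "complex^'a^'a \<Rightarrow> complex^'b^'b \<Rightarrow> complex^('a \<times> 'b)^('a \<times> 'b)" where
  "tensor M N = (\<chi> p q. M $ fst p $ fst q * N $ snd p $ snd q)"

definition ketbra :: "complex^'n \<Rightarrow> complex^'n \<Rightarrow> complex^'n^'n" where
  "ketbra v w = (\<chi> i j. v $ i * cnj (w $ j))"

definition expval :: "complex^'n \<Rightarrow> complex^'n^'n \<Rightarrow> complex" where
  "expval v M = (\<Sum>i\<in>UNIV. cnj (v $ i) * (M *v v) $ i)"

definition diag :: "('n \<Rightarrow> complex) \<Rightarrow> complex^'n^'n" where
  "diag d = (\<chi> i j. if i = j then d i else 0)"

text \<open>Over the complex numbers a real non-negative quadratic form is automatically Hermitian.\<close>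

definition positive_op :: "complex^'n^'n \<Rightarrow> bool" where
  "positive_op M \<longleftrightarrow> (\<forall>v. Im (expval v M) = 0 \<and> 0 \<le> Re (expval v M))"

definition density_op :: "complex^'n^'n \<Rightarrow> bool" where
  "density_op \<rho> \<longleftrightarrow> positive_op \<rho> \<and> trace \<rho> = 1"

definition is_povm :: "('o::finite \<Rightarrow> complex^'n^'n) \<Rightarrow> bool" where
  "is_povm E \<longleftrightarrow> (\<forall>z. positive_op (E z)) \<and> (\<Sum>z\<in>UNIV. E z) = mat 1"

definition ptrace_snd :: "complex^('a::finite \<times> 'e::finite)^('a \<times> 'e) \<Rightarrow> complex^'a^'a" where
  "ptrace_snd M = (\<chi> i j. \<Sum>e\<in>UNIV. M $ (i, e) $ (j, e))"

definition is_purification :: "complex^('a::finite \<times> 'e::finite) \<Rightarrow> complex^'a^'a \<Rightarrow> bool" where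
  "is_purification \<psi> \<rho> \<longleftrightarrow> ptrace_snd (ketbra \<psi> \<psi>) = \<rho>"

definition has_outcome_law ::
  "complex^(('a::finite \<times> 'b::finite) \<times> 'e::finite) \<Rightarrow> ('x \<Rightarrow> complex^'a^'a) \<Rightarrow> ('y \<Rightarrow> complex^'b^'b) \<Rightarrow>
   ('z \<Rightarrow> complex^'e^'e) \<Rightarrow> ('x \<times> 'y \<times> 'z) pmf \<Rightarrow> bool" where
  "has_outcome_law \<psi> A B E P \<longleftrightarrow>
     (\<forall>x y z. expval \<psi> (tensor (tensor (A x) (B y)) (E z)) = complex_of_real (pmf P (x, y, z)))"


section \<open>Separable and bound entangled states\<close>

definition separable_state :: "complex^('a::finite \<times> 'b::finite)^('a \<times> 'b) \<Rightarrow> bool" where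
  "separable_state \<sigma> \<longleftrightarrow>
     (\<exists>(n::nat) (p :: nat \<Rightarrow> real) \<rho> \<tau>.
        (\<forall>i<n. 0 \<le> p i \<and> density_op (\<rho> i) \<and> density_op (\<tau> i)) \<and> (\<Sum>i<n. p i) = 1 \<and>
        \<sigma> = (\<Sum>i<n. p i *\<^sub>R tensor (\<rho> i) (\<tau> i)))"

text \<open>
  LOCC protocols change the local dimensions, so here the local spaces are \<open>\<complex>\<^sup>I\<close> and
  \<open>\<complex>\<^sup>J\<close> for finite index sets \<open>I\<close>, \<open>J\<close>, and an operator on the joint space is its kernel
  (only the entries indexed by \<open>I \<times> J\<close> matter). A Kraus operator from \<open>\<complex>\<^sup>I\<close> to
  \<open>\<complex>\<^sup>I\<^sup>'\<close> is given by its entries \<open>K w u\<close> with \<open>w \<in> I'\<close> and \<open>u \<in> I\<close>.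
\<close>

type_synonym ('i, 'j) kernel = "'i \<times> 'j \<Rightarrow> 'i \<times> 'j \<Rightarrow> complex"

definition kraus_complete :: "'i set \<Rightarrow> nat \<Rightarrow> (nat \<Rightarrow> 'i set) \<Rightarrow> (nat \<Rightarrow> 'i \<Rightarrow> 'i \<Rightarrow> complex) \<Rightarrow> bool" where
  "kraus_complete I k I' K \<longleftrightarrow> (\<forall>m<k. finite (I' m)) \<and>
     (\<forall>u\<in>I. \<forall>v\<in>I. (\<Sum>m<k. \<Sum>w\<in>I' m. cnj (K m w u) * K m w v) = (if u = v then 1 else 0))"

definition apply_alice :: "'i set \<Rightarrow> ('i \<Rightarrow> 'i \<Rightarrow> complex) \<Rightarrow> ('i, 'j) kernel \<Rightarrow> ('i, 'j) kernel" where
  "apply_alice I K \<rho> = (\<lambda>(w, j) (w', j'). \<Sum>u\<in>I. \<Sum>v\<in>I. K w u * \<rho> (u, j) (v, j') * cnj (K w' v))"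

definition apply_bob :: "'j set \<Rightarrow> ('j \<Rightarrow> 'j \<Rightarrow> complex) \<Rightarrow> ('i, 'j) kernel \<Rightarrow> ('i, 'j) kernel" where
  "apply_bob J L \<rho> = (\<lambda>(i, w) (i', w'). \<Sum>u\<in>J. \<Sum>v\<in>J. L w u * \<rho> (i, u) (i', v) * cnj (L w' v))"

text \<open>
  \<open>locc I J \<rho> I' J' \<tau>\<close>: some finite LOCC protocol turns \<open>\<rho>\<close> (on \<open>I \<times> J\<close>) into \<open>\<tau>\<close>
  (on \<open>I' \<times> J'\<close>). One party performs a measurement with Kraus operators \<open>K 0, \<dots>, K (k - 1)\<close>
  and announces the outcome \<open>m\<close>, the protocol goes on depending on \<open>m\<close>, and the final state is
  the sum of the unnormalised final states of the branches.
\<close>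

inductive locc :: "'i set \<Rightarrow> 'j set \<Rightarrow> ('i, 'j) kernel \<Rightarrow> 'i set \<Rightarrow> 'j set \<Rightarrow> ('i, 'j) kernel \<Rightarrow> bool"
where
  stop: "locc I J \<rho> I J \<rho>"
| alice: "\<lbrakk>kraus_complete I k I1 K; \<And>m. m < k \<Longrightarrow> locc (I1 m) J (apply_alice I (K m) \<rho>) I' J' (\<tau> m)\<rbrakk>
    \<Longrightarrow> locc I J \<rho> I' J' (\<lambda>p q. \<Sum>m<k. \<tau> m p q)"
| bob: "\<lbrakk>kraus_complete J k J1 L; \<And>m. m < k \<Longrightarrow> locc I (J1 m) (apply_bob J (L m) \<rho>) I' J' (\<tau> m)\<rbrakk>
    \<Longrightarrow> locc I J \<rho> I' J' (\<lambda>p q. \<Sum>m<k. \<tau> m p q)"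

text \<open>The kernel of \<open>\<sigma>\<^sup>\<otimes>\<^sup>n\<close> across the cut Alice's \<open>n\<close> systems : Bob's \<open>n\<close> systems.\<close>

definition copies :: "nat \<Rightarrow> complex^('a::finite \<times> 'b::finite)^('a \<times> 'b) \<Rightarrow> ('a list, 'b list) kernel" where
  "copies n \<sigma> = (\<lambda>(xs, ys) (xs', ys'). \<Prod>m<n. \<sigma> $ (xs ! m, ys ! m) $ (xs' ! m, ys' ! m))"

text \<open>Distillability: LOCC on sufficiently many copies yields a two-qubit state (on the index sets
  \<open>{a0, a1}\<close> and \<open>{b0, b1}\<close>) whose fidelity with the maximally entangled vector
  \<open>(|a0 b0> + |a1 b1>) / sqrt 2\<close> is arbitrarily close to one.\<close>

definition distillable :: "complex^('a::finite \<times> 'b::finite)^('a \<times> 'b) \<Rightarrow> bool" where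
  "distillable \<sigma> \<longleftrightarrow> (\<forall>\<epsilon>>0. \<exists>n a0 a1 b0 b1 \<tau>. a0 \<noteq> a1 \<and> b0 \<noteq> b1 \<and>
     locc {xs. length xs = n} {ys. length ys = n} (copies n \<sigma>) {a0, a1} {b0, b1} \<tau> \<and>
     Re (\<tau> (a0, b0) (a0, b0) + \<tau> (a0, b0) (a1, b1) + \<tau> (a1, b1) (a0, b0) + \<tau> (a1, b1) (a1, b1)) / 2
       \<ge> 1 - (\<epsilon>::real))"

definition bound_entangled :: "complex^('a::finite \<times> 'b::finite)^('a \<times> 'b) \<Rightarrow> bool" where
  "bound_entangled \<sigma> \<longleftrightarrow> density_op \<sigma> \<and> \<not> separable_state \<sigma> \<and> \<not> distillable \<sigma>"


section \<open>The family of states and the measurements\<close>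

text \<open>The labels on Eve's system: \<open>EUp i\<close> is the label \<open>i, i+1\<close> and \<open>EDown i\<close> is the label
  \<open>i+1, i\<close>. Arithmetic on the three-element type \<open>3\<close> is modulo three.\<close>

datatype env = EPhi | EUp 3 | EDown 3

lemma UNIV_env: "(UNIV :: env set) = insert EPhi (range EUp \<union> range EDown)"
  by (auto intro: env.exhaust)

instance env :: finite
  by standard (simp add: UNIV_env)

datatype eve_outcome = E0 | E1 | EBot

lemma UNIV_eve_outcome: "(UNIV :: eve_outcome set) = {E0, E1, EBot}"
  by (auto intro: eve_outcome.exhaust)

instance eve_outcome :: finite
  by standard (simp add: UNIV_eve_outcome)

definition ket2 :: "3 \<Rightarrow> 3 \<Rightarrow> complex^(3 \<times> 3)" where
  "ket2 i j = tensor_vec (ket i) (ket j)"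

definition Phi :: "complex^(3 \<times> 3)" where
  "Phi = (1 / sqrt 3) *\<^sub>R (ket2 0 0 + ket2 1 1 + ket2 2 2)"

definition Psi :: "real \<Rightarrow> complex^((3 \<times> 3) \<times> env)" where
  "Psi \<alpha> = (let \<beta> = 5 - \<alpha> in
     sqrt (2/7) *\<^sub>R tensor_vec Phi (ket EPhi)
     + sqrt (\<alpha>/21) *\<^sub>R (\<Sum>i\<in>UNIV. tensor_vec (ket2 i (i + 1)) (ket (EUp i)))
     + sqrt (\<beta>/21) *\<^sub>R (\<Sum>i\<in>UNIV. tensor_vec (ket2 (i + 1) i) (ket (EDown i))))"

definition sigma_state :: "real \<Rightarrow> complex^(3 \<times> 3)^(3 \<times> 3)" where
  "sigma_state \<alpha> = (let \<beta> = 5 - \<alpha> in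
     (2/7) *\<^sub>R ketbra Phi Phi
     + (\<alpha>/21) *\<^sub>R (\<Sum>i\<in>UNIV. ketbra (ket2 i (i + 1)) (ket2 i (i + 1)))
     + (\<beta>/21) *\<^sub>R (\<Sum>i\<in>UNIV. ketbra (ket2 (i + 1) i) (ket2 (i + 1) i)))"

text \<open>Binary outcomes are of type \<^typ>\<open>bool\<close>, with \<^const>\<open>False\<close> for 0 and \<^const>\<open>True\<close> for 1.\<close>

definition alice_povm :: "bool \<Rightarrow> complex^3^3" where
  "alice_povm x = (let A0 = diag (\<lambda>i. if i = 0 then 0 else if i = 1 then 1/2 else 1)
     in if x then mat 1 - A0 else A0)"

definition bob_povm :: "bool \<Rightarrow> complex^3^3" where
  "bob_povm y = (let B0 = diag (\<lambda>i. if i = 0 then 1 else if i = 1 then 1/2 else 0)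
     in if y then mat 1 - B0 else B0)"

definition q_eve :: "real \<Rightarrow> eve_outcome \<Rightarrow> env \<Rightarrow> real" where
  "q_eve \<alpha> z k = (let \<beta> = 5 - \<alpha>;
     q0 = (if k = EUp 2 then 1 / (10 * \<alpha>) else if k = EDown 0 \<or> k = EDown 1 then 1 / \<beta> else 0);
     q1 = (if k = EUp 0 \<or> k = EUp 1 then 1 / \<alpha> else if k = EDown 2 then 1 / (10 * \<beta>) else 0)
     in case z of E0 \<Rightarrow> q0 | E1 \<Rightarrow> q1 | EBot \<Rightarrow> 1 - q0 - q1)"

definition eve_povm :: "real \<Rightarrow> eve_outcome \<Rightarrow> complex^env^env" where
  "eve_povm \<alpha> z = (\<Sum>k\<in>UNIV. q_eve \<alpha> z k *\<^sub>R ketbra (ket k) (ket k))"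

text \<open>\<open>M_law z x y\<close> is the entry of the matrix \<open>M\<^sub>z\<close> in row \<open>x\<close> and column \<open>y\<close>.\<close>

fun M_law :: "eve_outcome \<Rightarrow> bool \<Rightarrow> bool \<Rightarrow> real" where
  "M_law E0 False False = 11/210"
| "M_law E0 False True  = 1/42"
| "M_law E0 True  False = 1/42"
| "M_law E0 True  True  = 0"
| "M_law E1 False False = 0"
| "M_law E1 False True  = 1/42"
| "M_law E1 True  False = 1/42"
| "M_law E1 True  True  = 11/210"
| "M_law EBot False False = 22/105"
| "M_law EBot False True  = 4/21"
| "M_law EBot True  False = 4/21"
| "M_law EBot True  True  = 22/105"

definition purification_produces ::
  "complex^('a::finite \<times> 'b::finite)^('a \<times> 'b) \<Rightarrow> ('x::finite \<times> 'y::finite \<times> 'z::finite) pmf \<Rightarrow> bool" where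
  "purification_produces \<sigma> P \<longleftrightarrow>
     (\<exists>(\<psi> :: complex^(('a \<times> 'b) \<times> env)) A B E. is_purification \<psi> \<sigma> \<and>
        is_povm A \<and> is_povm B \<and> is_povm E \<and> has_outcome_law \<psi> A B E P)"


section \<open>Information quantities of discrete distributions\<close>

text \<open>The types of the random variables are countable, so that the library notions relative to
  counting measure are the discrete ones.\<close>

definition Hent :: "'s pmf \<Rightarrow> ('s \<Rightarrow> 'u::countable) \<Rightarrow> real" where
  "Hent p U = prob_space.entropy (measure_pmf p) 2 (count_space UNIV) U"

definition mutual_info :: "'s pmf \<Rightarrow> ('s \<Rightarrow> 'u::countable) \<Rightarrow> ('s \<Rightarrow> 'v::countable) \<Rightarrow> real" where
  "mutual_info p U V =
     prob_space.mutual_information (measure_pmf p) 2 (count_space UNIV) (count_space UNIV) U V"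

definition cond_mutual_info ::
  "'s pmf \<Rightarrow> ('s \<Rightarrow> 'u::countable) \<Rightarrow> ('s \<Rightarrow> 'v::countable) \<Rightarrow> ('s \<Rightarrow> 'w::countable) \<Rightarrow> real" where
  "cond_mutual_info p U V W =
     prob_space.conditional_mutual_information (measure_pmf p) 2
       (count_space UNIV) (count_space UNIV) (count_space UNIV) U V W"

definition tv_dist :: "'s pmf \<Rightarrow> 's pmf \<Rightarrow> real" where
  "tv_dist p p' = (SUP S. \<bar>measure_pmf.prob p S - measure_pmf.prob p' S\<bar>)"

text \<open>Channels into finite alphabets; every finite alphabet is encoded as a set of values of the
  output type, which is infinite in all uses below.\<close>

definition finite_channel :: "('z \<Rightarrow> 'w pmf) \<Rightarrow> bool" where
  "finite_channel W \<longleftrightarrow> (\<forall>z. finite (set_pmf (W z)))"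

definition apply_channel :: "('x \<times> 'y \<times> 'z) pmf \<Rightarrow> ('z \<Rightarrow> 'w pmf) \<Rightarrow> ('x \<times> 'y \<times> 'w) pmf" where
  "apply_channel P W = do {(x, y, z) \<leftarrow> P; w \<leftarrow> W z; return_pmf (x, y, w)}"

definition intrinsic_information :: "('x::finite \<times> 'y::finite \<times> 'z::finite) pmf \<Rightarrow> real" where
  "intrinsic_information P =
     (INF W \<in> {W :: 'z \<Rightarrow> nat pmf. finite_channel W}.
        cond_mutual_info (apply_channel P W) (\<lambda>(x, y, w). x) (\<lambda>(x, y, w). y) (\<lambda>(x, y, w). w))"

definition iid :: "nat \<Rightarrow> ('x \<times> 'y \<times> 'z) pmf \<Rightarrow> ('x list \<times> 'y list \<times> 'z list) pmf" where
  "iid n P = map_pmf (\<lambda>s. (map fst s, map (fst \<circ> snd) s, map (snd \<circ> snd) s)) (replicate_pmf n P)"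


section \<open>Public discussion\<close>

text \<open>Messages and seeds are encoded as natural numbers. Alice speaks in rounds \<open>0, 2, \<dots>\<close>, Bob in
  rounds \<open>1, 3, \<dots>\<close>; a constant message stands for silence.\<close>

fun transcript :: "nat \<Rightarrow> (nat list \<Rightarrow> nat) \<Rightarrow> (nat list \<Rightarrow> nat) \<Rightarrow> nat list" where
  "transcript 0 f g = []"
| "transcript (Suc r) f g =
     (let h = transcript r f g in h @ [if even r then f h else g h])"

record ('a, 'b, 'k, 'l) protocol =
  rounds :: nat
  seedA :: "nat pmf"
  seedB :: "nat pmf"
  msgA :: "'a \<Rightarrow> nat \<Rightarrow> nat list \<Rightarrow> nat"
  msgB :: "'b \<Rightarrow> nat \<Rightarrow> nat list \<Rightarrow> nat"
  outA :: "'a \<Rightarrow> nat \<Rightarrow> nat list \<Rightarrow> 'k"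
  outB :: "'b \<Rightarrow> nat \<Rightarrow> nat list \<Rightarrow> 'l"

text \<open>Finite seed alphabets are no restriction: there are only finitely many deterministic
  strategies with given finite data and message alphabets and a given number of rounds.\<close>

definition finite_seeds :: "('a, 'b, 'k, 'l) protocol \<Rightarrow> bool" where
  "finite_seeds \<pi> \<longleftrightarrow> finite (set_pmf (seedA \<pi>)) \<and> finite (set_pmf (seedB \<pi>))"

text \<open>The joint law of Alice's output, Bob's output, the public transcript and the side
  information \<open>c\<close>, when the data of Alice, the data of Bob and \<open>c\<close> have joint law \<open>D\<close>.\<close>

definition run :: "('a, 'b, 'k, 'l) protocol \<Rightarrow> ('a \<times> 'b \<times> 'c) pmf \<Rightarrow> ('k \<times> 'l \<times> nat list \<times> 'c) pmf" where
  "run \<pi> D = do {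
     (a, b, c) \<leftarrow> D;
     r \<leftarrow> seedA \<pi>;
     s \<leftarrow> seedB \<pi>;
     let F = transcript (rounds \<pi>) (msgA \<pi> a r) (msgB \<pi> b s);
     return_pmf (outA \<pi> a r F, outB \<pi> b s F, F, c)}"


section \<open>Secret-key rate\<close>

definition admissible ::
  "('x::finite \<times> 'y::finite \<times> 'z::finite) pmf \<Rightarrow>
   (nat \<Rightarrow> ('x list, 'y list, nat, nat) protocol) \<Rightarrow> (nat \<Rightarrow> nat set) \<Rightarrow> bool" where
  "admissible P \<pi> K \<longleftrightarrow>
     (\<forall>n. finite_seeds (\<pi> n) \<and> finite (K n) \<and>
        (\<forall>a r F. outA (\<pi> n) a r F \<in> K n) \<and> (\<forall>b s F. outB (\<pi> n) b s F \<in> K n)) \<and>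
     (\<lambda>n. measure_pmf.prob (run (\<pi> n) (iid n P)) {(kA, kB, F, zs). kA = kB}) \<longlonglongrightarrow> 1 \<and>
     (\<lambda>n. log 2 (real (card (K n))) - Hent (run (\<pi> n) (iid n P)) (\<lambda>(kA, kB, F, zs). kA)) \<longlonglongrightarrow> 0 \<and>
     (\<lambda>n. mutual_info (run (\<pi> n) (iid n P))
        (\<lambda>(kA, kB, F, zs). kA) (\<lambda>(kA, kB, F, zs). (zs, F))) \<longlonglongrightarrow> 0"

definition key_rate :: "(nat \<Rightarrow> nat set) \<Rightarrow> ereal" where
  "key_rate K = liminf (\<lambda>n. ereal (log 2 (real (card (K n))) / real n))"

definition secret_key_rate :: "('x::finite \<times> 'y::finite \<times> 'z::finite) pmf \<Rightarrow> ereal" where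
  "secret_key_rate P = Sup {key_rate K | \<pi> K. admissible P \<pi> K}"


section \<open>Formation cost\<close>

definition shared_bits :: "nat \<Rightarrow> (bool list \<times> bool list \<times> unit) pmf" where
  "shared_bits l = map_pmf (\<lambda>s. (s, s, ())) (pmf_of_set {s. length s = l})"

definition formation_rate_achievable :: "('x::finite \<times> 'y::finite \<times> 'z::finite) pmf \<Rightarrow> real \<Rightarrow> bool" where
  "formation_rate_achievable P R \<longleftrightarrow> (\<forall>\<epsilon>>0. \<forall>\<^sub>F N in sequentially.
     \<exists>(\<pi> :: (bool list, bool list, 'x list, 'y list) protocol) (W :: 'z list \<Rightarrow> nat list pmf).
       finite_seeds \<pi> \<and> finite_channel W \<and>
       tv_dist
         (map_pmf (\<lambda>(xs, ys, C, _). (xs, ys, C)) (run \<pi> (shared_bits (nat \<lfloor>R * real N\<rfloor>))))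
         (apply_channel (iid N P) W) \<le> \<epsilon>)"

definition formation_cost :: "('x::finite \<times> 'y::finite \<times> 'z::finite) pmf \<Rightarrow> ereal" where
  "formation_cost P = Inf {ereal R | R. 0 \<le> R \<and> formation_rate_achievable P R}"

end

(*
Secret-key rate. Eve's variable Z is an erased version (erasure probability 4/5) of a bit W with
P(x, y | w) proportional to (11, 5; 5, 0) for w = 0 and to (0, 5; 5, 11) for w = 1. Sending W through a
binary symmetric channel with 4 p (1 - p) = 100/121 instead gives J with X - J - Y a Markov chain.
The squared correlation 21/121 of that channel is below 1/5, so Z is less noisy than J: it tells at
least as much about every variable behind W. A key that is secret from Z is then secret from J, and a
key about which J leaves the two parties uncorrelated has bounded length.

Intrinsic information. A value of the processed Z with weights (a, b, c) of the three matrices makes X and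
Y independent only on 21 (a + b + 8 c)^2 = 121 (a - b)^2, and the positive part of the difference cannot
vanish on average.

Formation cost. The intrinsic information is superadditive over letters, the conditional mutual information of
the outputs given the transcript is at most the number of shared bits. Two laws at distance epsilon share a
measure of mass 1 - epsilon, and splitting off the rest changes the information by O(1) + epsilon N.

States. LOCC preserves positivity of the partial transpose, which bounds the fidelity by 1/2; Choi's map
detects the entanglement for alpha > 3; for alpha <= 3 the state is a mixture of an average of product
states over phases with diagonal product states.
*)

theory Submission
  imports Defs
begin

section \<open>Entropy of finitely supported weights\<close>

text \<open>J is not a degraded version of Z: were it the image of Z under a channel, the intrinsic
  information would vanish. The example lives between two orders on channels. That U has smaller
  entropy given Z than given J, for every U behind W, is weaker than degradation but still survives
  public discussion. For an erasure channel that keeps its letter with probability 1/5 and a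
  symmetric channel of correlation c, this comparison is a convexity statement, and c^2 <= 1/5 is
  its second-derivative condition. The value 25/121 of p (1 - p) is forced by independence of X and
  Y given J. For the intrinsic information, an infimum over channels of unbounded output size need
  not be attained, so excluding the value zero channel by channel is not enough. The local bound is
  therefore linear in the transition probabilities, whose sums are known. Entropies are defined for
  arbitrary nonnegative weights because the formation cost cuts laws into pieces of mass below one,
  and as finite sums because every law that occurs has finite support.\<close>

definition mass :: "'s set \<Rightarrow> ('s \<Rightarrow> real) \<Rightarrow> ('s \<Rightarrow> 'u) \<Rightarrow> 'u \<Rightarrow> real" where
  "mass A w U u = (\<Sum>s\<in>{s\<in>A. U s = u}. w s)"

text \<open>The sum runs over sample points rather than over values of \<open>U\<close>, so that
  identities between several entropies can be proved summand by summand.\<close>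

definition ent :: "'s set \<Rightarrow> ('s \<Rightarrow> real) \<Rightarrow> ('s \<Rightarrow> 'u) \<Rightarrow> real" where
  "ent A w U = - (\<Sum>s\<in>A. w s * log 2 (mass A w U (U s)))"

definition cmi :: "'s set \<Rightarrow> ('s \<Rightarrow> real) \<Rightarrow> ('s \<Rightarrow> 'u) \<Rightarrow> ('s \<Rightarrow> 'v) \<Rightarrow> ('s \<Rightarrow> 'c) \<Rightarrow> real" where
  "cmi A w U V C = ent A w (\<lambda>s. (U s, C s)) + ent A w (\<lambda>s. (V s, C s))
     - ent A w (\<lambda>s. (U s, V s, C s)) - ent A w C"

lemma sum_by_mass:
  assumes "finite A"
  shows "(\<Sum>s\<in>A. w s * f (U s)) = (\<Sum>u\<in>U ` A. mass A w U u * f u)"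
  unfolding mass_def sum_distrib_right
  by (subst sum.image_gen[OF assms, of _ U]) (auto intro!: sum.cong)

lemma sum_mass:
  assumes "finite A"
  shows "(\<Sum>u\<in>U ` A. mass A w U u) = sum w A"
  using sum_by_mass[OF assms, of w "\<lambda>_. 1" U] by simp

lemma sum_mass_superset:
  assumes "finite T" "finite A" "U ` A \<subseteq> T"
  shows "(\<Sum>u\<in>T. mass A w U u * f u) = (\<Sum>u\<in>U ` A. mass A w U u * f u)"
proof (rule sum.mono_neutral_right[OF assms(1,3)], rule ballI)
  fix u assume "u \<in> T - U ` A"
  hence "{s\<in>A. U s = u} = {}" by auto
  thus "mass A w U u * f u = 0" unfolding mass_def by (metis mult_zero_left sum.empty)
qed

lemma ent_by_mass:
  assumes "finite T" "finite A" "U ` A \<subseteq> T"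
  shows "ent A w U = - (\<Sum>u\<in>T. mass A w U u * log 2 (mass A w U u))"
  unfolding ent_def
  by (subst sum_by_mass[OF assms(2)], subst sum_mass_superset[OF assms]) simp

text \<open>Entropy sees only the partition into level sets. Regrouped tuples and injective
  encodings by \<open>to_nat\<close> are exchanged freely on this ground.\<close>

lemma ent_cong:
  assumes "\<And>s t. s \<in> A \<Longrightarrow> t \<in> A \<Longrightarrow> U s = U t \<longleftrightarrow> V s = V t"
  shows "ent A w U = ent A w V"
proof -
  have "mass A w U (U s) = mass A w V (V s)" if "s \<in> A" for s
    unfolding mass_def using assms that by (intro sum.cong) auto
  thus ?thesis by (simp add: ent_def cong: sum.cong)
qed

lemma ent_const: "ent A w (\<lambda>_. c) = - (sum w A * log 2 (sum w A))"
  by (simp add: ent_def mass_def sum_distrib_right)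

text \<open>From ln q <= q - 1. In the uses \<open>q\<close> is the ratio of a guessed mass to the
  true one; \<open>cmi_nonneg\<close>, \<open>ent_cond_le\<close> and \<open>fano\<close> differ
  only in the guess.\<close>

lemma gibbs:
  assumes "\<And>s. s \<in> A \<Longrightarrow> 0 \<le> w s" "\<And>s. s \<in> A \<Longrightarrow> 0 < w s \<Longrightarrow> 0 < q s"
    and "(\<Sum>s\<in>A. w s * q s) \<le> sum w A"
  shows "(\<Sum>s\<in>A. w s * log 2 (q s)) \<le> 0"
proof -
  have "(\<Sum>s\<in>A. w s * log 2 (q s)) \<le> (\<Sum>s\<in>A. w s * ((q s - 1) / ln 2))"
  proof (rule sum_mono)
    fix s assume s: "s \<in> A"
    show "w s * log 2 (q s) \<le> w s * ((q s - 1) / ln 2)"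
    proof (cases "w s = 0")
      case False
      hence "0 < q s" using assms(1,2)[OF s] by auto
      hence "log 2 (q s) \<le> (q s - 1) / ln 2"
        using ln_le_minus_one[of "q s"] by (simp add: log_def divide_right_mono)
      thus ?thesis using assms(1)[OF s] by (rule mult_left_mono)
    qed simp
  qed
  also have "\<dots> = ((\<Sum>s\<in>A. w s * q s) - sum w A) / ln 2"
    by (simp add: sum_subtractf sum_divide_distrib right_diff_distrib diff_divide_distrib)
  also have "\<dots> \<le> 0" using assms(3) by (simp add: divide_nonpos_pos)
  finally show ?thesis .
qed

locale weights =
  fixes A :: "'s set" and w :: "'s \<Rightarrow> real"
  assumes fin[simp]: "finite A" and nn: "s \<in> A \<Longrightarrow> 0 \<le> w s"
begin

lemma mass_nonneg [simp]: "0 \<le> mass A w U u"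
  unfolding mass_def by (rule sum_nonneg) (auto intro: nn)

lemma mass_ge: "s \<in> A \<Longrightarrow> w s \<le> mass A w U (U s)"
  unfolding mass_def by (rule member_le_sum) (auto intro: nn)

lemma mass_pos: "s \<in> A \<Longrightarrow> 0 < w s \<Longrightarrow> 0 < mass A w U (U s)"
  using mass_ge[of s U] by linarith

lemma mass_mono:
  assumes "\<And>s. s \<in> A \<Longrightarrow> U s = u \<Longrightarrow> V s = v"
  shows "mass A w U u \<le> mass A w V v"
  unfolding mass_def by (rule sum_mono2) (auto intro: nn assms)

lemma sum_mass_pair:
  "(\<Sum>u\<in>U ` A. mass A w (\<lambda>s. (U s, V s)) (u, v)) = mass A w V v"
proof -
  have "mass A w V v = (\<Sum>u\<in>U ` {s\<in>A. V s = v}. \<Sum>s\<in>{s\<in>{s\<in>A. V s = v}. U s = u}. w s)"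
    unfolding mass_def by (rule sum.image_gen) simp
  also have "\<dots> = (\<Sum>u\<in>U ` A. \<Sum>s\<in>{s\<in>{s\<in>A. V s = v}. U s = u}. w s)"
  proof (rule sum.mono_neutral_left, simp, blast, rule ballI)
    fix u assume "u \<in> U ` A - U ` {s\<in>A. V s = v}"
    hence "U s \<noteq> u" if "s \<in> A" "V s = v" for s
      using that by (auto simp: image_iff)
    hence "{s\<in>{s\<in>A. V s = v}. U s = u} = {}" by auto
    thus "(\<Sum>s\<in>{s\<in>{s\<in>A. V s = v}. U s = u}. w s) = 0" by (metis sum.empty)
  qed
  also have "\<dots> = (\<Sum>u\<in>U ` A. mass A w (\<lambda>s. (U s, V s)) (u, v))"
    unfolding mass_def by (intro sum.cong) auto
  finally show ?thesis by simp
qed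

text \<open>Factors of \<^term>\<open>mass A w U\<close> in the denominator cancel after grouping by the value of \<open>U\<close>.\<close>

lemma sum_ratio_le:
  assumes "finite T" "U ` A \<subseteq> T" and "\<And>u. u \<in> T \<Longrightarrow> 0 \<le> r u"
  shows "(\<Sum>s\<in>A. w s * (r (U s) / mass A w U (U s))) \<le> (\<Sum>u\<in>T. r u)"
proof -
  have "(\<Sum>s\<in>A. w s * (r (U s) / mass A w U (U s))) = (\<Sum>u\<in>U ` A. mass A w U u * (r u / mass A w U u))"
    by (rule sum_by_mass) simp
  also have "\<dots> \<le> (\<Sum>u\<in>U ` A. r u)"
    by (rule sum_mono) (use assms in auto)
  also have "\<dots> \<le> (\<Sum>u\<in>T. r u)"
    using assms by (intro sum_mono2) auto
  finally show ?thesis .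
qed

lemma cmi_nonneg: "0 \<le> cmi A w U V C"
proof -
  let ?UC = "\<lambda>s. (U s, C s)" and ?VC = "\<lambda>s. (V s, C s)" and ?UVC = "\<lambda>s. (U s, V s, C s)"
  \<comment> \<open>The guess keeps the laws of \<open>(U, C)\<close> and \<open>(V, C)\<close> and
    makes \<open>U\<close> and \<open>V\<close> independent given \<open>C\<close>.\<close>
  define r where "r = (\<lambda>(u, v, c). mass A w ?UC (u, c) * mass A w ?VC (v, c) / mass A w C c)"
  define q where "q s = r (?UVC s) / mass A w ?UVC (?UVC s)" for s
  let ?T = "U ` A \<times> V ` A \<times> C ` A"
  have r0: "0 \<le> r t" for t by (simp add: r_def split: prod.split)
  have "(\<Sum>s\<in>A. w s * q s) \<le> (\<Sum>t\<in>?T. r t)"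
    unfolding q_def by (rule sum_ratio_le) (auto simp: r0)
  also have "\<dots> = (\<Sum>c\<in>C ` A. \<Sum>u\<in>U ` A. \<Sum>v\<in>V ` A. r (u, v, c))"
    unfolding sum.cartesian_product' by (subst sum.swap[where A = "C ` A"]) (intro sum.cong refl sum.swap)
  also have "\<dots> = (\<Sum>c\<in>C ` A. mass A w C c)"
  proof (rule sum.cong[OF refl])
    fix c
    have "(\<Sum>u\<in>U ` A. \<Sum>v\<in>V ` A. r (u, v, c)) =
       (\<Sum>u\<in>U ` A. mass A w ?UC (u, c)) * (\<Sum>v\<in>V ` A. mass A w ?VC (v, c)) / mass A w C c"
      by (simp add: r_def sum_product sum_divide_distrib)
    thus "(\<Sum>u\<in>U ` A. \<Sum>v\<in>V ` A. r (u, v, c)) = mass A w C c"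
      by (simp add: sum_mass_pair)
  qed
  also have "\<dots> = sum w A" by (simp add: sum_mass)
  finally have *: "(\<Sum>s\<in>A. w s * q s) \<le> sum w A" .
  have "(\<Sum>s\<in>A. w s * log 2 (q s)) \<le> 0"
  proof (rule gibbs[OF nn _ *])
    fix s assume "s \<in> A" "0 < w s"
    note p = mass_pos[OF this]
    show "0 < q s" using p[of ?UC] p[of ?VC] p[of ?UVC] p[of C] by (simp add: q_def r_def)
  qed
  moreover have "(\<Sum>s\<in>A. w s * log 2 (q s)) = (\<Sum>s\<in>A. w s * log 2 (mass A w ?UC (?UC s))
      + w s * log 2 (mass A w ?VC (?VC s)) - w s * log 2 (mass A w ?UVC (?UVC s)) - w s * log 2 (mass A w C (C s)))"
  proof (rule sum.cong[OF refl])
    fix s assume s: "s \<in> A"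
    show "w s * log 2 (q s) = w s * log 2 (mass A w ?UC (?UC s))
      + w s * log 2 (mass A w ?VC (?VC s)) - w s * log 2 (mass A w ?UVC (?UVC s)) - w s * log 2 (mass A w C (C s))"
    proof (cases "w s = 0")
      case False
      hence "0 < w s" using nn[OF s] by auto
      note p = mass_pos[OF s this]
      have lq: "log 2 (q s) = log 2 (mass A w ?UC (?UC s)) + log 2 (mass A w ?VC (?VC s))
         - log 2 (mass A w C (C s)) - log 2 (mass A w ?UVC (?UVC s))"
        using p[of ?UC] p[of ?VC] p[of ?UVC] p[of C]
        by (simp add: q_def r_def log_divide log_mult)
      show ?thesis unfolding lq by (auto simp: algebra_simps)
    qed simp
  qed
  ultimately show ?thesis
    by (simp add: cmi_def ent_def sum.distrib sum_subtractf)
qed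

lemma ent_mono: "ent A w U \<le> ent A w (\<lambda>s. (U s, V s))"
proof -
  have "(\<Sum>s\<in>A. w s * log 2 (mass A w (\<lambda>s. (U s, V s)) (U s, V s)))
      \<le> (\<Sum>s\<in>A. w s * log 2 (mass A w U (U s)))"
  proof (rule sum_mono)
    fix s assume s: "s \<in> A"
    show "w s * log 2 (mass A w (\<lambda>s. (U s, V s)) (U s, V s)) \<le> w s * log 2 (mass A w U (U s))"
    proof (cases "w s = 0")
      case False
      hence "0 < w s" using nn[OF s] by auto
      note p = mass_pos[OF s this]
      have "log 2 (mass A w (\<lambda>s. (U s, V s)) (U s, V s)) \<le> log 2 (mass A w U (U s))"
        using p[of "\<lambda>s. (U s, V s)"] p[of U] by (subst log_le_cancel_iff) (auto intro: mass_mono)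
      thus ?thesis by (rule mult_left_mono) (rule nn[OF s])
    qed simp
  qed
  thus ?thesis by (simp add: ent_def)
qed

lemma ent_cond_le:
  fixes U :: "'s \<Rightarrow> 'u" and C :: "'s \<Rightarrow> 'c"
  assumes T: "finite T" "U ` A \<subseteq> T" "T \<noteq> {}"
  shows "ent A w (\<lambda>s. (U s, C s)) - ent A w C \<le> sum w A * log 2 (real (card T))"
proof -
  let ?UC = "\<lambda>s. (U s, C s)"
  have n: "0 < real (card T)" using T by (simp add: card_gt_0_iff)
  \<comment> \<open>The guess is uniform on \<open>T\<close>, independently of
    \<open>C\<close>.\<close>
  define r where "r = (\<lambda>(u::'u, c). mass A w C c / card T)"
  define q where "q s = r (?UC s) / mass A w ?UC (?UC s)" for s
  have "(\<Sum>s\<in>A. w s * q s) \<le> (\<Sum>t\<in>T \<times> C ` A. r t)"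
    unfolding q_def by (rule sum_ratio_le) (use T in \<open>auto simp: r_def\<close>)
  also have "\<dots> = (\<Sum>u\<in>T. \<Sum>c\<in>C ` A. mass A w C c / card T)"
    by (simp add: sum.cartesian_product' r_def)
  also have "\<dots> = sum w A" using n by (simp add: sum_mass flip: sum_divide_distrib)
  finally have *: "(\<Sum>s\<in>A. w s * q s) \<le> sum w A" .
  have "(\<Sum>s\<in>A. w s * log 2 (q s)) \<le> 0"
  proof (rule gibbs[OF nn _ *])
    fix s assume "s \<in> A" "0 < w s"
    note p = mass_pos[OF this]
    show "0 < q s" using p[of ?UC] p[of C] n by (simp add: q_def r_def)
  qed
  moreover have "(\<Sum>s\<in>A. w s * log 2 (q s)) = (\<Sum>s\<in>A. w s * log 2 (mass A w C (C s))
      - w s * log 2 (mass A w ?UC (?UC s)) - w s * log 2 (real (card T)))"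
  proof (rule sum.cong[OF refl])
    fix s assume s: "s \<in> A"
    show "w s * log 2 (q s) = w s * log 2 (mass A w C (C s))
      - w s * log 2 (mass A w ?UC (?UC s)) - w s * log 2 (real (card T))"
    proof (cases "w s = 0")
      case False
      hence "0 < w s" using nn[OF s] by auto
      note p = mass_pos[OF s this]
      have lq: "log 2 (q s) = log 2 (mass A w C (C s)) - log 2 (real (card T)) - log 2 (mass A w ?UC (?UC s))"
        using p[of ?UC] p[of C] n by (simp add: q_def r_def log_divide log_mult)
      show ?thesis unfolding lq by (auto simp: algebra_simps)
    qed simp
  qed
  ultimately show ?thesis
    by (simp add: ent_def sum.distrib sum_subtractf sum_distrib_right)
qed

text \<open>Gibbs' inequality with the guess that \<open>U = V\<close> has weight one half and that all other values of
  \<open>U\<close> are equally likely.\<close>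

lemma fano:
  fixes U V :: "'s \<Rightarrow> 'u"
  assumes T: "finite T" "U ` A \<subseteq> T" "T \<noteq> {}"
  shows "ent A w (\<lambda>s. (U s, V s)) - ent A w V
    \<le> sum w A + (\<Sum>s\<in>{s\<in>A. U s \<noteq> V s}. w s) * log 2 (real (card T))"
proof -
  let ?UV = "\<lambda>s. (U s, V s)"
  have n: "0 < real (card T)" using T by (simp add: card_gt_0_iff)
  define g where "g = (\<lambda>(u :: 'u, v). if u = v then 1 / 2 else 1 / (2 * real (card T)))"
  define r where "r = (\<lambda>(u, v). mass A w V v * g (u, v))"
  define q where "q s = r (?UV s) / mass A w ?UV (?UV s)" for s
  have g: "(\<Sum>u\<in>T. g (u, v)) \<le> 1" for v
  proof -
    have "(\<Sum>u\<in>T. g (u, v)) \<le> (\<Sum>u\<in>T. (if u = v then 1 / 2 else 0) + 1 / (2 * real (card T)))"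
      by (rule sum_mono) (auto simp: g_def)
    also have "\<dots> \<le> 1" using n T(1) by (simp add: sum.distrib)
    finally show ?thesis .
  qed
  have "(\<Sum>s\<in>A. w s * q s) \<le> (\<Sum>t\<in>T \<times> V ` A. r t)"
    unfolding q_def by (rule sum_ratio_le) (use T in \<open>auto simp: r_def g_def\<close>)
  also have "\<dots> = (\<Sum>v\<in>V ` A. mass A w V v * (\<Sum>u\<in>T. g (u, v)))"
    unfolding sum.cartesian_product' by (subst sum.swap) (simp add: r_def sum_distrib_left)
  also have "\<dots> \<le> (\<Sum>v\<in>V ` A. mass A w V v)"
    using g by (intro sum_mono mult_left_le) auto
  also have "\<dots> = sum w A" by (simp add: sum_mass)
  finally have *: "(\<Sum>s\<in>A. w s * q s) \<le> sum w A" .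
  have "(\<Sum>s\<in>A. w s * log 2 (q s)) \<le> 0"
  proof (rule gibbs[OF nn _ *])
    fix s assume "s \<in> A" "0 < w s"
    note p = mass_pos[OF this]
    show "0 < q s" using p[of ?UV] p[of V] n by (simp add: q_def r_def g_def)
  qed
  moreover have "(\<Sum>s\<in>A. w s * log 2 (q s)) = (\<Sum>s\<in>A. w s * log 2 (mass A w V (V s))
      - w s * log 2 (mass A w ?UV (?UV s)) - w s - (if U s \<noteq> V s then w s * log 2 (real (card T)) else 0))"
  proof (rule sum.cong[OF refl])
    fix s assume s: "s \<in> A"
    show "w s * log 2 (q s) = w s * log 2 (mass A w V (V s))
      - w s * log 2 (mass A w ?UV (?UV s)) - w s - (if U s \<noteq> V s then w s * log 2 (real (card T)) else 0)"
    proof (cases "w s = 0")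
      case False
      hence "0 < w s" using nn[OF s] by auto
      note p = mass_pos[OF s this]
      have lq: "log 2 (q s) = log 2 (mass A w V (V s)) - 1 - (if U s \<noteq> V s then log 2 (real (card T)) else 0)
         - log 2 (mass A w ?UV (?UV s))"
        using p[of ?UV] p[of V] n by (auto simp: q_def r_def g_def log_divide log_mult)
      show ?thesis unfolding lq by (auto simp: algebra_simps)
    qed simp
  qed
  moreover have "(\<Sum>s\<in>A. if U s \<noteq> V s then w s * log 2 (real (card T)) else 0) =
      (\<Sum>s\<in>{s\<in>A. U s \<noteq> V s}. w s) * log 2 (real (card T))"
    by (simp add: sum.If_cases sum_distrib_right Int_def cong: if_cong)
  ultimately show ?thesis
    by (simp add: ent_def sum.distrib sum_subtractf sum_distrib_right)
qed

text \<open>I(U;V|C) is H(U|C) minus H(U|V,C), and the latter is nonnegative. The bound scales with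
  the total weight, which makes a piece of mass epsilon cheap in
  \<open>pcmi_continuity\<close>.\<close>

lemma cmi_le_card:
  assumes T: "finite T" "U ` A \<subseteq> T" "T \<noteq> {}"
  shows "cmi A w U V C \<le> sum w A * log 2 (real (card T))"
proof -
  have "ent A w (\<lambda>s. (V s, C s)) \<le> ent A w (\<lambda>s. ((V s, C s), U s))" by (rule ent_mono)
  also have "\<dots> = ent A w (\<lambda>s. (U s, V s, C s))" by (rule ent_cong) auto
  finally show ?thesis using ent_cond_le[OF T, of C] by (simp add: cmi_def)
qed

end

section \<open>Entropy of finitely supported laws\<close>

lemma mass_superset:
  assumes "finite B" "A \<subseteq> B" "\<forall>s\<in>B - A. w s = 0"
  shows "mass B w U u = mass A w U u"
  unfolding mass_def by (rule sum.mono_neutral_right) (use assms in auto)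

lemma ent_superset:
  assumes "finite B" "A \<subseteq> B" "\<forall>s\<in>B - A. w s = 0"
  shows "ent B w U = ent A w U"
proof -
  have "(\<Sum>s\<in>B. w s * log 2 (mass A w U (U s))) = (\<Sum>s\<in>A. w s * log 2 (mass A w U (U s)))"
    by (rule sum.mono_neutral_right) (use assms in auto)
  thus ?thesis by (simp add: ent_def mass_superset[OF assms])
qed

lemma cmi_superset:
  assumes "finite B" "A \<subseteq> B" "\<forall>s\<in>B - A. w s = 0"
  shows "cmi B w U V C = cmi A w U V C"
  by (simp add: cmi_def ent_superset[OF assms])

lemma xlog_superadditive:
  fixes a b :: real
  assumes "0 \<le> a" "0 \<le> b"
  shows "a * log 2 a + b * log 2 b \<le> (a + b) * log 2 (a + b)"
proof -
  have "x * log 2 x \<le> x * log 2 (x + y)" if "0 \<le> x" "0 \<le> y" for x y :: real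
    by (cases "x = 0") (use that in \<open>auto intro!: mult_left_mono\<close>)
  from this[of a b] this[of b a] assms show ?thesis
    by (simp add: algebra_simps)
qed

text \<open>The defect is \<open>a + b\<close> times the binary entropy of a/(a+b), hence at most
  one bit per unit of mass. The tangent estimate is applied at the ratios of the average to
  \<open>a\<close> and to \<open>b\<close>, where the errors cancel.\<close>

lemma xlog_almost_subadditive:
  fixes a b :: real
  assumes "0 \<le> a" "0 \<le> b"
  shows "(a + b) * log 2 (a + b) \<le> a * log 2 a + b * log 2 b + (a + b)"
proof (cases "a = 0 \<or> b = 0")
  case True thus ?thesis using assms by auto
next
  case False
  hence ab: "0 < a" "0 < b" using assms by auto
  have 1: "x * log 2 ((a + b) / (2 * x)) \<le> ((a + b) / 2 - x) / ln 2" if "0 < x" for x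
  proof -
    have "log 2 ((a + b) / (2 * x)) \<le> ((a + b) / (2 * x) - 1) / ln 2"
      using ln_le_minus_one[of "(a + b) / (2 * x)"] ab that
      by (simp add: log_def divide_right_mono)
    hence "x * log 2 ((a + b) / (2 * x)) \<le> x * (((a + b) / (2 * x) - 1) / ln 2)"
      using that by (intro mult_left_mono) auto
    also have "\<dots> = ((a + b) / 2 - x) / ln 2" using that by (simp add: field_simps)
    finally show ?thesis .
  qed
  have 2: "x * log 2 ((a + b) / (2 * x)) = x * log 2 (a + b) - x - x * log 2 x" if "0 < x" for x
    using ab that by (simp add: log_divide log_mult algebra_simps)
  from 1[OF ab(1)] 1[OF ab(2)]
  have "a * log 2 ((a + b) / (2 * a)) + b * log 2 ((a + b) / (2 * b)) \<le>
      ((a + b) / 2 - a) / ln 2 + ((a + b) / 2 - b) / ln 2" by (rule add_mono)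
  also have "\<dots> = 0" by (simp add: field_simps)
  finally show ?thesis unfolding 2[OF ab(1)] 2[OF ab(2)] by (simp add: algebra_simps)
qed

lemma mass_add: "mass A (\<lambda>s. w s + w' s) U u = mass A w U u + mass A w' U u"
  by (simp add: mass_def sum.distrib)

lemma ent_add:
  assumes "weights A w" "weights A w'"
  shows "ent A (\<lambda>s. w s + w' s) U \<le> ent A w U + ent A w' U"
    and "ent A w U + ent A w' U \<le> ent A (\<lambda>s. w s + w' s) U + (sum w A + sum w' A)"
proof -
  interpret w: weights A w by fact
  interpret w': weights A w' by fact
  note e = ent_by_mass[of "U ` A" A U, simplified]
  show "ent A (\<lambda>s. w s + w' s) U \<le> ent A w U + ent A w' U"
    unfolding e mass_add
    using sum_mono[OF xlog_superadditive, of "U ` A" "mass A w U" "mass A w' U"]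
    by (simp add: sum.distrib)
  show "ent A w U + ent A w' U \<le> ent A (\<lambda>s. w s + w' s) U + (sum w A + sum w' A)"
    unfolding e mass_add sum_mass[OF w.fin, of _ U, symmetric]
    using sum_mono[OF xlog_almost_subadditive, of "U ` A" "mass A w U" "mass A w' U"]
    by (simp add: sum.distrib)
qed

text \<open>Of the four entropies two enter with each sign, and each has a splitting error between 0
  and 1.\<close>

lemma cmi_add:
  assumes "weights A w" "weights A w'" "sum w A + sum w' A = 1"
  shows "\<bar>cmi A (\<lambda>s. w s + w' s) U V C - (cmi A w U V C + cmi A w' U V C)\<bar> \<le> 2"
  using ent_add[OF assms(1,2), of "\<lambda>s. (U s, C s)"] ent_add[OF assms(1,2), of "\<lambda>s. (V s, C s)"]
    ent_add[OF assms(1,2), of "\<lambda>s. (U s, V s, C s)"] ent_add[OF assms(1,2), of C] assms(3)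
  unfolding cmi_def by linarith

definition pent :: "'s pmf \<Rightarrow> ('s \<Rightarrow> 'u) \<Rightarrow> real" where
  "pent D U = ent (set_pmf D) (pmf D) U"

definition pcmi :: "'s pmf \<Rightarrow> ('s \<Rightarrow> 'u) \<Rightarrow> ('s \<Rightarrow> 'v) \<Rightarrow> ('s \<Rightarrow> 'c) \<Rightarrow> real" where
  "pcmi D U V C = pent D (\<lambda>s. (U s, C s)) + pent D (\<lambda>s. (V s, C s))
     - pent D (\<lambda>s. (U s, V s, C s)) - pent D C"

lemma pcmi_cmi: "pcmi D U V C = cmi (set_pmf D) (pmf D) U V C"
  by (simp add: pcmi_def cmi_def pent_def)

lemma weights_pmf: "finite (set_pmf D) \<Longrightarrow> weights (set_pmf D) (pmf D)"
  by standard auto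

lemma mass_pmf:
  assumes "finite (set_pmf D)"
  shows "mass (set_pmf D) (pmf D) U u = pmf (map_pmf U D) u"
proof -
  have "pmf (map_pmf U D) u = measure_pmf.prob D ((U -` {u}) \<inter> set_pmf D)"
    by (simp add: pmf_map measure_Int_set_pmf)
  also have "\<dots> = sum (pmf D) ((U -` {u}) \<inter> set_pmf D)"
    using assms by (intro measure_measure_pmf_finite) auto
  finally show ?thesis by (auto simp: mass_def intro!: sum.cong)
qed

lemma pent_eq:
  assumes "finite (set_pmf D)" "finite T" "U ` set_pmf D \<subseteq> T"
  shows "pent D U = - (\<Sum>u\<in>T. pmf (map_pmf U D) u * log 2 (pmf (map_pmf U D) u))"
  unfolding pent_def ent_by_mass[OF assms(2,1,3)] mass_pmf[OF assms(1)] ..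

lemma pent_map_pmf:
  assumes "finite (set_pmf D)"
  shows "pent (map_pmf f D) U = pent D (\<lambda>s. U (f s))"
  using pent_eq[of "map_pmf f D" "U ` f ` set_pmf D" U] pent_eq[of D "U ` f ` set_pmf D" "\<lambda>s. U (f s)"] assms
  by (simp add: image_image map_pmf_comp)

lemma pcmi_map_pmf:
  assumes "finite (set_pmf D)"
  shows "pcmi (map_pmf f D) U V C = pcmi D (\<lambda>s. U (f s)) (\<lambda>s. V (f s)) (\<lambda>s. C (f s))"
  by (simp add: pcmi_def pent_map_pmf[OF assms])

lemma pent_cong:
  assumes "\<And>s t. s \<in> set_pmf D \<Longrightarrow> t \<in> set_pmf D \<Longrightarrow> U s = U t \<longleftrightarrow> V s = V t"
  shows "pent D U = pent D V"
  unfolding pent_def by (rule ent_cong) (rule assms)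

lemma pent_const: "finite (set_pmf D) \<Longrightarrow> pent D (\<lambda>_. c) = 0"
  by (simp add: pent_def ent_const sum_pmf_eq_1)

lemma pcmi_nonneg: "finite (set_pmf D) \<Longrightarrow> 0 \<le> pcmi D U V C"
  unfolding pcmi_cmi by (rule weights.cmi_nonneg) (rule weights_pmf)

lemma pent_fano:
  fixes U V :: "'s \<Rightarrow> 'u"
  assumes "finite (set_pmf D)" "finite T" "U ` set_pmf D \<subseteq> T"
  shows "pent D (\<lambda>s. (U s, V s)) - pent D V
    \<le> 1 + measure_pmf.prob D {s. U s \<noteq> V s} * log 2 (real (card T))"
proof -
  have "T \<noteq> {}" using assms(3) set_pmf_not_empty[of D] by auto
  from weights.fano[OF weights_pmf[OF assms(1)] assms(2,3) this, of V]
  have "pent D (\<lambda>s. (U s, V s)) - pent D V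
    \<le> 1 + sum (pmf D) {s \<in> set_pmf D. U s \<noteq> V s} * log 2 (real (card T))"
    by (simp add: pent_def sum_pmf_eq_1 assms(1))
  also have "sum (pmf D) {s \<in> set_pmf D. U s \<noteq> V s} = measure_pmf.prob D {s \<in> set_pmf D. U s \<noteq> V s}"
    using assms(1) by (intro measure_measure_pmf_finite[symmetric]) auto
  also have "\<dots> = measure_pmf.prob D {s. U s \<noteq> V s}"
    by (rule measure_pmf.finite_measure_eq_AE) (auto simp: AE_measure_pmf_iff)
  finally show ?thesis .
qed

lemma pent_pair:
  assumes fin: "finite (set_pmf p)" "finite (set_pmf q)"
  shows "pent (pair_pmf p q) (\<lambda>(a, b). (U a, V b)) = pent p U + pent q V"
proof -
  note [simp] = fin
  let ?UV = "\<lambda>(a, b). (U a, V b)"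
  have m: "mass (set_pmf (pair_pmf p q)) (pmf (pair_pmf p q)) ?UV (u, v)
      = mass (set_pmf p) (pmf p) U u * mass (set_pmf q) (pmf q) V v" for u v
  proof -
    have "mass (set_pmf (pair_pmf p q)) (pmf (pair_pmf p q)) ?UV (u, v) = pmf (map_pmf ?UV (pair_pmf p q)) (u, v)"
      by (rule mass_pmf) simp
    also have "\<dots> = pmf (map_pmf U p) u * pmf (map_pmf V q) v" by (simp add: map_pair pmf_pair)
    finally show ?thesis by (simp only: mass_pmf fin)
  qed
  interpret p: weights "set_pmf p" "pmf p" by (rule weights_pmf) simp
  interpret q: weights "set_pmf q" "pmf q" by (rule weights_pmf) simp
  have "pent (pair_pmf p q) ?UV = - (\<Sum>a\<in>set_pmf p. \<Sum>b\<in>set_pmf q. pmf p a * pmf q b *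
      log 2 (mass (set_pmf p) (pmf p) U (U a) * mass (set_pmf q) (pmf q) V (V b)))"
    unfolding pent_def ent_def case_prod_beta' using m
    by (simp add: sum.cartesian_product' pmf_pair case_prod_beta')
  also have "\<dots> = - (\<Sum>a\<in>set_pmf p. \<Sum>b\<in>set_pmf q.
      pmf p a * log 2 (mass (set_pmf p) (pmf p) U (U a)) * pmf q b +
      pmf p a * (pmf q b * log 2 (mass (set_pmf q) (pmf q) V (V b))))"
  proof (intro arg_cong[where f = uminus] sum.cong refl)
    fix a b assume ab: "a \<in> set_pmf p" "b \<in> set_pmf q"
    have "log 2 (mass (set_pmf p) (pmf p) U (U a) * mass (set_pmf q) (pmf q) V (V b)) =
       log 2 (mass (set_pmf p) (pmf p) U (U a)) + log 2 (mass (set_pmf q) (pmf q) V (V b))"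
      using p.mass_pos[OF ab(1) pmf_positive[OF ab(1)], of U] q.mass_pos[OF ab(2) pmf_positive[OF ab(2)], of V]
      by (simp add: log_mult)
    thus "pmf p a * pmf q b *
      log 2 (mass (set_pmf p) (pmf p) U (U a) * mass (set_pmf q) (pmf q) V (V b)) =
      pmf p a * log 2 (mass (set_pmf p) (pmf p) U (U a)) * pmf q b +
      pmf p a * (pmf q b * log 2 (mass (set_pmf q) (pmf q) V (V b)))"
      by (simp add: algebra_simps)
  qed
  also have "\<dots> = pent p U + pent q V"
    by (simp add: pent_def ent_def sum.distrib sum_pmf_eq_1 flip: sum_distrib_left sum_distrib_right)
  finally show ?thesis .
qed

section \<open>Agreement with the measure-theoretic information quantities\<close>

lemma distributed_pmf:
  "distributed (measure_pmf D) (count_space UNIV) U (\<lambda>u. ennreal (pmf (map_pmf U D) u))"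
proof -
  have "distr (measure_pmf D) (count_space UNIV) U = measure_pmf (map_pmf U D)"
    by (rule map_pmf_rep_eq[symmetric])
  also have "\<dots> = density (count_space UNIV) (\<lambda>u. ennreal (pmf (map_pmf U D) u))"
    by (rule measure_pmf_eq_density)
  finally show ?thesis by (simp add: distributed_def)
qed

lemma mutual_info_pent:
  fixes U :: "'s \<Rightarrow> 'u::countable" and V :: "'s \<Rightarrow> 'v::countable"
  assumes fin: "finite (set_pmf D)"
  shows "mutual_info D U V = pent D U + pent D V - pent D (\<lambda>s. (U s, V s))"
proof -
  let ?UV = "\<lambda>s. (U s, V s)"
  interpret information_space "measure_pmf D" 2 by unfold_locales simp
  interpret w: weights "set_pmf D" "pmf D" by (rule weights_pmf[OF fin])
  have cs: "count_space (UNIV :: 'u set) \<Otimes>\<^sub>M count_space (UNIV :: 'v set) = count_space UNIV"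
    by (subst pair_measure_countable) auto
  have sf: "sigma_finite_measure (count_space (UNIV :: 'u set))"
    "sigma_finite_measure (count_space (UNIV :: 'v set))"
    by (auto intro!: sigma_finite_measure_count_space_countable)
  define f where "f = (\<lambda>t. pmf (map_pmf ?UV D) t *
      log 2 (pmf (map_pmf ?UV D) t / (pmf (map_pmf U D) (fst t) * pmf (map_pmf V D) (snd t))))"
  have "mutual_info D U V = integral\<^sup>L (count_space (UNIV :: 'u set) \<Otimes>\<^sub>M count_space (UNIV :: 'v set)) f"
    unfolding mutual_info_def f_def
    by (rule mutual_information_distr[OF sf distributed_pmf _ distributed_pmf _
          distributed_pmf[where U = ?UV, folded cs]]) simp_all
  also have "\<dots> = (\<Sum>t\<in>{t. f t \<noteq> 0}. f t)"
  proof -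
    have "finite {t. f t \<noteq> 0}"
      by (rule finite_subset[of _ "?UV ` set_pmf D"]) (use fin in \<open>auto simp: f_def pmf_eq_0_set_pmf\<close>)
    thus ?thesis unfolding cs by (subst lebesgue_integral_count_space_finite_support) auto
  qed
  also have "\<dots> = (\<Sum>t\<in>?UV ` set_pmf D. f t)"
    by (rule sum.mono_neutral_left) (use fin in \<open>auto simp: f_def pmf_eq_0_set_pmf\<close>)
  also have "\<dots> = (\<Sum>s\<in>set_pmf D. pmf D s * log 2 (pmf (map_pmf ?UV D) (?UV s) /
      (pmf (map_pmf U D) (U s) * pmf (map_pmf V D) (V s))))"
    using sum_by_mass[OF fin, of "pmf D" "\<lambda>t. log 2 (pmf (map_pmf ?UV D) t /
      (pmf (map_pmf U D) (fst t) * pmf (map_pmf V D) (snd t)))" ?UV]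
    by (simp add: mass_pmf[OF fin] f_def)
  also have "\<dots> = (\<Sum>s\<in>set_pmf D. pmf D s * log 2 (pmf (map_pmf ?UV D) (?UV s)) -
      pmf D s * log 2 (pmf (map_pmf U D) (U s)) - pmf D s * log 2 (pmf (map_pmf V D) (V s)))"
  proof (rule sum.cong[OF refl])
    fix s assume s: "s \<in> set_pmf D"
    have "0 < pmf (map_pmf F D) (F s)" for F :: "'s \<Rightarrow> 'z"
      using s by (intro pmf_positive) auto
    note this[of ?UV]
    moreover have "0 < pmf (map_pmf U D) (U s)" "0 < pmf (map_pmf V D) (V s)" "0 < pmf (map_pmf ?UV D) (?UV s)"
      using s by (auto intro!: pmf_positive)
    ultimately show "pmf D s * log 2 (pmf (map_pmf ?UV D) (?UV s) /
      (pmf (map_pmf U D) (U s) * pmf (map_pmf V D) (V s))) = pmf D s * log 2 (pmf (map_pmf ?UV D) (?UV s)) -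
      pmf D s * log 2 (pmf (map_pmf U D) (U s)) - pmf D s * log 2 (pmf (map_pmf V D) (V s))"
      by (simp add: log_divide log_mult algebra_simps)
  qed
  finally show ?thesis
    by (simp add: pent_def ent_def mass_pmf[OF fin] sum_subtractf)
qed

lemma Hent_pent:
  assumes fin: "finite (set_pmf D)"
  shows "Hent D U = pent D U"
proof -
  interpret information_space "measure_pmf D" 2 by unfold_locales simp
  let ?f = "\<lambda>u. pmf (map_pmf U D) u * log 2 (pmf (map_pmf U D) u)"
  have "Hent D U = - (\<integral>u. ?f u \<partial>count_space UNIV)"
    unfolding Hent_def by (rule entropy_distr[OF distributed_pmf]) auto
  also have "(\<integral>u. ?f u \<partial>count_space UNIV) = (\<Sum>u\<in>{u. ?f u \<noteq> 0}. ?f u)"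
  proof -
    have "finite {u. ?f u \<noteq> 0}"
      by (rule finite_subset[of _ "U ` set_pmf D"]) (use fin in \<open>auto simp: pmf_eq_0_set_pmf\<close>)
    thus ?thesis by (subst lebesgue_integral_count_space_finite_support) auto
  qed
  also have "\<dots> = (\<Sum>u\<in>U ` set_pmf D. ?f u)"
    by (rule sum.mono_neutral_left) (use fin in \<open>auto simp: pmf_eq_0_set_pmf\<close>)
  finally show ?thesis using pent_eq[OF fin _ subset_refl, of U] fin by simp
qed

text \<open>The library sets I(U;V|C) to I(U;V,C) - I(U;C), so H(U) cancels and the four entropies
  of \<open>pcmi\<close> remain.\<close>

lemma cond_mutual_info_pcmi:
  fixes U :: "'s \<Rightarrow> 'u::countable" and V :: "'s \<Rightarrow> 'v::countable" and C :: "'s \<Rightarrow> 'c::countable"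
  assumes fin: "finite (set_pmf D)"
  shows "cond_mutual_info D U V C = pcmi D U V C"
proof -
  have cs: "count_space (UNIV :: 'v set) \<Otimes>\<^sub>M count_space (UNIV :: 'c set) = count_space UNIV"
    by (subst pair_measure_countable) auto
  have "cond_mutual_info D U V C = mutual_info D U (\<lambda>s. (V s, C s)) - mutual_info D U C"
    unfolding cond_mutual_info_def mutual_info_def
      prob_space.conditional_mutual_information_def[OF measure_pmf.prob_space_axioms] cs ..
  thus ?thesis by (simp add: mutual_info_pent[OF fin] pcmi_def)
qed

text \<open>Both laws contain the measure \<open>min P Q\<close>, and splitting off a part of a measure changes each
  entropy by at most one bit.\<close>

lemma pcmi_continuity:
  fixes P Q :: "'s pmf"
  assumes fin: "finite (set_pmf P)" "finite (set_pmf Q)" and tv: "tv_dist P Q \<le> \<epsilon>"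
    and T: "finite T" "U ` set_pmf Q \<subseteq> T"
  shows "pcmi Q U V C \<le> pcmi P U V C + \<epsilon> * log 2 (real (card T)) + 4"
proof -
  let ?A = "set_pmf P \<union> set_pmf Q"
  define m where "m s = min (pmf P s) (pmf Q s)" for s
  define p where "p s = pmf P s - m s" for s
  define q where "q s = pmf Q s - m s" for s
  have finA: "finite ?A" using fin by simp
  have T0: "T \<noteq> {}" using T(2) set_pmf_not_empty[of Q] by auto
  hence n: "0 \<le> log 2 (real (card T))" using T(1)
    by (simp add: Suc_leI card_gt_0_iff)
  have wm: "weights ?A m" and wp: "weights ?A p" and wq: "weights ?A q" and wq': "weights (set_pmf Q) q"
    using fin by (auto simp: weights_def m_def p_def q_def)
  have P: "pmf P = (\<lambda>s. m s + p s)" and Q: "pmf Q = (\<lambda>s. m s + q s)"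
    by (auto simp: p_def q_def)
  have sP: "sum (pmf P) ?A = 1" and sQ: "sum (pmf Q) ?A = 1"
    using fin by (auto intro!: sum_pmf_eq_1)
  have cP: "pcmi P U V C = cmi ?A (\<lambda>s. m s + p s) U V C"
    unfolding pcmi_cmi P[symmetric] by (rule cmi_superset[symmetric]) (auto simp: fin pmf_eq_0_set_pmf)
  have cQ: "pcmi Q U V C = cmi ?A (\<lambda>s. m s + q s) U V C"
    unfolding pcmi_cmi Q[symmetric] by (rule cmi_superset[symmetric]) (auto simp: fin pmf_eq_0_set_pmf)
  have q: "sum q ?A \<le> \<epsilon>"
  proof -
    \<comment> \<open>This event attains the total variation distance: its difference in probability
      is the mass of \<open>Q\<close> above \<open>P\<close>.\<close>
    let ?S = "{s\<in>?A. pmf P s < pmf Q s}"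
    have "sum q ?A = (\<Sum>s\<in>?S. pmf Q s - pmf P s)"
      by (rule sum.mono_neutral_cong_right) (use finA in \<open>auto simp: q_def m_def\<close>)
    also have "\<dots> = measure_pmf.prob Q ?S - measure_pmf.prob P ?S"
      using finA by (simp add: sum_subtractf measure_measure_pmf_finite)
    also have "\<dots> \<le> \<bar>measure_pmf.prob P ?S - measure_pmf.prob Q ?S\<bar>" by simp
    also have "\<dots> \<le> tv_dist P Q" unfolding tv_dist_def
    proof (rule cSUP_upper[OF UNIV_I], rule bdd_aboveI2[where M = 1])
      fix S show "\<bar>measure_pmf.prob P S - measure_pmf.prob Q S\<bar> \<le> 1"
        using measure_pmf.prob_le_1[of P S] measure_pmf.prob_le_1[of Q S]
          measure_nonneg[of P S] measure_nonneg[of Q S] by linarith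
    qed
    finally show ?thesis using tv by simp
  qed
  have q0: "\<forall>s\<in>?A - set_pmf Q. q s = 0"
    by (auto simp: q_def m_def set_pmf_iff)
  have "sum q (set_pmf Q) = sum q ?A"
    by (rule sum.mono_neutral_left) (use fin q0 in auto)
  hence "cmi ?A q U V C \<le> sum q ?A * log 2 (real (card T))"
    using weights.cmi_le_card[OF wq' T T0, of V C] cmi_superset[OF finA _ q0, of U V C] by simp
  also have "\<dots> \<le> \<epsilon> * log 2 (real (card T))" using q n by (rule mult_right_mono)
  finally have "cmi ?A q U V C \<le> \<epsilon> * log 2 (real (card T))" .
  \<comment> \<open>The leftover of \<open>P\<close> only has to be nonnegative; the leftover of
    \<open>Q\<close> is charged to \<open>T\<close>. The constant 4 is twice the 2 of
    \<open>cmi_add\<close>.\<close>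
  moreover have "0 \<le> cmi ?A p U V C" by (rule weights.cmi_nonneg[OF wp])
  ultimately show ?thesis
    using cmi_add[OF wm wp, of U V C] cmi_add[OF wm wq, of U V C] sP sQ
    unfolding cP cQ P Q by (simp add: sum.distrib)
qed

section \<open>Public discussion and the formation cost\<close>

lemma pcmi_cong:
  assumes "\<And>s t. s \<in> set_pmf D \<Longrightarrow> t \<in> set_pmf D \<Longrightarrow> U s = U t \<longleftrightarrow> U' s = U' t"
    and "\<And>s t. s \<in> set_pmf D \<Longrightarrow> t \<in> set_pmf D \<Longrightarrow> V s = V t \<longleftrightarrow> V' s = V' t"
    and "\<And>s t. s \<in> set_pmf D \<Longrightarrow> t \<in> set_pmf D \<Longrightarrow> C s = C t \<longleftrightarrow> C' s = C' t"
  shows "pcmi D U V C = pcmi D U' V' C'"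
  unfolding pcmi_def
  by (intro arg_cong2[where f = "(-)"] arg_cong2[where f = "(+)"] pent_cong) (use assms in auto)

lemma pcmi_sym: "pcmi D U V C = pcmi D V U C"
proof -
  have "pent D (\<lambda>s. (U s, V s, C s)) = pent D (\<lambda>s. (V s, U s, C s))"
    by (rule pent_cong) auto
  thus ?thesis by (simp add: pcmi_def)
qed

lemma pcmi_chain:
  "pcmi D (\<lambda>s. (U s, U' s)) V C = pcmi D U V C + pcmi D U' V (\<lambda>s. (C s, U s))"
proof -
  have "pent D (\<lambda>s. ((U s, U' s), C s)) = pent D (\<lambda>s. (U' s, C s, U s))"
    "pent D (\<lambda>s. ((U s, U' s), V s, C s)) = pent D (\<lambda>s. (U' s, V s, C s, U s))"
    "pent D (\<lambda>s. (U s, C s)) = pent D (\<lambda>s. (C s, U s))"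
    "pent D (\<lambda>s. (U s, V s, C s)) = pent D (\<lambda>s. (V s, C s, U s))"
    by (rule pent_cong; auto)+
  thus ?thesis by (simp add: pcmi_def)
qed

text \<open>Once \<open>C\<close> is known, \<open>(U, A)\<close> carries the same information as
  \<open>A\<close>, so the chain rule leaves a nonnegative remainder. Letting \<open>h\<close> read
  \<open>C\<close> covers outputs computed from the transcript.\<close>

lemma pcmi_data_processing:
  assumes fin: "finite (set_pmf D)" and U: "\<And>s. s \<in> set_pmf D \<Longrightarrow> U s = h (A s) (C s)"
  shows "pcmi D U V C \<le> pcmi D A V C"
proof -
  have "pent D (\<lambda>s. ((U s, A s), C s)) = pent D (\<lambda>s. (A s, C s))"
    "pent D (\<lambda>s. ((U s, A s), V s, C s)) = pent D (\<lambda>s. (A s, V s, C s))"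
    by (rule pent_cong; auto simp: U)+
  hence "pcmi D A V C = pcmi D (\<lambda>s. (U s, A s)) V C" by (simp add: pcmi_def)
  thus ?thesis using pcmi_nonneg[OF fin, of A V "\<lambda>s. (C s, U s)"] by (simp add: pcmi_chain)
qed

lemma pcmi_data_processing2:
  assumes fin: "finite (set_pmf D)" and U: "\<And>s. s \<in> set_pmf D \<Longrightarrow> U s = h (A s) (C s)"
  shows "pcmi D V U C \<le> pcmi D V A C"
  using pcmi_data_processing[of D U h A C V, OF assms] by (simp add: pcmi_sym[of D V])

text \<open>Splitting \<open>A\<close> into \<open>M\<close> and the rest, the chain rule removes
  exactly I(M;B|C), so an announcement by one party never raises the correlation of the two.\<close>

lemma pcmi_message:
  assumes fin: "finite (set_pmf D)" and M: "\<And>s. s \<in> set_pmf D \<Longrightarrow> M s = h (A s) (C s)"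
  shows "pcmi D A B (\<lambda>s. (C s, M s)) \<le> pcmi D A B C"
proof -
  have "pent D (\<lambda>s. ((M s, A s), C s)) = pent D (\<lambda>s. (A s, C s))"
    "pent D (\<lambda>s. ((M s, A s), B s, C s)) = pent D (\<lambda>s. (A s, B s, C s))"
    by (rule pent_cong; auto simp: M)+
  hence "pcmi D A B C = pcmi D (\<lambda>s. (M s, A s)) B C" by (simp add: pcmi_def)
  also have "\<dots> = pcmi D M B C + pcmi D A B (\<lambda>s. (C s, M s))" by (rule pcmi_chain)
  finally show ?thesis using pcmi_nonneg[OF fin, of M B C] by simp
qed

text \<open>\<open>pcmi_message\<close> is applied round by round, with the earlier messages
  absorbed in the conditioning variable; Bob's rounds use the symmetry of
  \<open>pcmi\<close>.\<close>

lemma pcmi_transcript: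
  assumes fin: "finite (set_pmf D)"
  shows "pcmi D A B (\<lambda>s. (C s, transcript r (f (A s)) (g (B s)))) \<le> pcmi D A B C"
proof (induction r)
  case 0
  have "pcmi D A B (\<lambda>s. (C s, transcript 0 (f (A s)) (g (B s)))) = pcmi D A B C"
    by (rule pcmi_cong) auto
  thus ?case by simp
next
  case (Suc r)
  let ?h = "\<lambda>s. transcript r (f (A s)) (g (B s))"
  let ?m = "\<lambda>s. if even r then f (A s) (?h s) else g (B s) (?h s)"
  have "pcmi D A B (\<lambda>s. (C s, transcript (Suc r) (f (A s)) (g (B s)))) =
     pcmi D A B (\<lambda>s. ((C s, ?h s), ?m s))"
    by (rule pcmi_cong) (auto simp: Let_def)
  also have "\<dots> \<le> pcmi D A B (\<lambda>s. (C s, ?h s))"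
  proof (cases "even r")
    case True
    thus ?thesis
      using pcmi_message[OF fin, of ?m "\<lambda>a c. f a (snd c)" A "\<lambda>s. (C s, ?h s)" B] by simp
  next
    case False
    thus ?thesis
      using pcmi_message[OF fin, of ?m "\<lambda>a c. g a (snd c)" B "\<lambda>s. (C s, ?h s)" A]
      by (simp add: pcmi_sym[of D A B])
  qed
  finally show ?case using Suc.IH by simp
qed

definition pcmi3 :: "('x \<times> 'y \<times> 'c) pmf \<Rightarrow> real" where
  "pcmi3 D = pcmi D (\<lambda>(x, y, c). x) (\<lambda>(x, y, c). y) (\<lambda>(x, y, c). c)"

lemma pcmi3_map_pmf:
  assumes "finite (set_pmf D)"
  shows "pcmi3 (map_pmf (\<lambda>s. (U s, V s, C s)) D) = pcmi D U V C"
  by (simp add: pcmi3_def pcmi_map_pmf[OF assms])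

lemma pcmi3_map_inj:
  assumes "finite (set_pmf D)" "inj f"
  shows "pcmi3 (map_pmf (\<lambda>(x, y, c). (x, y, f c)) D) = pcmi3 D"
  unfolding pcmi3_def pcmi_map_pmf[OF assms(1)]
  by (rule pcmi_cong) (auto simp: inj_eq[OF assms(2)])

lemma pent_pair_split:
  assumes "finite (set_pmf D)" "finite (set_pmf E)"
    and "\<And>s t. W s = W t \<longleftrightarrow> U (fst s) = U (fst t) \<and> V (snd s) = V (snd t)"
  shows "pent (pair_pmf D E) W = pent D U + pent E V"
proof -
  have "pent (pair_pmf D E) W = pent (pair_pmf D E) (\<lambda>(d, e). (U d, V e))"
    by (rule pent_cong) (auto simp: assms(3))
  thus ?thesis by (simp add: pent_pair assms)
qed

text \<open>Private randomness is neutral: the entropy of each seed occurs once with either sign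
  among the four entropies.\<close>

lemma pcmi_seeds:
  assumes [simp]: "finite (set_pmf D)" "finite (set_pmf p)" "finite (set_pmf q)"
  shows "pcmi (pair_pmf D (pair_pmf p q)) (\<lambda>((a, b, c), r, s). (a, r)) (\<lambda>((a, b, c), r, s). (b, s))
     (\<lambda>((a, b, c), r, s). c) = pcmi3 D"
proof -
  let ?G = "pair_pmf D (pair_pmf p q)"
  have fpq: "finite (set_pmf (pair_pmf p q))" by simp
  note key = pent_pair_split[OF assms(1) fpq]
  have p: "pent (pair_pmf p q) fst = pent p (\<lambda>x. x)"
    using pent_map_pmf[of "pair_pmf p q" fst "\<lambda>x. x"] by (simp add: map_fst_pair_pmf)
  have q: "pent (pair_pmf p q) snd = pent q (\<lambda>x. x)"
    using pent_map_pmf[of "pair_pmf p q" snd "\<lambda>x. x"] by (simp add: map_snd_pair_pmf)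
  have pq: "pent (pair_pmf p q) (\<lambda>e. e) = pent p (\<lambda>x. x) + pent q (\<lambda>x. x)"
    using pent_pair[of p q "\<lambda>x. x" "\<lambda>x. x"] by (simp add: id_def)
  have u: "pent (pair_pmf p q) (\<lambda>_. ()) = 0" by (rule pent_const) simp
  show ?thesis
    unfolding pcmi_def pcmi3_def
    by (subst key[where U = "\<lambda>(a, b, c). (a, c)" and V = fst], force,
        subst key[where U = "\<lambda>(a, b, c). (b, c)" and V = snd], force,
        subst key[where U = "\<lambda>(a, b, c). (a, b, c)" and V = "\<lambda>e. e"], force,
        subst key[where U = "\<lambda>(a, b, c). c" and V = "\<lambda>_. ()"], force)
      (simp add: p q pq u case_prod_unfold)
qed

lemma run_eq_map:
  "run \<pi> D = map_pmf (\<lambda>((a, b, c), r, s).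
      let F = transcript (rounds \<pi>) (msgA \<pi> a r) (msgB \<pi> b s)
      in (outA \<pi> a r F, outB \<pi> b s F, F, c)) (pair_pmf D (pair_pmf (seedA \<pi>) (seedB \<pi>)))"
  by (simp add: run_def pair_pmf_def map_bind_pmf bind_assoc_pmf bind_return_pmf case_prod_unfold Let_def)

lemma finite_run:
  assumes "finite_seeds \<pi>" "finite (set_pmf D)"
  shows "finite (set_pmf (run \<pi> D))"
  using assms by (simp add: run_eq_map finite_seeds_def)

text \<open>Each output is computed from one party's data and seed and the transcript. Data
  processing given the transcript therefore replaces outputs by local views; then the transcript and
  finally the seeds are removed.\<close>

lemma pcmi_run:
  assumes fs: "finite_seeds \<pi>" and fin: "finite (set_pmf D)"
  shows "pcmi (run \<pi> D) (\<lambda>(kA, kB, F, c). kA) (\<lambda>(kA, kB, F, c). kB) (\<lambda>(kA, kB, F, c). (c, F)) \<le> pcmi3 D"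
proof -
  let ?G = "pair_pmf D (pair_pmf (seedA \<pi>) (seedB \<pi>))"
  let ?A = "\<lambda>((a, b, c), r, s). (a, r)" and ?B = "\<lambda>((a, b, c), r, s). (b, s)"
    and ?C = "\<lambda>((a, b, c), r, s). c"
  let ?F = "\<lambda>s. transcript (rounds \<pi>) (case_prod (msgA \<pi>) (?A s)) (case_prod (msgB \<pi>) (?B s))"
  let ?KA = "\<lambda>s. case_prod (outA \<pi>) (?A s) (?F s)" and ?KB = "\<lambda>s. case_prod (outB \<pi>) (?B s) (?F s)"
  have G: "finite (set_pmf ?G)" using fs fin by (simp add: finite_seeds_def)
  have "pcmi (run \<pi> D) (\<lambda>(kA, kB, F, c). kA) (\<lambda>(kA, kB, F, c). kB) (\<lambda>(kA, kB, F, c). (c, F)) =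
     pcmi ?G ?KA ?KB (\<lambda>s. (?C s, ?F s))"
    unfolding run_eq_map pcmi_map_pmf[OF G] by (simp add: case_prod_unfold Let_def)
  also have "\<dots> \<le> pcmi ?G ?A ?KB (\<lambda>s. (?C s, ?F s))"
    by (rule pcmi_data_processing[OF G, where h = "\<lambda>a c. case_prod (outA \<pi>) a (snd c)"]) simp
  also have "\<dots> \<le> pcmi ?G ?A ?B (\<lambda>s. (?C s, ?F s))"
    by (rule pcmi_data_processing2[OF G, where h = "\<lambda>a c. case_prod (outB \<pi>) a (snd c)"]) simp
  also have "\<dots> \<le> pcmi ?G ?A ?B ?C"
    by (rule pcmi_transcript[OF G])
  also have "\<dots> = pcmi3 D" using fs fin by (intro pcmi_seeds) (auto simp: finite_seeds_def)
  finally show ?thesis .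
qed

section \<open>Intrinsic information of blocks and the formation cost\<close>

lemma finite_apply_channel:
  "finite (set_pmf P) \<Longrightarrow> finite_channel W \<Longrightarrow> finite (set_pmf (apply_channel P W))"
  by (auto simp: apply_channel_def finite_channel_def)

lemma finite_iid [simp]: "finite (set_pmf (P :: ('x::finite \<times> 'y::finite \<times> 'z::finite) pmf)) \<Longrightarrow> finite (set_pmf (iid n P))"
proof -
  have "finite {xs. set xs \<subseteq> set_pmf P \<and> length xs = n}" by (rule finite_lists_length_eq) simp
  thus ?thesis by (auto simp: iid_def set_replicate_pmf lists_eq_set elim: rev_finite_subset)
qed

lemma iid_0: "iid 0 P = return_pmf ([], [], [])"
  by (simp add: iid_def)

lemma iid_Suc:
  "iid (Suc n) P = do {(x, y, z) \<leftarrow> P; (xs, ys, zs) \<leftarrow> iid n P; return_pmf (x # xs, y # ys, z # zs)}"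
  by (simp add: iid_def map_bind_pmf bind_map_pmf case_prod_unfold map_pmf_def[symmetric] map_pmf_comp o_def)

lemma intrinsic_information_eq:
  "intrinsic_information (P :: ('x::finite \<times> 'y::finite \<times> 'z::finite) pmf) =
     (INF W \<in> {W :: 'z \<Rightarrow> nat pmf. finite_channel W}. pcmi3 (apply_channel P W))"
  unfolding intrinsic_information_def pcmi3_def
  by (intro INF_cong refl cond_mutual_info_pcmi finite_apply_channel) auto

text \<open>Coding the outputs injectively by \<open>to_nat\<close> changes no entropy, which
  extends the bound from outputs in \<open>nat\<close> to any countable type.\<close>

lemma intrinsic_information_le:
  fixes P :: "('x::finite \<times> 'y::finite \<times> 'z::finite) pmf" and W :: "'z \<Rightarrow> 'c::countable pmf"
  assumes W: "finite_channel W"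
  shows "intrinsic_information P \<le> pcmi3 (apply_channel P W)"
proof -
  let ?W = "\<lambda>z. map_pmf to_nat (W z)"
  have fW: "finite_channel ?W" using W by (simp add: finite_channel_def)
  have "intrinsic_information P \<le> pcmi3 (apply_channel P ?W)"
    unfolding intrinsic_information_eq
  proof (rule cINF_lower)
    show "bdd_below ((\<lambda>W. pcmi3 (apply_channel P W)) ` {W :: 'z \<Rightarrow> nat pmf. finite_channel W})"
      by (rule bdd_belowI2[where m = 0]) (auto simp: pcmi3_def intro!: pcmi_nonneg finite_apply_channel)
  qed (use fW in simp)
  also have "apply_channel P ?W = map_pmf (\<lambda>(x, y, c). (x, y, to_nat c)) (apply_channel P W)"
    by (simp add: apply_channel_def map_bind_pmf bind_map_pmf case_prod_unfold)
  also have "pcmi3 \<dots> = pcmi3 (apply_channel P W)"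
    by (rule pcmi3_map_inj) (auto intro: finite_apply_channel W)
  finally show ?thesis .
qed

text \<open>The chain rule peels off one letter; the other letters are absorbed into the channel.\<close>

lemma intrinsic_information_iid_nat:
  fixes P :: "('x::finite \<times> 'y::finite \<times> 'z::finite) pmf" and W :: "'z list \<Rightarrow> nat pmf"
  assumes W: "finite_channel W"
  shows "real N * intrinsic_information P \<le> pcmi3 (apply_channel (iid N P) W)"
  using W
proof (induction N arbitrary: W)
  case 0
  thus ?case by (auto simp: pcmi3_def iid_0 intro!: pcmi_nonneg finite_apply_channel)
next
  case (Suc N)
  define G where "G = do {(x, y, z) \<leftarrow> P; (xs, ys, zs) \<leftarrow> iid N P; c \<leftarrow> W (z # zs); return_pmf (x, xs, y, ys, c)}"
  have G': "G = do {(xs, ys, zs) \<leftarrow> iid N P; (x, y, z) \<leftarrow> P; c \<leftarrow> W (z # zs); return_pmf (x, xs, y, ys, c)}"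
    unfolding G_def case_prod_unfold by (rule bind_commute_pmf)
  \<comment> \<open>\<open>W1\<close> lets Eve draw the other letters herself. \<open>W2\<close>
    lets her draw the first letter herself and output \<open>x\<close> along with \<open>c\<close>,
    because the second term of the chain rule is conditioned on \<open>x\<close>.\<close>
  define W1 where "W1 z = do {(xs, ys, zs) \<leftarrow> iid N P; W (z # zs)}" for z
  define W2 where "W2 zs = do {(x, y, z) \<leftarrow> P; c \<leftarrow> W (z # zs); return_pmf (to_nat (c, x))}" for zs
  have fin: "finite (set_pmf G)"
    using Suc.prems by (auto simp: G_def finite_channel_def)
  have fW1: "finite_channel W1" and fW2: "finite_channel W2"
    using Suc.prems by (auto simp: finite_channel_def W1_def W2_def)
  let ?x = "\<lambda>(x, xs, y, ys, c). x" and ?xs = "\<lambda>(x, xs, y, ys, c). xs" and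
    ?y = "\<lambda>(x, xs, y, ys, c). y" and ?ys = "\<lambda>(x, xs, y, ys, c). ys" and ?c = "\<lambda>(x, xs, y, ys, c). c"
  have "map_pmf (\<lambda>s. (?x s, ?y s, ?c s)) G = apply_channel P W1"
    by (simp add: G_def W1_def apply_channel_def map_bind_pmf bind_assoc_pmf case_prod_unfold)
  hence 1: "intrinsic_information P \<le> pcmi G ?x ?y ?c"
    using intrinsic_information_le[OF fW1, of P] pcmi3_map_pmf[OF fin, of ?x ?y ?c] by simp
  have "map_pmf (\<lambda>s. (?xs s, ?ys s, to_nat (?c s, ?x s))) G = apply_channel (iid N P) W2"
    by (simp add: G' W2_def apply_channel_def map_bind_pmf bind_assoc_pmf case_prod_unfold bind_return_pmf)
  hence "real N * intrinsic_information P \<le> pcmi G ?xs ?ys (\<lambda>s. to_nat (?c s, ?x s))"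
    using Suc.IH[OF fW2] pcmi3_map_pmf[OF fin, of ?xs ?ys "\<lambda>s. to_nat (?c s, ?x s)"] by simp
  also have "\<dots> = pcmi G ?xs ?ys (\<lambda>s. (?c s, ?x s))"
    by (rule pcmi_cong) auto
  finally have 2: "real N * intrinsic_information P \<le> pcmi G ?xs ?ys (\<lambda>s. (?c s, ?x s))" .
  let ?Y = "\<lambda>s. (?y s, ?ys s)"
  \<comment> \<open>Enlarging Bob's part to the whole block turns the two summands into those of the
    chain rule.\<close>
  have "pcmi G ?x ?y ?c + pcmi G ?xs ?ys (\<lambda>s. (?c s, ?x s)) \<le> pcmi G ?x ?Y ?c + pcmi G ?xs ?Y (\<lambda>s. (?c s, ?x s))"
    by (intro add_mono pcmi_data_processing2[OF fin, where h = "\<lambda>a c. fst a"]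
        pcmi_data_processing2[OF fin, where h = "\<lambda>a c. snd a"]) auto
  also have "\<dots> = pcmi G (\<lambda>s. (?x s, ?xs s)) ?Y ?c" by (rule pcmi_chain[symmetric])
  also have "\<dots> = pcmi G (\<lambda>s. ?x s # ?xs s) (\<lambda>s. ?y s # ?ys s) ?c"
    by (rule pcmi_cong) auto
  also have "\<dots> = pcmi3 (map_pmf (\<lambda>s. (?x s # ?xs s, ?y s # ?ys s, ?c s)) G)"
    by (rule pcmi3_map_pmf[OF fin, symmetric])
  also have "map_pmf (\<lambda>s. (?x s # ?xs s, ?y s # ?ys s, ?c s)) G = apply_channel (iid (Suc N) P) W"
    by (simp add: G_def iid_Suc apply_channel_def map_bind_pmf bind_assoc_pmf case_prod_unfold bind_return_pmf)
  finally show ?case using 1 2 by (simp only: of_nat_Suc distrib_right mult_1)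
qed

lemma intrinsic_information_iid:
  fixes P :: "('x::finite \<times> 'y::finite \<times> 'z::finite) pmf" and W :: "'z list \<Rightarrow> 'c::countable pmf"
  assumes W: "finite_channel W"
  shows "real N * intrinsic_information P \<le> pcmi3 (apply_channel (iid N P) W)"
proof -
  let ?W = "\<lambda>z. map_pmf to_nat (W z)"
  have fW: "finite_channel ?W" using W by (simp add: finite_channel_def)
  have "apply_channel (iid N P) ?W = map_pmf (\<lambda>(x, y, c). (x, y, to_nat c)) (apply_channel (iid N P) W)"
    by (simp add: apply_channel_def map_bind_pmf bind_map_pmf case_prod_unfold)
  also have "pcmi3 \<dots> = pcmi3 (apply_channel (iid N P) W)"
    by (rule pcmi3_map_inj) (auto intro: finite_apply_channel W)
  finally show ?thesis using intrinsic_information_iid_nat[OF fW, of N P] by simp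
qed

lemma finite_bool_lists: "finite {s :: bool list. length s = l}"
  using finite_lists_length_eq[of "UNIV :: bool set" l] by simp

lemma pcmi3_shared_bits: "pcmi3 (shared_bits l) \<le> real l"
proof -
  let ?L = "{s :: bool list. length s = l}"
  let ?a = "\<lambda>(x, y, c). x"
  have card: "card ?L = 2 ^ l"
    using card_lists_length_eq[of "UNIV :: bool set" l] by simp
  have L: "?L \<noteq> {}" by (metis (mono_tags, lifting) Ex_list_of_length empty_iff mem_Collect_eq)
  have s: "set_pmf (shared_bits l) = (\<lambda>s. (s, s, ())) ` ?L"
    using L by (simp add: shared_bits_def finite_bool_lists)
  have fin: "finite (set_pmf (shared_bits l))"
    by (simp add: s finite_bool_lists)
  have "cmi (set_pmf (shared_bits l)) (pmf (shared_bits l)) ?a (\<lambda>(x, y, c). y) (\<lambda>(x, y, c). c)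
     \<le> sum (pmf (shared_bits l)) (set_pmf (shared_bits l)) * log 2 (real (card ?L))"
    by (rule weights.cmi_le_card[OF weights_pmf[OF fin] finite_bool_lists _ L]) (auto simp: s)
  thus ?thesis by (simp add: pcmi3_def pcmi_cmi sum_pmf_eq_1 fin card log_nat_power)
qed

theorem intrinsic_information_le_rate:
  fixes P :: "('x::finite \<times> 'y::finite \<times> 'z::finite) pmf"
  assumes R: "0 \<le> R" "formation_rate_achievable P R"
  shows "intrinsic_information P \<le> R"
proof -
  define L where "L = log 2 (real CARD('x))"
  \<comment> \<open>The tolerance costs \<open>\<epsilon> * L\<close> per letter however long the
    block is. So \<open>\<epsilon>\<close> is fixed while \<open>N\<close> grows and removes 4/N,
    and only then tends to zero.\<close>
  have *: "intrinsic_information P \<le> R + \<epsilon> * L" if eps: "\<epsilon> > 0" for \<epsilon>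
  proof -
    have "\<forall>\<^sub>F N in sequentially. intrinsic_information P \<le> R + \<epsilon> * L + 4 / real N"
      using R(2)[unfolded formation_rate_achievable_def, rule_format, OF eps] eventually_gt_at_top[of 0]
    proof eventually_elim
      case (elim N)
      then obtain \<pi> :: "(bool list, bool list, 'x list, 'y list) protocol" and W :: "'z list \<Rightarrow> nat list pmf"
        where fs: "finite_seeds \<pi>" and fW: "finite_channel W" and tv: "tv_dist
         (map_pmf (\<lambda>(xs, ys, C, _). (xs, ys, C)) (run \<pi> (shared_bits (nat \<lfloor>R * real N\<rfloor>))))
         (apply_channel (iid N P) W) \<le> \<epsilon>" by blast
      let ?D = "shared_bits (nat \<lfloor>R * real N\<rfloor>)"
      let ?P = "map_pmf (\<lambda>(xs, ys, C, _). (xs, ys, C)) (run \<pi> ?D)"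
      let ?Q = "apply_channel (iid N P) W"
      let ?T = "{xs :: 'x list. length xs = N}"
      have fD: "finite (set_pmf ?D)" by (auto simp: shared_bits_def finite_bool_lists set_pmf_of_set Ex_list_of_length)
      have fP: "finite (set_pmf ?P)" using finite_run[OF fs fD] by simp
      have fQ: "finite (set_pmf ?Q)" by (simp add: finite_apply_channel fW)
      have cT: "card ?T = CARD('x) ^ N" and fT: "finite ?T"
        using card_lists_length_eq[of "UNIV :: 'x set" N] finite_lists_length_eq[of "UNIV :: 'x set" N] by simp_all
      have "real N * intrinsic_information P \<le> pcmi3 ?Q"
        by (rule intrinsic_information_iid[OF fW])
      also have "\<dots> \<le> pcmi3 ?P + \<epsilon> * log 2 (real (card ?T)) + 4"
        unfolding pcmi3_def
        by (rule pcmi_continuity[OF fP fQ tv fT]) (auto simp: apply_channel_def iid_def set_replicate_pmf)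
      also have "log 2 (real (card ?T)) = real N * L"
        by (simp add: cT L_def log_nat_power)
      also have "pcmi3 ?P \<le> real (nat \<lfloor>R * real N\<rfloor>)"
      proof -
        have "pcmi3 ?P = pcmi (run \<pi> ?D) (\<lambda>(kA, kB, F, c). kA) (\<lambda>(kA, kB, F, c). kB) (\<lambda>(kA, kB, F, c). F)"
          unfolding pcmi3_def pcmi_map_pmf[OF finite_run[OF fs fD]] by (simp add: case_prod_unfold)
        also have "\<dots> = pcmi (run \<pi> ?D) (\<lambda>(kA, kB, F, c). kA) (\<lambda>(kA, kB, F, c). kB) (\<lambda>(kA, kB, F, c). (c, F))"
          by (rule pcmi_cong) auto
        also have "\<dots> \<le> pcmi3 ?D" by (rule pcmi_run[OF fs fD])
        finally show ?thesis using pcmi3_shared_bits order_trans by blast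
      qed
      also have "real (nat \<lfloor>R * real N\<rfloor>) \<le> R * real N" using R(1) by (simp add: of_nat_nat)
      finally have "real N * intrinsic_information P \<le> real N * (R + \<epsilon> * L + 4 / real N)"
        using elim(2) by (simp add: algebra_simps)
      thus ?case using elim(2) by simp
    qed
    moreover have "(\<lambda>N. R + \<epsilon> * L + 4 / real N) \<longlonglongrightarrow> R + \<epsilon> * L + 0"
      by (intro tendsto_intros lim_const_over_n)
    ultimately show ?thesis
      using tendsto_lowerbound[of "\<lambda>N. R + \<epsilon> * L + 4 / real N" "R + \<epsilon> * L + 0" sequentially "intrinsic_information P"]
      by simp
  qed
  have "((\<lambda>\<epsilon>. R + \<epsilon> * L) \<longlongrightarrow> R + 0 * L) (at_right 0)"
    by (intro tendsto_intros)
  moreover have "\<forall>\<^sub>F \<epsilon> in at_right 0. intrinsic_information P \<le> R + \<epsilon> * L"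
    using * by (auto simp: eventually_at_right_less intro: eventually_mono[OF eventually_at_right_less])
  ultimately show ?thesis
    using tendsto_lowerbound[of "\<lambda>\<epsilon>. R + \<epsilon> * L" "R + 0 * L" "at_right 0" "intrinsic_information P"] by simp
qed

corollary intrinsic_information_le_formation_cost:
  "ereal (intrinsic_information P) \<le> formation_cost P"
  unfolding formation_cost_def
  by (rule Inf_greatest) (auto intro: intrinsic_information_le_rate)

section \<open>Erasure channels are less noisy than symmetric channels\<close>

text \<open>Natural logarithms, since this section differentiates; \<open>xlog_eta\<close> converts
  to bits.\<close>

definition \<eta> :: "real \<Rightarrow> real" where
  "\<eta> x = x * ln x"

lemma eta_0 [simp]: "\<eta> 0 = 0" and eta_1 [simp]: "\<eta> 1 = 0"
  by (simp_all add: \<eta>_def)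

lemma eta_mult: "0 < a \<Longrightarrow> 0 < b \<Longrightarrow> \<eta> (a * b) = a * \<eta> b + b * \<eta> a"
  by (simp add: \<eta>_def ln_mult algebra_simps)

lemma xlog_eta: "x * log 2 x = \<eta> x / ln 2"
  by (simp add: \<eta>_def log_def)

lemma DERIV_eta: "0 < x \<Longrightarrow> (\<eta> has_real_derivative ln x + 1) (at x)"
  unfolding \<eta>_def[abs_def] by (auto intro!: derivative_eq_intros)

text \<open>The convexity argument works with positive weights; zero weights are reached by this
  limit.\<close>

lemma tendsto_eta:
  assumes "0 \<le> c" "0 < k"
  shows "((\<lambda>d. \<eta> (c + k * d)) \<longlongrightarrow> \<eta> c) (at_right 0)"
proof (cases "c = 0")
  case False
  have "((\<lambda>d. (c + k * d) * ln (c + k * d)) \<longlongrightarrow> (c + k * 0) * ln (c + k * 0)) (at_right 0)"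
    using False assms by (intro tendsto_intros) auto
  thus ?thesis by (simp add: \<eta>_def)
next
  case True
  have 1: "((\<lambda>d. 2 * (k * d - sqrt (k * d))) \<longlongrightarrow> 2 * (k * 0 - sqrt (k * 0))) (at_right 0)"
    by (intro tendsto_intros)
  have "eventually (\<lambda>d::real. 0 < d \<and> d < 1 / k) (at_right 0)"
    using assms(2) by (intro eventually_at_right_real[THEN eventually_mono]) auto
  hence "eventually (\<lambda>d. 2 * (k * d - sqrt (k * d)) \<le> \<eta> (c + k * d) \<and> \<eta> (c + k * d) \<le> 0) (at_right 0)"
  proof eventually_elim
    case (elim d)
    define x where "x = k * d"
    have x: "0 < x" "x < 1" using elim assms(2) by (auto simp: x_def field_simps)
    \<comment> \<open>Using ln t <= t - 1 at 1 / sqrt x, rather than at 1 / x, gives a lower bound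
      for x ln x that tends to 0 with x.\<close>
    have "ln (1 / sqrt x) \<le> 1 / sqrt x - 1" using x by (intro ln_le_minus_one) auto
    hence "2 * (1 - 1 / sqrt x) \<le> ln x" using x by (simp add: ln_div ln_sqrt)
    hence "x * (2 * (1 - 1 / sqrt x)) \<le> x * ln x" using x by (intro mult_left_mono) auto
    also have "x * (2 * (1 - 1 / sqrt x)) = 2 * (x - sqrt x)"
    proof -
      have "x / sqrt x = sqrt x" using x by (simp add: real_div_sqrt)
      moreover have "x * (2 * (1 - 1 / sqrt x)) = 2 * (x - x / sqrt x)" by (simp add: algebra_simps)
      ultimately show ?thesis by simp
    qed
    finally have "2 * (x - sqrt x) \<le> \<eta> x" by (simp add: \<eta>_def)
    moreover have "\<eta> x \<le> 0" using x by (simp add: \<eta>_def mult_nonneg_nonpos)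
    ultimately show ?case using True by (simp add: x_def)
  qed
  hence e: "eventually (\<lambda>d. 2 * (k * d - sqrt (k * d)) \<le> \<eta> (c + k * d)) (at_right 0)"
    "eventually (\<lambda>d. \<eta> (c + k * d) \<le> 0) (at_right 0)"
    by (simp_all only: eventually_conj_iff)
  have "((\<lambda>d. \<eta> (c + k * d)) \<longlongrightarrow> 0) (at_right 0)"
    by (rule tendsto_sandwich[OF e _ tendsto_const]) (use 1 in simp)
  thus ?thesis using True by simp
qed

text \<open>For a bit with weights \<open>(a, b)\<close>, \<open>gap p a b\<close> is the entropy of its output under the binary
  symmetric channel with error probability \<open>p\<close>, minus the entropy of its output under the
  erasure channel with erasure probability \<open>4/5\<close>, up to a multiple of \<open>a + b\<close>.\<close>

definition gap :: "real \<Rightarrow> real \<Rightarrow> real \<Rightarrow> real" where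
  "gap p a b = (\<eta> a + \<eta> b) / 5 + 4 / 5 * \<eta> (a + b) - \<eta> ((1 - p) * a + p * b) - \<eta> (p * a + (1 - p) * b)"

text \<open>With c = 1 - 2 p and y = p + c x the second derivative is 1 / (5 x (1 - x)) - c^2 / (y
  (1 - y)). The noisy weight y is at least as close to 1/2 as x, so y (1 - y) >= x (1 - x), and c^2
  <= 1/5 finishes.\<close>

lemma gap_convex:
  assumes p: "0 < p" "p < 1" "(1 - 2 * p)\<^sup>2 \<le> 1 / 5"
  shows "convex_on {0<..<1} (\<lambda>x. gap p (1 - x) x)"
proof -
  define c where "c = 1 - 2 * p"
  define y where "y x = p + c * x" for x
  have y: "0 < y x" "0 < 1 - y x" if "x \<in> {0<..<1}" for x
  proof -
    have "y x = p * (1 - x) + (1 - p) * x" "1 - y x = (1 - p) * (1 - x) + p * x"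
      by (auto simp: y_def c_def algebra_simps)
    thus "0 < y x" "0 < 1 - y x" using p that by (auto intro!: add_pos_pos mult_pos_pos)
  qed
  have eq: "(\<lambda>x. gap p (1 - x) x) =
     (\<lambda>x. (\<eta> (1 - x) + \<eta> x) / 5 - \<eta> (1 - y x) - \<eta> (y x))"
  proof (rule ext)
    fix x
    have "(1 - p) * (1 - x) + p * x = 1 - y x" "p * (1 - x) + (1 - p) * x = y x"
      by (simp_all add: y_def c_def algebra_simps)
    thus "gap p (1 - x) x = (\<eta> (1 - x) + \<eta> x) / 5 - \<eta> (1 - y x) - \<eta> (y x)"
      by (simp add: gap_def)
  qed
  have c5: "c\<^sup>2 \<le> 1 / 5" using p(3) by (simp add: c_def)
  show ?thesis unfolding eq
  proof (rule f''_ge0_imp_convex)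
    fix x :: real assume x: "x \<in> {0<..<1}"
    note yx = y[OF x]
    have dy: "(y has_real_derivative c) (at x)" "((\<lambda>x. 1 - y x) has_real_derivative - c) (at x)"
      "((\<lambda>x. 1 - x) has_real_derivative - 1) (at x)"
      unfolding y_def[abs_def] by (auto intro!: derivative_eq_intros)
    have x': "0 < x" "0 < 1 - x" using x by auto
    show "((\<lambda>x. (\<eta> (1 - x) + \<eta> x) / 5 - \<eta> (1 - y x) - \<eta> (y x))
       has_real_derivative ((ln x - ln (1 - x)) / 5 - c * (ln (y x) - ln (1 - y x)))) (at x)"
      by (rule DERIV_cong[OF DERIV_diff[OF DERIV_diff[OF DERIV_cdivide[OF DERIV_add[OF
            DERIV_chain2[OF DERIV_eta[OF x'(2)] dy(3)] DERIV_eta[OF x'(1)]]]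
            DERIV_chain2[OF DERIV_eta[OF yx(2)] dy(2)]] DERIV_chain2[OF DERIV_eta[OF yx(1)] dy(1)]]])
        (simp add: algebra_simps)
    show "((\<lambda>x. (ln x - ln (1 - x)) / 5 - c * (ln (y x) - ln (1 - y x))) has_real_derivative
       ((1 / x + 1 / (1 - x)) / 5 - c * (c / y x + c / (1 - y x)))) (at x)"
      by (rule DERIV_cong[OF DERIV_diff[OF DERIV_cdivide[OF DERIV_diff[OF
            DERIV_ln_divide[OF x'(1)] DERIV_chain2[OF DERIV_ln_divide[OF x'(2)] dy(3)]]]
            DERIV_cmult[OF DERIV_diff[OF DERIV_chain2[OF DERIV_ln_divide[OF yx(1)] dy(1)]
              DERIV_chain2[OF DERIV_ln_divide[OF yx(2)] dy(2)]]]]])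
        simp
    have 1: "1 / x + 1 / (1 - x) = 1 / (x * (1 - x))" using x by (simp add: field_simps)
    have 2: "c / y x + c / (1 - y x) = c / (y x * (1 - y x))" using yx by (simp add: field_simps)
    have yy: "y x * (1 - y x) - x * (1 - x) = p * (1 - p) * (1 - 2 * x)\<^sup>2"
      by (simp add: y_def c_def power2_eq_square algebra_simps)
    have "0 \<le> p * (1 - p) * (1 - 2 * x)\<^sup>2" using p by simp
    hence "x * (1 - x) \<le> y x * (1 - y x)" using yy by linarith
    hence "1 / (y x * (1 - y x)) \<le> 1 / (x * (1 - x))"
      using x' yx by (intro divide_left_mono) (auto intro!: mult_pos_pos)
    hence "c\<^sup>2 * (1 / (y x * (1 - y x))) \<le> 1 / 5 * (1 / (x * (1 - x)))"
      using c5 yx x by (intro mult_mono) auto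
    thus "0 \<le> (1 / x + 1 / (1 - x)) / 5 - c * (c / y x + c / (1 - y x))"
      unfolding 1 2 by (simp add: power2_eq_square mult_ac)
  qed simp
qed

text \<open>The logarithms of the total weight cancel because 1/5 + 4/5 - 1 = 0.\<close>

lemma gap_homogeneous:
  assumes "0 < a" "0 < b" "0 < p" "p < 1"
  shows "gap p a b = (a + b) * gap p (1 - b / (a + b)) (b / (a + b))"
proof -
  define N where "N = a + b"
  define x where "x = b / N"
  have N: "0 < N" using assms by (simp add: N_def)
  have x: "0 < x" "0 < 1 - x" using assms N by (auto simp: x_def N_def)
  have b: "b = N * x" and a: "a = N * (1 - x)" using N by (auto simp: x_def right_diff_distrib) (simp add: N_def)
  have 1: "(1 - p) * a + p * b = N * ((1 - p) * (1 - x) + p * x)" "p * a + (1 - p) * b = N * (p * (1 - x) + (1 - p) * x)"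
    by (simp_all add: a b algebra_simps)
  have 2: "0 < (1 - p) * (1 - x) + p * x" "0 < p * (1 - x) + (1 - p) * x"
    using assms x by (auto intro!: add_pos_pos mult_pos_pos)
  have 3: "a + b = N" by (simp add: N_def)
  have "gap p a b = N * gap p (1 - x) x"
    unfolding gap_def 1 eta_mult[OF N 2(1)] eta_mult[OF N 2(2)] 3
    unfolding a b eta_mult[OF N x(1)] eta_mult[OF N x(2)]
    by (simp add: field_simps)
  thus ?thesis by (simp add: N_def x_def)
qed

text \<open>A function that is homogeneous of degree one and convex on normalised weights is
  subadditive; \<open>t\<close> is the share of the second pair in the total weight.\<close>

lemma gap_subadditive_pos:
  assumes p: "0 < p" "p < 1" "(1 - 2 * p)\<^sup>2 \<le> 1 / 5"
    and pos: "0 < a" "0 < b" "0 < a'" "0 < b'"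
  shows "gap p (a + a') (b + b') \<le> gap p a b + gap p a' b'"
proof -
  define N N' where "N = a + b" and "N' = a' + b'"
  have N: "0 < N" "0 < N'" using pos by (auto simp: N_def N'_def)
  define g where "g x = gap p (1 - x) x" for x
  define t where "t = N' / (N + N')"
  have t: "0 \<le> t" "t \<le> 1" using N by (auto simp: t_def)
  have in01: "b / N \<in> {0<..<1}" "b' / N' \<in> {0<..<1}"
    using pos by (auto simp: N_def N'_def)
  have "(1 - t) * (b / N) + t * (b' / N') = (b + b') / (N + N')"
  proof -
    have "1 - t = N / (N + N')" using N by (simp add: t_def field_simps)
    thus ?thesis using N by (simp add: t_def) (simp add: add_divide_distrib)
  qed
  hence "g ((b + b') / (N + N')) \<le> (1 - t) * g (b / N) + t * g (b' / N')"
    using convex_onD[OF gap_convex[OF p] t in01] by (simp add: g_def)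
  hence "(N + N') * g ((b + b') / (N + N')) \<le> (N + N') * ((1 - t) * g (b / N) + t * g (b' / N'))"
    using N by (intro mult_left_mono) auto
  also have "\<dots> = N * g (b / N) + N' * g (b' / N')"
  proof -
    have 1: "(N + N') * (1 - t) = N" "(N + N') * t = N'" using N by (simp_all add: t_def right_diff_distrib)
    have "(N + N') * ((1 - t) * g (b / N) + t * g (b' / N')) = ((N + N') * (1 - t)) * g (b / N) + ((N + N') * t) * g (b' / N')"
      by (simp add: algebra_simps)
    thus ?thesis unfolding 1 .
  qed
  also have "\<dots> = gap p a b + gap p a' b'"
    using gap_homogeneous[of a b p] gap_homogeneous[of a' b' p] pos p by (simp add: g_def N_def N'_def)
  finally show ?thesis
    using gap_homogeneous[of "a + a'" "b + b'" p] pos p by (simp add: g_def N_def N'_def algebra_simps)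
qed

lemma gap_subadditive:
  assumes p: "0 < p" "p < 1" "(1 - 2 * p)\<^sup>2 \<le> 1 / 5"
    and nonneg: "0 \<le> a" "0 \<le> b" "0 \<le> a'" "0 \<le> b'"
  shows "gap p (a + a') (b + b') \<le> gap p a b + gap p a' b'"
proof -
  have lim: "((\<lambda>d. gap p (a + k * d) (b + k * d)) \<longlongrightarrow> gap p a b) (at_right 0)"
    if "0 \<le> a" "0 \<le> b" "0 < k" for a b k
  proof -
    have eq: "gap p (a + k * d) (b + k * d) =
        (\<eta> (a + k * d) + \<eta> (b + k * d)) / 5 + 4 / 5 * \<eta> ((a + b) + (2 * k) * d)
        - \<eta> (((1 - p) * a + p * b) + k * d) - \<eta> ((p * a + (1 - p) * b) + k * d)" for d :: real
    proof -
      have "(1 - p) * (a + k * d) + p * (b + k * d) = ((1 - p) * a + p * b) + k * d"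
        "p * (a + k * d) + (1 - p) * (b + k * d) = (p * a + (1 - p) * b) + k * d"
        "a + k * d + (b + k * d) = (a + b) + (2 * k) * d" by (simp_all add: algebra_simps)
      thus ?thesis unfolding gap_def by (simp only:)
    qed
    have nn: "0 \<le> a + b" "0 \<le> (1 - p) * a + p * b" "0 \<le> p * a + (1 - p) * b" "0 < 2 * k"
      using that p by auto
    show ?thesis unfolding eq unfolding gap_def
      by (intro tendsto_diff tendsto_add tendsto_mult tendsto_divide tendsto_const tendsto_eta nn that)
        simp
  qed
  \<comment> \<open>Both pairs are shifted by \<open>d\<close> into the positive region, so their
    sum moves by \<open>2 * d\<close>; this is why \<open>lim\<close> carries a slope
    \<open>k\<close>.\<close>
  have "\<forall>\<^sub>F d in at_right (0::real). gap p ((a + a') + 2 * d) ((b + b') + 2 * d) \<le> gap p (a + 1 * d) (b + 1 * d) + gap p (a' + 1 * d) (b' + 1 * d)"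
    using eventually_at_right_less[of "0::real"]
  proof eventually_elim
    case (elim d)
    have "gap p ((a + d) + (a' + d)) ((b + d) + (b' + d)) \<le> gap p (a + d) (b + d) + gap p (a' + d) (b' + d)"
      using elim nonneg by (intro gap_subadditive_pos p) auto
    moreover have "(a + d) + (a' + d) = (a + a') + 2 * d" "(b + d) + (b' + d) = (b + b') + 2 * d" by auto
    ultimately show ?case by simp
  qed
  moreover have "((\<lambda>d. gap p ((a + a') + 2 * d) ((b + b') + 2 * d)) \<longlongrightarrow> gap p (a + a') (b + b')) (at_right 0)"
    using nonneg by (intro lim) auto
  moreover have "((\<lambda>d. gap p (a + 1 * d) (b + 1 * d) + gap p (a' + 1 * d) (b' + 1 * d)) \<longlongrightarrow> gap p a b + gap p a' b') (at_right 0)"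
    using nonneg by (intro tendsto_add lim) auto
  ultimately show ?thesis by (intro tendsto_le[OF trivial_limit_at_right_real])
qed

lemma gap_sum:
  assumes p: "0 < p" "p < 1" "(1 - 2 * p)\<^sup>2 \<le> 1 / 5"
    and "finite I" "\<And>i. i \<in> I \<Longrightarrow> 0 \<le> a i" "\<And>i. i \<in> I \<Longrightarrow> 0 \<le> b i"
  shows "gap p (\<Sum>i\<in>I. a i) (\<Sum>i\<in>I. b i) \<le> (\<Sum>i\<in>I. gap p (a i) (b i))"
  using assms(4-)
proof (induction I rule: finite_induct)
  case empty
  thus ?case by (simp add: gap_def)
next
  case (insert i I)
  have "gap p (a i + (\<Sum>i\<in>I. a i)) (b i + (\<Sum>i\<in>I. b i)) \<le> gap p (a i) (b i) + gap p (\<Sum>i\<in>I. a i) (\<Sum>i\<in>I. b i)"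
    using insert by (intro gap_subadditive p sum_nonneg) auto
  also have "\<dots> \<le> gap p (a i) (b i) + (\<Sum>i\<in>I. gap p (a i) (b i))"
    using insert by (intro add_left_mono insert.IH) auto
  finally show ?case using insert by simp
qed

section \<open>Channels acting on bits and on bit strings\<close>

lemma pmf_apply_channel:
  fixes P :: "('x \<times> 'y \<times> 'z::finite) pmf"
  shows "pmf (apply_channel P W) (x, y, c) = (\<Sum>z\<in>UNIV. pmf P (x, y, z) * pmf (W z) c)"
proof -
  have *: "apply_channel P W = P \<bind> (\<lambda>(x, y, z). map_pmf (\<lambda>w. (x, y, w)) (W z))"
    by (simp add: apply_channel_def map_pmf_def)
  have **: "pmf (map_pmf (\<lambda>w. (x', y', w)) (W z)) (x, y, c) = (if x' = x \<and> y' = y then pmf (W z) c else 0)" for x' y' z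
  proof (cases "x' = x \<and> y' = y")
    case True
    thus ?thesis using pmf_map_inj'[of "\<lambda>w. (x, y, w)" "W z" c] by (auto simp: inj_on_def)
  next
    case False
    thus ?thesis by (auto simp: pmf_eq_0_set_pmf)
  qed
  have "pmf (apply_channel P W) (x, y, c) =
      (\<Sum>t\<in>(\<lambda>z. (x, y, z)) ` UNIV. pmf (map_pmf (\<lambda>w. (fst t, fst (snd t), w)) (W (snd (snd t)))) (x, y, c) * pmf P t)"
    unfolding * pmf_bind case_prod_unfold
  proof (rule integral_measure_pmf_real)
    fix t assume "pmf (map_pmf (\<lambda>w. (fst t, fst (snd t), w)) (W (snd (snd t)))) (x, y, c) \<noteq> 0"
    hence "t = (x, y, snd (snd t))" unfolding ** by (auto simp: prod_eq_iff split: if_splits)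
    thus "t \<in> (\<lambda>z. (x, y, z)) ` UNIV" by (rule image_eqI) simp
  qed simp
  also have "\<dots> = (\<Sum>z\<in>UNIV. pmf P (x, y, z) * pmf (W z) c)"
    by (subst sum.reindex) (auto simp: inj_on_def ** mult.commute)
  finally show ?thesis .
qed

definition bsc :: "real \<Rightarrow> bool \<Rightarrow> bool pmf" where
  "bsc p w = map_pmf (\<lambda>e. w \<noteq> e) (bernoulli_pmf p)"

definition erasure :: "bool \<Rightarrow> eve_outcome pmf" where
  "erasure w = map_pmf (\<lambda>e. if e then (if w then E1 else E0) else EBot) (bernoulli_pmf (1/5))"

lemma pmf_bsc:
  assumes "0 \<le> p" "p \<le> 1"
  shows "pmf (bsc p w) j = (if j = w then 1 - p else p)"
proof -
  have "(\<lambda>e. w \<noteq> e) -` {j} = {w \<noteq> j}" by blast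
  hence "pmf (bsc p w) j = pmf (bernoulli_pmf p) (w \<noteq> j)"
    unfolding bsc_def pmf_map by (simp only: measure_pmf_single)
  thus ?thesis using assms by (cases w; cases j) simp_all
qed

lemma pmf_erasure:
  "pmf (erasure w) z = (case z of E0 \<Rightarrow> if w then 0 else 1/5 | E1 \<Rightarrow> if w then 1/5 else 0 | EBot \<Rightarrow> 4/5)"
proof -
  have "(\<lambda>e. if e then (if w then E1 else E0) else EBot) -` {z} =
    (case z of E0 \<Rightarrow> if w then {} else {True} | E1 \<Rightarrow> if w then {True} else {} | EBot \<Rightarrow> {False})"
    by (auto split: eve_outcome.split if_splits)
  thus ?thesis
    by (auto simp: erasure_def pmf_map measure_pmf_single split: eve_outcome.split)
qed

text \<open>The equivocation H(U | V).\<close>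

definition peq :: "'s pmf \<Rightarrow> ('s \<Rightarrow> 'u) \<Rightarrow> ('s \<Rightarrow> 'v) \<Rightarrow> real" where
  "peq D U V = pent D (\<lambda>s. (U s, V s)) - pent D V"

lemma peq_map_pmf:
  "finite (set_pmf D) \<Longrightarrow> peq (map_pmf f D) U V = peq D (\<lambda>s. U (f s)) (\<lambda>s. V (f s))"
  by (simp add: peq_def pent_map_pmf)

lemma peq_cong:
  assumes "\<And>s t. s \<in> set_pmf D \<Longrightarrow> t \<in> set_pmf D \<Longrightarrow> U s = U t \<longleftrightarrow> U' s = U' t"
    and "\<And>s t. s \<in> set_pmf D \<Longrightarrow> t \<in> set_pmf D \<Longrightarrow> V s = V t \<longleftrightarrow> V' s = V' t"
  shows "peq D U V = peq D U' V'"
  unfolding peq_def by (intro arg_cong2[where f = "(-)"] pent_cong) (use assms in auto)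

abbreviation peq3 :: "('u \<times> 't \<times> 'c) pmf \<Rightarrow> real" where
  "peq3 D \<equiv> peq D (\<lambda>(u, t, c). u) (\<lambda>(u, t, c). (t, c))"

lemma pmf_map_snd:
  assumes fin: "finite (set_pmf D)" "finite I" "fst ` set_pmf D \<subseteq> I"
  shows "pmf (map_pmf snd D) v = (\<Sum>u\<in>I. pmf D (u, v))"
proof -
  have "pmf (map_pmf snd D) v = (\<Sum>u\<in>fst ` set_pmf D. pmf D (u, v))"
    using weights.sum_mass_pair[OF weights_pmf[OF fin(1)], of fst snd v]
    by (simp add: mass_pmf[OF fin(1)])
  also have "\<dots> = (\<Sum>u\<in>I. pmf D (u, v))"
  proof (rule sum.mono_neutral_left[OF fin(2,3)], rule ballI)
    fix u assume "u \<in> I - fst ` set_pmf D"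
    hence "(u, v) \<notin> set_pmf D" by force
    thus "pmf D (u, v) = 0" by (simp add: set_pmf_iff)
  qed
  finally show ?thesis .
qed

text \<open>\<open>h a b\<close> is the unnormalised output entropy of the channel on a bit with
  weights \<open>(a, b)\<close>. For each \<open>t\<close> the equivocation measures how far
  \<open>h\<close> is from additive over the values of \<open>u\<close>, so a comparison of two
  channels becomes subadditivity of a difference of such functions.\<close>

lemma peq3_apply_channel:
  fixes D :: "('u \<times> 't \<times> bool) pmf" and c :: "bool \<Rightarrow> 'o::finite pmf"
  assumes fin: "finite (set_pmf D)"
  defines "h \<equiv> \<lambda>a b. - (\<Sum>z\<in>UNIV. (a * pmf (c False) z + b * pmf (c True) z) * log 2 (a * pmf (c False) z + b * pmf (c True) z))"
  shows "peq3 (apply_channel D c) =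
    (\<Sum>t\<in>fst ` snd ` set_pmf D. (\<Sum>u\<in>fst ` set_pmf D. h (pmf D (u, t, False)) (pmf D (u, t, True)))
       - h (\<Sum>u\<in>fst ` set_pmf D. pmf D (u, t, False)) (\<Sum>u\<in>fst ` set_pmf D. pmf D (u, t, True)))"
proof -
  let ?E = "apply_channel D c" and ?I = "fst ` set_pmf D" and ?T = "fst ` snd ` set_pmf D"
  have fc: "finite_channel c" by (auto simp: finite_channel_def)
  have finE: "finite (set_pmf ?E)" by (rule finite_apply_channel[OF fin fc])
  have sE: "set_pmf ?E \<subseteq> ?I \<times> ?T \<times> UNIV"
    by (auto simp: apply_channel_def image_iff Bex_def) blast+
  have pE: "pmf ?E (u, t, z) = pmf D (u, t, False) * pmf (c False) z + pmf D (u, t, True) * pmf (c True) z" for u t z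
    by (simp add: pmf_apply_channel UNIV_bool)
  have pE2: "pmf (map_pmf snd ?E) (t, z) =
      (\<Sum>u\<in>?I. pmf D (u, t, False)) * pmf (c False) z + (\<Sum>u\<in>?I. pmf D (u, t, True)) * pmf (c True) z" for t z
  proof -
    have "pmf (map_pmf snd ?E) (t, z) = (\<Sum>u\<in>?I. pmf ?E (u, t, z))"
      by (rule pmf_map_snd[OF finE]) (use fin sE in auto)
    thus ?thesis by (simp add: pE sum.distrib sum_distrib_right)
  qed
  have 1: "pent ?E (\<lambda>e. e) = (\<Sum>t\<in>?T. \<Sum>u\<in>?I. h (pmf D (u, t, False)) (pmf D (u, t, True)))"
  proof -
    have "pent ?E (\<lambda>e. e) = - (\<Sum>e\<in>?I \<times> ?T \<times> UNIV. pmf ?E e * log 2 (pmf ?E e))"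
      by (subst pent_eq[OF finE, of "?I \<times> ?T \<times> UNIV"]) (use fin sE in auto)
    hence "pent ?E (\<lambda>e. e) = (\<Sum>u\<in>?I. \<Sum>t\<in>?T. h (pmf D (u, t, False)) (pmf D (u, t, True)))"
      by (simp add: sum.cartesian_product' pE h_def sum_negf)
    also have "\<dots> = (\<Sum>t\<in>?T. \<Sum>u\<in>?I. h (pmf D (u, t, False)) (pmf D (u, t, True)))"
      by (rule sum.swap)
    finally show ?thesis .
  qed
  have 2: "pent ?E snd = (\<Sum>t\<in>?T. h (\<Sum>u\<in>?I. pmf D (u, t, False)) (\<Sum>u\<in>?I. pmf D (u, t, True)))"
  proof -
    have "pent ?E snd = - (\<Sum>e\<in>?T \<times> UNIV. pmf (map_pmf snd ?E) e * log 2 (pmf (map_pmf snd ?E) e))"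
      by (rule pent_eq[OF finE]) (use fin sE in auto)
    thus ?thesis by (simp add: sum.cartesian_product' pE2 h_def sum_negf)
  qed
  have "peq3 ?E = pent ?E (\<lambda>e. e) - pent ?E snd"
    by (simp add: peq_def case_prod_unfold)
  thus ?thesis unfolding 1 2 by (simp add: sum_subtractf)
qed

lemma UNIV_eve_sum: "(\<Sum>z\<in>UNIV. f z) = f E0 + f E1 + f EBot" for f :: "eve_outcome \<Rightarrow> real"
  by (simp add: UNIV_eve_outcome)

lemma eta_scale: "0 < k \<Longrightarrow> 0 \<le> a \<Longrightarrow> \<eta> (a * k) = k * \<eta> a + a * \<eta> k"
  using eta_mult[of a k] by (cases "a = 0") auto

text \<open>\<open>1 - 2 * p\<close> is the correlation of the symmetric channel and \<open>1 / 5\<close> the probability of no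
  erasure.\<close>

lemma less_noisy_step:
  fixes D :: "('u \<times> 't \<times> bool) pmf"
  assumes p: "0 < p" "p < 1" "(1 - 2 * p)\<^sup>2 \<le> 1 / 5" and fin: "finite (set_pmf D)"
  shows "peq3 (apply_channel D erasure) \<le> peq3 (apply_channel D (bsc p))"
proof -
  \<comment> \<open>Minus the entropy, in nats, of the erasure event. It enters in proportion to the
    total weight, so it is additive and drops out.\<close>
  define \<kappa> where "\<kappa> = \<eta> (1/5) + \<eta> (4/5)"
  define hz where "hz a b = - (\<Sum>z\<in>UNIV. (a * pmf (erasure False) z + b * pmf (erasure True) z) *
      log 2 (a * pmf (erasure False) z + b * pmf (erasure True) z))" for a b
  define hj where "hj a b = - (\<Sum>z\<in>UNIV. (a * pmf (bsc p False) z + b * pmf (bsc p True) z) *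
      log 2 (a * pmf (bsc p False) z + b * pmf (bsc p True) z))" for a b
  have hj: "hj a b = hz a b + (gap p a b + \<kappa> * (a + b)) / ln 2" if "0 \<le> a" "0 \<le> b" for a b
  proof -
    have "hj a b = - ((\<eta> ((1 - p) * a + p * b) + \<eta> (p * a + (1 - p) * b)) / ln 2)"
      using p by (simp add: hj_def xlog_eta UNIV_bool pmf_bsc add_divide_distrib mult.commute)
    moreover have "hz a b = - ((\<eta> (a * (1 / 5)) + \<eta> (b * (1 / 5)) + \<eta> ((a + b) * (4 / 5))) / ln 2)"
      by (simp add: hz_def xlog_eta UNIV_eve_sum pmf_erasure add_divide_distrib distrib_right)
    moreover have "\<eta> (a * (1 / 5)) + \<eta> (b * (1 / 5)) + \<eta> ((a + b) * (4 / 5)) =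
       (\<eta> a + \<eta> b) / 5 + 4 / 5 * \<eta> (a + b) + \<kappa> * (a + b)"
      using that by (subst eta_scale, simp, simp)+ (simp add: \<kappa>_def algebra_simps)
    ultimately show ?thesis by (simp add: gap_def field_simps)
  qed
  let ?I = "fst ` set_pmf D" and ?T = "fst ` snd ` set_pmf D"
  let ?a = "\<lambda>u t. pmf D (u, t, False)" and ?b = "\<lambda>u t. pmf D (u, t, True)"
  have "peq3 (apply_channel D erasure) = (\<Sum>t\<in>?T. (\<Sum>u\<in>?I. hz (?a u t) (?b u t)) - hz (\<Sum>u\<in>?I. ?a u t) (\<Sum>u\<in>?I. ?b u t))"
    unfolding hz_def by (rule peq3_apply_channel[OF fin])
  also have "\<dots> \<le> (\<Sum>t\<in>?T. (\<Sum>u\<in>?I. hj (?a u t) (?b u t)) - hj (\<Sum>u\<in>?I. ?a u t) (\<Sum>u\<in>?I. ?b u t))"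
  proof (rule sum_mono)
    fix t
    have "gap p (\<Sum>u\<in>?I. ?a u t) (\<Sum>u\<in>?I. ?b u t) \<le> (\<Sum>u\<in>?I. gap p (?a u t) (?b u t))"
      by (rule gap_sum[OF p]) (use fin in auto)
    hence "(gap p (\<Sum>u\<in>?I. ?a u t) (\<Sum>u\<in>?I. ?b u t) + \<kappa> * ((\<Sum>u\<in>?I. ?a u t) + (\<Sum>u\<in>?I. ?b u t))) / ln 2
       \<le> (\<Sum>u\<in>?I. gap p (?a u t) (?b u t) + \<kappa> * (?a u t + ?b u t)) / ln 2"
      by (intro divide_right_mono) (auto simp: sum.distrib simp flip: sum_distrib_left)
    also have "\<dots> = (\<Sum>u\<in>?I. (gap p (?a u t) (?b u t) + \<kappa> * (?a u t + ?b u t)) / ln 2)"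
      by (rule sum_divide_distrib)
    finally show "(\<Sum>u\<in>?I. hz (?a u t) (?b u t)) - hz (\<Sum>u\<in>?I. ?a u t) (\<Sum>u\<in>?I. ?b u t)
      \<le> (\<Sum>u\<in>?I. hj (?a u t) (?b u t)) - hj (\<Sum>u\<in>?I. ?a u t) (\<Sum>u\<in>?I. ?b u t)"
      by (simp add: hj sum_nonneg sum.distrib)
  qed
  also have "\<dots> = peq3 (apply_channel D (bsc p))"
    unfolding hj_def by (rule peq3_apply_channel[OF fin, symmetric])
  finally show ?thesis .
qed

fun chan_list :: "('w \<Rightarrow> 'o pmf) \<Rightarrow> 'w list \<Rightarrow> 'o list pmf" where
  "chan_list c [] = return_pmf []"
| "chan_list c (w # ws) = do {z \<leftarrow> c w; zs \<leftarrow> chan_list c ws; return_pmf (z # zs)}"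

lemma finite_chan_list:
  fixes c :: "'w \<Rightarrow> 'o::finite pmf"
  shows "finite (set_pmf (chan_list c ws))"
  by (induction ws) auto

text \<open>The letters are replaced one at a time; the outputs for the other letters are part of the
  conditioning variable.\<close>

lemma less_noisy_nat:
  fixes D :: "('u \<times> nat \<times> bool list) pmf"
  assumes p: "0 < p" "p < 1" "(1 - 2 * p)\<^sup>2 \<le> 1 / 5" and fin: "finite (set_pmf D)"
    and len: "\<And>u t ws. (u, t, ws) \<in> set_pmf D \<Longrightarrow> length ws = n"
  shows "peq3 (apply_channel D (chan_list erasure)) \<le> peq3 (apply_channel D (chan_list (bsc p)))"
  using fin len
proof (induction n arbitrary: D)
  case 0
  have "apply_channel D (chan_list c) = apply_channel D (\<lambda>_. return_pmf [])" for c :: "bool \<Rightarrow> 'o pmf"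
    unfolding apply_channel_def by (rule bind_pmf_cong[OF refl]) (auto dest!: 0(2))
  from this[of erasure] this[of "bsc p"] show ?case
    by (simp add: apply_channel_def bind_return_pmf case_prod_unfold map_pmf_def[symmetric]
        peq_map_pmf[OF 0(1)]) (simp add: peq_def pent_def ent_def mass_def)
next
  case (Suc n)
  let ?J = "bsc p" and ?Z = erasure
  \<comment> \<open>\<open>D1\<close> has sent the first letter through the symmetric channel and
    stored the result in the conditioning variable, coded in \<open>nat\<close> so that the
    induction hypothesis applies. \<open>D2\<close> has sent the later letters through the erasure
    channel and leaves the first to \<open>less_noisy_step\<close>. Both meet at the intermediate
    law \<open>GM\<close>.\<close>
  define D1 where "D1 = do {(u, t, ws) \<leftarrow> D; j \<leftarrow> ?J (hd ws); return_pmf (u, to_nat (t, j), tl ws)}"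
  define D2 where "D2 = do {(u, t, ws) \<leftarrow> D; zs \<leftarrow> chan_list ?Z (tl ws); return_pmf (u, (t, zs), hd ws)}"
  define GJ where "GJ = do {(u, t, ws) \<leftarrow> D; j \<leftarrow> ?J (hd ws); zs \<leftarrow> chan_list ?J (tl ws); return_pmf (u, t, j, zs)}"
  define GM where "GM = do {(u, t, ws) \<leftarrow> D; j \<leftarrow> ?J (hd ws); zs \<leftarrow> chan_list ?Z (tl ws); return_pmf (u, t, j, zs)}"
  define GZ where "GZ = do {(u, t, ws) \<leftarrow> D; j \<leftarrow> ?Z (hd ws); zs \<leftarrow> chan_list ?Z (tl ws); return_pmf (u, t, j, zs)}"
  note D = Suc.prems
  have fin: "finite (set_pmf GJ)" "finite (set_pmf GM)" "finite (set_pmf GZ)" "finite (set_pmf D1)" "finite (set_pmf D2)"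
    using D(1) by (auto simp: GJ_def GM_def GZ_def D1_def D2_def finite_chan_list)
  have split: "apply_channel D (chan_list c) = map_pmf (\<lambda>(u, t, j, zs). (u, t, j # zs))
     (do {(u, t, ws) \<leftarrow> D; j \<leftarrow> c (hd ws); zs \<leftarrow> chan_list c (tl ws); return_pmf (u, t, j, zs)})"
    for c :: "bool \<Rightarrow> 'o pmf"
    unfolding apply_channel_def map_bind_pmf
  proof (rule bind_pmf_cong[OF refl])
    fix s assume "s \<in> set_pmf D"
    then obtain u t w ws where "s = (u, t, w # ws)"
      using D(2) by (metis length_Suc_conv prod_cases3)
    thus "(case s of (x, y, z) \<Rightarrow> chan_list c z \<bind> (\<lambda>w. return_pmf (x, y, w))) =
         map_pmf (\<lambda>(u, t, j, zs). (u, t, j # zs))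
          (case s of (u, t, ws) \<Rightarrow> c (hd ws) \<bind> (\<lambda>j. chan_list c (tl ws) \<bind> (\<lambda>zs. return_pmf (u, t, j, zs))))"
      by (simp add: map_bind_pmf bind_assoc_pmf bind_return_pmf)
  qed
  let ?u = "\<lambda>(u, t, j, zs). u" and ?tjz = "\<lambda>(u, t, j, zs). (t, j, zs)"
  have 1: "peq3 (apply_channel D (chan_list ?J)) = peq GJ ?u ?tjz"
    unfolding split GJ_def[symmetric] peq_map_pmf[OF fin(1)] by (rule peq_cong) auto
  have 4: "peq3 (apply_channel D (chan_list ?Z)) = peq GZ ?u ?tjz"
    unfolding split GZ_def[symmetric] peq_map_pmf[OF fin(3)] by (rule peq_cong) auto
  have "apply_channel D1 (chan_list ?J) = map_pmf (\<lambda>(u, t, j, zs). (u, to_nat (t, j), zs)) GJ"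
    by (simp add: apply_channel_def D1_def GJ_def map_bind_pmf bind_assoc_pmf bind_return_pmf case_prod_unfold)
  hence 2: "peq3 (apply_channel D1 (chan_list ?J)) = peq GJ ?u ?tjz"
    by (simp add: peq_map_pmf[OF fin(1)]) (rule peq_cong; auto)
  have "apply_channel D1 (chan_list ?Z) = map_pmf (\<lambda>(u, t, j, zs). (u, to_nat (t, j), zs)) GM"
    by (simp add: apply_channel_def D1_def GM_def map_bind_pmf bind_assoc_pmf bind_return_pmf case_prod_unfold)
  hence 3: "peq3 (apply_channel D1 (chan_list ?Z)) = peq GM ?u ?tjz"
    by (simp add: peq_map_pmf[OF fin(2)]) (rule peq_cong; auto)
  have c: "apply_channel D2 c = map_pmf (\<lambda>(u, t, j, zs). (u, (t, zs), j))
     (do {(u, t, ws) \<leftarrow> D; j \<leftarrow> c (hd ws); zs \<leftarrow> chan_list ?Z (tl ws); return_pmf (u, t, j, zs)})"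
    for c :: "bool \<Rightarrow> 'o pmf"
    by (subst bind_commute_pmf) (simp add: apply_channel_def D2_def map_bind_pmf bind_assoc_pmf bind_return_pmf case_prod_unfold)
  have 5: "peq3 (apply_channel D2 ?J) = peq GM ?u ?tjz"
    unfolding c GM_def[symmetric] peq_map_pmf[OF fin(2)] by (rule peq_cong) auto
  have 6: "peq3 (apply_channel D2 ?Z) = peq GZ ?u ?tjz"
    unfolding c GZ_def[symmetric] peq_map_pmf[OF fin(3)] by (rule peq_cong) auto
  have "peq GM ?u ?tjz \<le> peq GJ ?u ?tjz"
    unfolding 2[symmetric] 3[symmetric]
    by (rule Suc.IH[OF fin(4)]) (use D(2) in \<open>fastforce simp: D1_def\<close>)
  moreover have "peq GZ ?u ?tjz \<le> peq GM ?u ?tjz"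
    unfolding 5[symmetric] 6[symmetric] by (rule less_noisy_step[OF p fin(5)])
  ultimately show ?case unfolding 1 4 by simp
qed

text \<open>The protocol never reads the third component, so a channel on it commutes with the run.
  Runs with Z and with J thus come from one run with W.\<close>

lemma run_apply_channel:
  "run \<pi> (apply_channel D W) = do {(kA, kB, F, ws) \<leftarrow> run \<pi> D; zs \<leftarrow> W ws; return_pmf (kA, kB, F, zs)}"
proof -
  have "run \<pi> (apply_channel D W) = do {(a, b, ws) \<leftarrow> D; zs \<leftarrow> W ws; r \<leftarrow> seedA \<pi>; s \<leftarrow> seedB \<pi>;
     let F = transcript (rounds \<pi>) (msgA \<pi> a r) (msgB \<pi> b s);
     return_pmf (outA \<pi> a r F, outB \<pi> b s F, F, zs)}"
    by (simp add: run_def apply_channel_def bind_assoc_pmf bind_return_pmf case_prod_unfold)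
  also have "\<dots> = do {(a, b, ws) \<leftarrow> D; r \<leftarrow> seedA \<pi>; s \<leftarrow> seedB \<pi>; zs \<leftarrow> W ws;
     let F = transcript (rounds \<pi>) (msgA \<pi> a r) (msgB \<pi> b s);
     return_pmf (outA \<pi> a r F, outB \<pi> b s F, F, zs)}"
  proof (intro bind_pmf_cong refl, clarify)
    fix a b ws
    show "W ws \<bind> (\<lambda>zs. seedA \<pi> \<bind> (\<lambda>r. seedB \<pi> \<bind> (\<lambda>s. let F = transcript (rounds \<pi>) (msgA \<pi> a r) (msgB \<pi> b s) in
        return_pmf (outA \<pi> a r F, outB \<pi> b s F, F, zs)))) =
      seedA \<pi> \<bind> (\<lambda>r. seedB \<pi> \<bind> (\<lambda>s. W ws \<bind> (\<lambda>zs. let F = transcript (rounds \<pi>) (msgA \<pi> a r) (msgB \<pi> b s) in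
        return_pmf (outA \<pi> a r F, outB \<pi> b s F, F, zs))))"
      by (subst bind_commute_pmf, rule bind_pmf_cong[OF refl], rule bind_commute_pmf)
  qed
  also have "\<dots> = do {(kA, kB, F, ws) \<leftarrow> run \<pi> D; zs \<leftarrow> W ws; return_pmf (kA, kB, F, zs)}"
    by (simp add: run_def bind_assoc_pmf bind_return_pmf case_prod_unfold Let_def)
  finally show ?thesis .
qed

lemma iid_apply_channel: "iid n (apply_channel P c) = apply_channel (iid n P) (chan_list c)"
proof (induction n)
  case 0
  show ?case by (simp add: iid_0 apply_channel_def bind_return_pmf)
next
  case (Suc n)
  have "iid (Suc n) (apply_channel P c) = do {(x, y, w) \<leftarrow> P; z \<leftarrow> c w; (xs, ys, ws) \<leftarrow> iid n P; zs \<leftarrow> chan_list c ws;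
      return_pmf (x # xs, y # ys, z # zs)}"
    by (simp add: iid_Suc Suc.IH) (simp add: apply_channel_def bind_assoc_pmf bind_return_pmf case_prod_unfold)
  also have "\<dots> = do {(x, y, w) \<leftarrow> P; (xs, ys, ws) \<leftarrow> iid n P; z \<leftarrow> c w; zs \<leftarrow> chan_list c ws;
      return_pmf (x # xs, y # ys, z # zs)}"
    unfolding case_prod_unfold by (rule bind_pmf_cong[OF refl], rule bind_commute_pmf)
  also have "\<dots> = apply_channel (iid (Suc n) P) (chan_list c)"
    by (simp add: iid_Suc apply_channel_def bind_assoc_pmf bind_return_pmf case_prod_unfold)
  finally show ?case .
qed

lemma pent_return_pmf: "pent (return_pmf x) U = 0"
  using pent_cong[of "return_pmf x" U "\<lambda>_. ()"] pent_const[of "return_pmf x" "()"] by simp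

lemma pcmi3_iid:
  fixes P :: "('x::finite \<times> 'y::finite \<times> 'z::finite) pmf"
  shows "pcmi3 (iid n P) = real n * pcmi3 P"
proof (induction n)
  case 0
  show ?case by (simp add: iid_0 pcmi3_def pcmi_def pent_return_pmf)
next
  case (Suc n)
  let ?G = "pair_pmf P (iid n P)"
  have fin: "finite (set_pmf P)" "finite (set_pmf (iid n P))" by auto
  hence finG: "finite (set_pmf ?G)" by simp
  have iid: "iid (Suc n) P = map_pmf (\<lambda>((x, y, z), (xs, ys, zs)). (x # xs, y # ys, z # zs)) ?G"
    by (simp add: iid_Suc pair_pmf_def map_bind_pmf case_prod_unfold bind_return_pmf map_pmf_def[symmetric] map_pmf_comp)
  note key = pent_pair_split[OF fin]
  have "pcmi3 (iid (Suc n) P) = pcmi3 P + pcmi3 (iid n P)"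
    unfolding iid pcmi3_def pcmi_map_pmf[OF finG] unfolding pcmi_def
    by (subst key[where U = "\<lambda>(x, y, z). (x, z)" and V = "\<lambda>(x, y, z). (x, z)"], force,
        subst key[where U = "\<lambda>(x, y, z). (y, z)" and V = "\<lambda>(x, y, z). (y, z)"], force,
        subst key[where U = "\<lambda>(x, y, z). (x, y, z)" and V = "\<lambda>(x, y, z). (x, y, z)"], force,
        subst key[where U = "\<lambda>(x, y, z). z" and V = "\<lambda>(x, y, z). z"], force)
      (simp add: case_prod_unfold)
  thus ?case by (simp add: Suc.IH algebra_simps)
qed

section \<open>The secret-key rate\<close>

text \<open>Write A, B for the two keys. They are independent given J and F, so H(A|J,F) =
  H(A|B,J,F) <= H(A|B), which Fano's inequality bounds. The less noisy comparison gives H(A|Z,F) <=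
  H(A|J,F), and the leakage H(A) - H(A|Z,F) closes the estimate.\<close>

lemma log_card_key_le:
  fixes Q :: "('x::finite \<times> 'y::finite \<times> bool) pmf" and \<pi> :: "('x list, 'y list, nat, nat) protocol" and n :: nat
  assumes p: "0 < p" "p < 1" "(1 - 2 * p)\<^sup>2 \<le> 1 / 5"
    and markov: "pcmi3 (apply_channel Q (bsc p)) = 0"
    and fs: "finite_seeds \<pi>" and K: "finite K" "\<And>a r F. outA \<pi> a r F \<in> K"
  defines "G \<equiv> run \<pi> (iid n (apply_channel Q erasure))"
  shows "measure_pmf.prob G {(kA, kB, F, zs). kA = kB} * log 2 (real (card K)) \<le>
     1 + (log 2 (real (card K)) - Hent G (\<lambda>(kA, kB, F, zs). kA))
     + mutual_info G (\<lambda>(kA, kB, F, zs). kA) (\<lambda>(kA, kB, F, zs). (zs, F))"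
proof -
  define R where "R = run \<pi> (iid n Q)"
  define H where "H = run \<pi> (iid n (apply_channel Q (bsc p)))"
  have finR: "finite (set_pmf R)" and finG: "finite (set_pmf G)" and finH: "finite (set_pmf H)"
    unfolding R_def G_def H_def by (auto intro!: finite_run fs)
  have G: "G = do {(kA, kB, F, ws) \<leftarrow> R; zs \<leftarrow> chan_list erasure ws; return_pmf (kA, kB, F, zs)}"
    and H: "H = do {(kA, kB, F, ws) \<leftarrow> R; zs \<leftarrow> chan_list (bsc p) ws; return_pmf (kA, kB, F, zs)}"
    by (simp_all add: G_def H_def R_def iid_apply_channel run_apply_channel)
  let ?A = "\<lambda>(kA, kB, F, zs). kA" and ?B = "\<lambda>(kA, kB, F, zs). kB" and ?CF = "\<lambda>(kA, kB, F, zs). (zs, F)"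
  let ?AB = "\<lambda>(kA, kB, F, zs). (kA, kB)"
  \<comment> \<open>Processing the third component does not touch the keys, so agreement and key
    entropy are common to both runs.\<close>
  have AB: "map_pmf ?AB G = map_pmf ?AB H"
    by (simp add: G H map_bind_pmf case_prod_unfold)
  have entA: "pent G ?A = pent H ?A"
    using pent_map_pmf[OF finG, of ?AB fst] pent_map_pmf[OF finH, of ?AB fst] AB
    by (simp add: case_prod_unfold)
  have probG: "measure_pmf.prob G {(kA, kB, F, zs). kA = kB} = 1 - measure_pmf.prob H {s. ?A s \<noteq> ?B s}"
  proof -
    have "measure_pmf.prob G {(kA, kB, F, zs). kA = kB} = measure_pmf.prob (map_pmf ?AB G) {(a, b). a = b}"
      by (auto simp: measure_map_pmf vimage_def case_prod_unfold)
    also have "\<dots> = measure_pmf.prob H {s. ?A s = ?B s}"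
      unfolding AB by (auto simp: measure_map_pmf vimage_def case_prod_unfold)
    also have "\<dots> = 1 - measure_pmf.prob H {s. ?A s \<noteq> ?B s}"
      using measure_pmf.prob_compl[of "{s. ?A s \<noteq> ?B s}" H]
      by (simp add: Collect_neg_eq[symmetric] Compl_eq_Diff_UNIV[symmetric])
    finally show ?thesis .
  qed

  define D where "D = map_pmf (\<lambda>(kA, kB, F, ws). (kA, to_nat F, ws)) R"
  have finD: "finite (set_pmf D)" using finR by (simp add: D_def)
  have D: "apply_channel D W = map_pmf (\<lambda>(kA, kB, F, zs). (kA, to_nat F, zs))
      (do {(kA, kB, F, ws) \<leftarrow> R; zs \<leftarrow> W ws; return_pmf (kA, kB, F, zs)})" for W :: "bool list \<Rightarrow> 'o pmf"
    by (simp add: D_def apply_channel_def map_bind_pmf bind_map_pmf case_prod_unfold)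
  have "peq3 (apply_channel D (chan_list erasure)) \<le> peq3 (apply_channel D (chan_list (bsc p)))"
  proof (rule less_noisy_nat[OF p finD])
    fix u t ws assume "(u, t, ws) \<in> set_pmf D"
    thus "length ws = n"
      by (auto simp: D_def R_def run_eq_map Let_def iid_def set_replicate_pmf)
  qed
  also have "peq3 (apply_channel D (chan_list erasure)) = peq G ?A ?CF"
    unfolding D G[symmetric] peq_map_pmf[OF finG] by (rule peq_cong) auto
  also have "peq3 (apply_channel D (chan_list (bsc p))) = peq H ?A ?CF"
    unfolding D H[symmetric] peq_map_pmf[OF finH] by (rule peq_cong) auto
  finally have less_noisy: "peq G ?A ?CF \<le> peq H ?A ?CF" .

  have "pcmi H ?A ?B ?CF \<le> pcmi3 (iid n (apply_channel Q (bsc p)))"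
    unfolding H_def by (rule pcmi_run[OF fs]) simp
  hence 1: "pcmi H ?A ?B ?CF \<le> 0" by (simp add: pcmi3_iid markov)
  have 2: "0 \<le> pcmi H ?A ?CF ?B" by (rule pcmi_nonneg[OF finH])
  have 3: "pent H (\<lambda>s. (?A s, ?B s)) - pent H ?B \<le> 1 + measure_pmf.prob H {s. ?A s \<noteq> ?B s} * log 2 (real (card K))"
    by (rule pent_fano[OF finH K(1)]) (auto simp: H_def run_eq_map Let_def K)
  have 4: "pent H (\<lambda>s. (?A s, ?CF s, ?B s)) = pent H (\<lambda>s. (?A s, ?B s, ?CF s))"
    "pent H (\<lambda>s. (?CF s, ?B s)) = pent H (\<lambda>s. (?B s, ?CF s))"
    by (rule pent_cong; auto)+
  have "peq H ?A ?CF \<le> 1 + measure_pmf.prob H {s. ?A s \<noteq> ?B s} * log 2 (real (card K))"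
    using 1 2 3 4 unfolding pcmi_def peq_def by linarith
  with less_noisy have "peq G ?A ?CF \<le> 1 + measure_pmf.prob H {s. ?A s \<noteq> ?B s} * log 2 (real (card K))"
    by simp
  moreover have "mutual_info G ?A ?CF = pent G ?A - peq G ?A ?CF"
    by (simp add: mutual_info_pent[OF finG] peq_def)
  ultimately show ?thesis
    unfolding probG Hent_pent[OF finG] by (simp add: algebra_simps)
qed

lemma key_rate_nonpos:
  fixes Q :: "('x::finite \<times> 'y::finite \<times> bool) pmf"
  assumes p: "0 < p" "p < 1" "(1 - 2 * p)\<^sup>2 \<le> 1 / 5"
    and markov: "pcmi3 (apply_channel Q (bsc p)) = 0"
    and adm: "admissible (apply_channel Q erasure) \<pi> K"
  shows "key_rate K \<le> 0"
proof -
  let ?G = "\<lambda>n. run (\<pi> n) (iid n (apply_channel Q erasure))"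
  let ?q = "\<lambda>n. measure_pmf.prob (?G n) {(kA, kB, F, zs). kA = kB}"
  let ?d = "\<lambda>n. log 2 (real (card (K n))) - Hent (?G n) (\<lambda>(kA, kB, F, zs). kA)"
  let ?m = "\<lambda>n. mutual_info (?G n) (\<lambda>(kA, kB, F, zs). kA) (\<lambda>(kA, kB, F, zs). (zs, F))"
  have K: "finite_seeds (\<pi> n)" "finite (K n)" "outA (\<pi> n) a r F \<in> K n" for n a r F
    using adm by (auto simp: admissible_def)
  have lim: "?q \<longlonglongrightarrow> 1" "?d \<longlonglongrightarrow> 0" "?m \<longlonglongrightarrow> 0"
    using adm by (auto simp: admissible_def)
  have half: "1 / 2 < (1 :: real)" by simp
  \<comment> \<open>Agreement above 1/2 and two error terms below 1 bound half of the key length by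
    3.\<close>
  have "\<forall>\<^sub>F n in sequentially. log 2 (real (card (K n))) \<le> 6"
    using order_tendstoD(1)[OF lim(1) half] order_tendstoD(2)[OF lim(2) zero_less_one]
      order_tendstoD(2)[OF lim(3) zero_less_one]
  proof eventually_elim
    case (elim n)
    hence q: "1 / 2 < ?q n" and d: "?d n < 1" and m: "?m n < 1" by simp_all
    have "K n \<noteq> {}" using K(3)[of n "[]" 0 "[]"] by auto
    hence "0 \<le> log 2 (real (card (K n)))" using K(2) by (simp add: Suc_leI card_gt_0_iff)
    hence "1 / 2 * log 2 (real (card (K n))) \<le> ?q n * log 2 (real (card (K n)))"
      using q by (intro mult_right_mono) auto
    also have "\<dots> \<le> 1 + ?d n + ?m n"
      by (rule log_card_key_le[OF p markov K])
    finally show ?case using d m by linarith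
  qed
  hence "\<forall>\<^sub>F n in sequentially. ereal (log 2 (real (card (K n))) / real n) \<le> ereal (6 / real n)"
    by eventually_elim (simp add: divide_right_mono)
  hence "key_rate K \<le> liminf (\<lambda>n. ereal (6 / real n))"
    unfolding key_rate_def by (rule Liminf_mono)
  also have "(\<lambda>n. ereal (6 / real n)) \<longlonglongrightarrow> ereal 0"
    by (intro tendsto_ereal lim_const_over_n)
  hence "liminf (\<lambda>n. ereal (6 / real n)) = 0"
    by (subst lim_imp_Liminf) (auto simp: zero_ereal_def)
  finally show ?thesis .
qed

text \<open>The silent protocol with a one-element key set is admissible; an empty supremum would be
  minus infinity.\<close>

lemma secret_key_rate_nonneg: "0 \<le> secret_key_rate P"
proof -
  define \<pi> :: "('a list, 'b list, nat, nat) protocol" where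
    "\<pi> = \<lparr>rounds = 0, seedA = return_pmf 0, seedB = return_pmf 0, msgA = \<lambda>_ _ _. 0, msgB = \<lambda>_ _ _. 0,
       outA = \<lambda>_ _ _. 0, outB = \<lambda>_ _ _. 0\<rparr>"
  have fs: "finite_seeds \<pi>" by (simp add: finite_seeds_def \<pi>_def)
  have run: "run \<pi> D = map_pmf (\<lambda>(a, b, c). (0, 0, [], c)) D" for D :: "('a list \<times> 'b list \<times> 'c list) pmf"
    by (simp add: run_def \<pi>_def bind_return_pmf map_pmf_def case_prod_unfold)
  have fin: "finite (set_pmf (run \<pi> (iid n P)))" for n
    by (rule finite_run[OF fs]) simp
  let ?A = "\<lambda>(kA :: nat, kB :: nat, F :: nat list, zs :: 'c list). kA"
  let ?C = "\<lambda>(kA :: nat, kB :: nat, F :: nat list, zs :: 'c list). (zs, F)"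
  have A: "pent (run \<pi> (iid n P)) ?A = 0" for n
  proof -
    have "pent (run \<pi> (iid n P)) ?A = pent (run \<pi> (iid n P)) (\<lambda>_. ())"
      by (rule pent_cong) (auto simp: run)
    thus ?thesis using pent_const[OF fin] by simp
  qed
  have "pent (run \<pi> (iid n P)) (\<lambda>s. (?A s, ?C s)) = pent (run \<pi> (iid n P)) ?C" for n
    by (rule pent_cong) (auto simp: run)
  hence "mutual_info (run \<pi> (iid n P)) ?A ?C = 0" for n
    by (simp add: mutual_info_pent[OF fin] A)
  moreover have "Hent (run \<pi> (iid n P)) ?A = 0" for n
    by (simp add: Hent_pent[OF fin] A)
  moreover have "measure_pmf.prob (run \<pi> (iid n P)) {(kA, kB, F, zs). kA = kB} = 1" for n
    by (simp add: run measure_map_pmf vimage_def case_prod_unfold)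
  ultimately have "admissible P (\<lambda>_. \<pi>) (\<lambda>_. {0})"
    using fs by (simp add: admissible_def) (simp add: \<pi>_def)
  moreover have "key_rate (\<lambda>_. {0}) = 0"
    by (simp add: key_rate_def Liminf_const zero_ereal_def)
  ultimately show ?thesis
    unfolding secret_key_rate_def by (intro Sup_upper2[of "key_rate (\<lambda>_. {0})"]) auto
qed

theorem secret_key_rate_eq_0:
  fixes Q :: "('x::finite \<times> 'y::finite \<times> bool) pmf"
  assumes "0 < p" "p < 1" "(1 - 2 * p)\<^sup>2 \<le> 1 / 5" "pcmi3 (apply_channel Q (bsc p)) = 0"
  shows "secret_key_rate (apply_channel Q erasure) = 0"
proof (rule antisym)
  show "secret_key_rate (apply_channel Q erasure) \<le> 0"
    unfolding secret_key_rate_def by (rule Sup_least) (use key_rate_nonpos[OF assms] in auto)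
qed (rule secret_key_rate_nonneg)

text \<open>The weight of \<open>w\<close> is split from the law of \<open>(x, y)\<close> so that erasing \<open>w\<close> with
  probability \<open>4/5\<close> gives the matrices \<open>M\<^sub>z\<close>.\<close>

definition Q_law :: "bool \<times> bool \<times> bool \<Rightarrow> real" where
  "Q_law = (\<lambda>(x, y, w). if x = y then (if x = w then 11/42 else 0) else 5/42)"

definition Q_pmf :: "(bool \<times> bool \<times> bool) pmf" where
  "Q_pmf = embed_pmf Q_law"

definition P_pmf :: "(bool \<times> bool \<times> eve_outcome) pmf" where
  "P_pmf = apply_channel Q_pmf erasure"

lemma UNIV_bool3: "(UNIV :: (bool \<times> bool \<times> bool) set) = {False, True} \<times> {False, True} \<times> {False, True}"
  by (auto simp: UNIV_bool)

lemma pmf_Q: "pmf Q_pmf = Q_law"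
proof (rule ext)
  fix s
  show "pmf Q_pmf s = Q_law s"
    unfolding Q_pmf_def
  proof (rule pmf_embed_pmf)
    show nn: "0 \<le> Q_law s" for s by (simp add: Q_law_def split: prod.split)
    have "(\<integral>\<^sup>+ x. ennreal (Q_law x) \<partial>count_space UNIV) = (\<Sum>x\<in>UNIV. ennreal (Q_law x))"
      by (rule nn_integral_count_space_finite) simp
    also have "\<dots> = ennreal (\<Sum>x\<in>UNIV. Q_law x)" by (rule sum_ennreal) (rule nn)
    also have "(\<Sum>x\<in>UNIV. Q_law x) = 1"
      unfolding UNIV_bool3 by (simp add: sum.cartesian_product' Q_law_def)
    finally show "(\<integral>\<^sup>+ x. ennreal (Q_law x) \<partial>count_space UNIV) = 1" by simp
  qed
qed

lemma pmf_P: "pmf P_pmf (x, y, z) = M_law z x y"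
  by (cases z; cases x; cases y)
    (simp_all add: P_pmf_def pmf_apply_channel UNIV_bool pmf_Q Q_law_def pmf_erasure)

lemma mass_bool3:
  fixes U :: "bool \<times> bool \<times> bool \<Rightarrow> 'v"
  shows "mass UNIV f U u = (\<Sum>x\<in>UNIV. \<Sum>y\<in>UNIV. \<Sum>c\<in>UNIV. if U (x, y, c) = u then f (x, y, c) else 0)"
proof -
  have "mass UNIV f U u = (\<Sum>s\<in>UNIV. if U s = u then f s else 0)"
    unfolding mass_def by (rule sum.inter_filter) simp
  thus ?thesis unfolding UNIV_Times_UNIV[symmetric] by (simp only: sum.cartesian_product')
qed

text \<open>Adding errors with \<open>p (1 - p) = 25/121\<close> to \<open>w\<close> makes the law of \<open>(x, y)\<close> given the result a
  product: \<open>55\<^sup>2 p (1 - p) = 25\<^sup>2\<close>.\<close>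

lemma pcmi3_markov_eq_0:
  assumes p: "0 < p" "p < 1" and eq: "p * (1 - p) = 25 / 121"
  shows "pcmi3 (apply_channel Q_pmf (bsc p)) = 0"
proof -
  let ?D = "apply_channel Q_pmf (bsc p)"
  let ?X = "\<lambda>(x, y, c). x" and ?Y = "\<lambda>(x, y, c). y" and ?C = "\<lambda>(x, y, c). c"
  have D: "pmf ?D (x, y, c) = (if x = y then (if x = c then 11/42 * (1 - p) else 11/42 * p) else 5/42)" for x y c
    using p by (auto simp: pmf_apply_channel UNIV_bool pmf_Q Q_law_def pmf_bsc field_simps)
  have key: "pmf ?D s * log 2 (mass UNIV (pmf ?D) (\<lambda>s. (?X s, ?C s)) (?X s, ?C s)) +
      pmf ?D s * log 2 (mass UNIV (pmf ?D) (\<lambda>s. (?Y s, ?C s)) (?Y s, ?C s)) =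
      pmf ?D s * log 2 (mass UNIV (pmf ?D) (\<lambda>s. (?X s, ?Y s, ?C s)) (?X s, ?Y s, ?C s)) +
      pmf ?D s * log 2 (mass UNIV (pmf ?D) ?C (?C s))" for s
  proof -
    obtain x y c where s: "s = (x, y, c)" by (cases s)
    have e: "mass UNIV (pmf ?D) (\<lambda>s. (?X s, ?C s)) (x, c) = 5/42 + 11/42 * (if x = c then 1 - p else p)"
      "mass UNIV (pmf ?D) (\<lambda>s. (?Y s, ?C s)) (y, c) = 5/42 + 11/42 * (if y = c then 1 - p else p)"
      "mass UNIV (pmf ?D) (\<lambda>s. (?X s, ?Y s, ?C s)) (x, y, c) = pmf ?D (x, y, c)"
      "mass UNIV (pmf ?D) ?C c = 1/2"
      unfolding mass_bool3 UNIV_bool D by (cases x; cases y; cases c; simp add: field_simps)+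
    have pos: "0 < 5/42 + 11/42 * (if x = c then 1 - p else p)" "0 < 5/42 + 11/42 * (if y = c then 1 - p else p)"
      "0 < pmf ?D (x, y, c)"
      using p by (auto simp: D intro!: add_pos_pos)
    \<comment> \<open>All eight cases are equivalent to 121 p^2 - 121 p + 25 = 0.\<close>
    have "(5/42 + 11/42 * (if x = c then 1 - p else p)) * (5/42 + 11/42 * (if y = c then 1 - p else p)) = pmf ?D (x, y, c) * (1/2)"
      using eq by (cases x; cases y; cases c; simp add: D field_simps; algebra?)
    hence "log 2 (5/42 + 11/42 * (if x = c then 1 - p else p)) + log 2 (5/42 + 11/42 * (if y = c then 1 - p else p)) =
      log 2 (pmf ?D (x, y, c)) + log 2 (1/2)"
      using pos by (metis less_irrefl log_mult zero_less_divide_1_iff zero_less_numeral)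
    thus ?thesis unfolding s by (simp only: e prod.case flip: distrib_left)
  qed
  have "pcmi3 ?D = cmi UNIV (pmf ?D) ?X ?Y ?C"
    unfolding pcmi3_def pcmi_cmi by (rule cmi_superset[symmetric]) (auto simp: set_pmf_iff)
  also have "\<dots> = 0"
    unfolding cmi_def ent_def using sum.cong[where A = UNIV and B = UNIV, OF refl key, of "\<lambda>s. s"]
    by (simp add: sum.distrib)
  finally show ?thesis .
qed

theorem secret_key_rate_P: "secret_key_rate P_pmf = 0"
proof -
  \<comment> \<open>The smaller root of p (1 - p) = 25/121, so that 1 - 2 p = sqrt 21 / 11.\<close>
  define p where "p = (1 - sqrt 21 / 11) / 2"
  have s: "sqrt 21 < 11" by (rule real_less_lsqrt) auto
  have s2: "sqrt 21 * sqrt 21 = (21 :: real)" by simp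
  have "- 11 < sqrt (21 :: real)" by (rule order_less_le_trans[of _ 0]) simp_all
  hence p: "0 < p" "p < 1" using s by (auto simp: p_def)
  have 1: "p * (1 - p) = 25 / 121" using s2 by (simp add: p_def field_simps)
  have "(1 - 2 * p)\<^sup>2 = 1 - 4 * (p * (1 - p))" by (simp add: power2_eq_square algebra_simps)
  hence "(1 - 2 * p)\<^sup>2 \<le> 1 / 5" using 1 by simp
  from secret_key_rate_eq_0[OF p this pcmi3_markov_eq_0[OF p 1]] show ?thesis
    by (simp add: P_pmf_def)
qed

section \<open>The intrinsic information\<close>

text \<open>One cell of a relative entropy, with joint mass \<open>D\<close> against the product X Y
  / M of the marginals. It is ln t <= t - 1 at t = g X Y / (M D), with equality when
  \<open>g\<close> is the true density ratio.\<close>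

lemma xlog_div_ge:
  fixes D g X Y M :: real
  assumes "0 \<le> D" "0 < g" "0 \<le> X" "0 \<le> Y" "0 \<le> M" and pos: "0 < D \<Longrightarrow> 0 < X \<and> 0 < Y \<and> 0 < M"
  shows "D * ln g + D - g * (X * Y / M) \<le> D * (ln D + ln M - ln X - ln Y)"
proof (cases "D = 0")
  case True
  thus ?thesis using assms by simp
next
  case False
  hence D: "0 < D" using assms by simp
  note p = pos[OF D]
  have "ln (g * X * Y / (M * D)) \<le> g * X * Y / (M * D) - 1"
    using D p assms(2) by (intro ln_le_minus_one) auto
  hence "D * ln (g * X * Y / (M * D)) \<le> D * (g * X * Y / (M * D) - 1)"
    using D by (intro mult_left_mono) auto
  also have "\<dots> = g * (X * Y / M) - D" using D p by (simp add: field_simps)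
  also have "ln (g * X * Y / (M * D)) = ln g + ln X + ln Y - ln M - ln D"
    using D p assms(2) by (simp add: ln_mult ln_div)
  finally show ?thesis by (simp add: algebra_simps)
qed

text \<open>One value of Eve's processed variable, with weights \<open>\<alpha>, \<beta>, \<gamma>\<close> of the matrices \<open>M\<^sub>0, M\<^sub>1, M\<^sub>\<bottom>\<close>.
  The relative entropy to the product of the marginals is bounded from below with the test
  function \<open>1 + k\<close> on the diagonal and \<open>1 - k\<close> off the diagonal. The bound is linear in the weights, and its
  first coefficient sums to \<open>9/2 * 10 - 11 * 2 > 0\<close> because the three weights each sum to 1.\<close>

lemma local_information_ge:
  fixes \<alpha> \<beta> \<gamma> k :: real
  assumes nn: "0 \<le> \<alpha>" "0 \<le> \<beta>" "0 \<le> \<gamma>" and k: "0 \<le> k" "k \<le> 1 / 2"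
  defines "a \<equiv> (11 * \<alpha> + 44 * \<gamma>) / 210" and "b \<equiv> (5 * \<alpha> + 5 * \<beta> + 40 * \<gamma>) / 210"
    and "d \<equiv> (11 * \<beta> + 44 * \<gamma>) / 210" and "n \<equiv> \<alpha> + \<beta> + 8 * \<gamma>"
  shows "k * (9 / 2 * n - 11 * (\<alpha> + \<beta>)) / 1000 - 2 * k\<^sup>2 * (n / 10) \<le>
     a * (ln a + ln (n / 10) - ln (a + b) - ln (a + b)) + b * (ln b + ln (n / 10) - ln (a + b) - ln (b + d)) +
     b * (ln b + ln (n / 10) - ln (b + d) - ln (a + b)) + d * (ln d + ln (n / 10) - ln (b + d) - ln (b + d))"
  (is "?l \<le> ?I")
proof -
  have abd: "0 \<le> a" "0 \<le> b" "0 \<le> d" using nn by (auto simp: a_def b_def d_def)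
  have m: "n / 10 = a + b + b + d" by (simp add: n_def a_def b_def d_def field_simps)
  have n0: "0 \<le> n" using nn by (simp add: n_def)
  \<comment> \<open>Stated for general \<open>t\<close>: the value 0 yields nonnegativity, the value
    \<open>k\<close> the main estimate.\<close>
  have I: "?I \<ge> a * ln (1 + t) + b * ln (1 - t) + b * ln (1 - t) + d * ln (1 + t) + n / 10
      - (1 + t) * ((a + b) * (a + b) / (n / 10)) - 2 * (1 - t) * ((a + b) * (b + d) / (n / 10))
      - (1 + t) * ((b + d) * (b + d) / (n / 10))" if t: "0 \<le> t" "t \<le> 1 / 2" for t
  proof -
    have arith: "A + a - P \<le> R1 \<Longrightarrow> B + b - Q \<le> R2 \<Longrightarrow> B + b - Q' \<le> R3 \<Longrightarrow> E + d - S \<le> R4 \<Longrightarrow>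
        Q' = Q \<Longrightarrow> T = Q + Q \<Longrightarrow> m = a + b + b + d \<Longrightarrow> A + B + B + E + m - P - T - S \<le> R1 + R2 + R3 + R4"
      for A B E P Q Q' S T R1 R2 R3 R4 m :: real by linarith
    have "a * ln (1 + t) + a - (1 + t) * ((a + b) * (a + b) / (n / 10)) \<le> a * (ln a + ln (n / 10) - ln (a + b) - ln (a + b))"
      by (rule xlog_div_ge) (use abd t n0 in \<open>auto simp: m\<close>)
    moreover have "b * ln (1 - t) + b - (1 - t) * ((a + b) * (b + d) / (n / 10)) \<le> b * (ln b + ln (n / 10) - ln (a + b) - ln (b + d))"
      by (rule xlog_div_ge) (use abd t n0 in \<open>auto simp: m\<close>)
    moreover have "b * ln (1 - t) + b - (1 - t) * ((b + d) * (a + b) / (n / 10)) \<le> b * (ln b + ln (n / 10) - ln (b + d) - ln (a + b))"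
      by (rule xlog_div_ge) (use abd t n0 in \<open>auto simp: m\<close>)
    moreover have "d * ln (1 + t) + d - (1 + t) * ((b + d) * (b + d) / (n / 10)) \<le> d * (ln d + ln (n / 10) - ln (b + d) - ln (b + d))"
      by (rule xlog_div_ge) (use abd t n0 in \<open>auto simp: m\<close>)
    moreover have "(1 - t) * ((b + d) * (a + b) / (n / 10)) = (1 - t) * ((a + b) * (b + d) / (n / 10))"
      by (simp add: mult.commute)
    moreover have "2 * (1 - t) * ((a + b) * (b + d) / (n / 10)) =
        (1 - t) * ((a + b) * (b + d) / (n / 10)) + (1 - t) * ((a + b) * (b + d) / (n / 10))"
      by (simp only: mult_2 distrib_right)
    ultimately show ?thesis using m by (rule arith)
  qed
  show ?thesis
  proof (cases "n = 0")
    case True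
    hence "\<alpha> = 0" "\<beta> = 0" "\<gamma> = 0" using nn by (auto simp: n_def)
    thus ?thesis by (simp add: a_def b_def d_def n_def)
  next
    case False
    hence n: "0 < n" using n0 by simp
    have Q: "(a + b) * (a + b) / (n / 10) + 2 * ((a + b) * (b + d) / (n / 10)) + (b + d) * (b + d) / (n / 10) = n / 10"
    proof -
      have sq: "(a + b) * (a + b) + 2 * ((a + b) * (b + d)) + (b + d) * (b + d) = (n / 10) * (n / 10)"
        unfolding m by (simp add: algebra_simps)
      have "((a + b) * (a + b) + 2 * ((a + b) * (b + d)) + (b + d) * (b + d)) / (n / 10) = n / 10"
        unfolding sq using n by simp
      moreover have "(a + b) * (a + b) / (n / 10) + 2 * ((a + b) * (b + d) / (n / 10)) + (b + d) * (b + d) / (n / 10) =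
          ((a + b) * (a + b) + 2 * ((a + b) * (b + d)) + (b + d) * (b + d)) / (n / 10)"
        by (simp only: add_divide_distrib times_divide_eq_right)
      ultimately show ?thesis by (simp only:)
    qed
    \<comment> \<open>The expectation of the test sign under the product of the marginals;
      subtracting it from a - b - b + d leaves a covariance.\<close>
    define S where "S = (a + b) * (a + b) / (n / 10) - 2 * ((a + b) * (b + d) / (n / 10)) + (b + d) * (b + d) / (n / 10)"
    show ?thesis
    \<comment> \<open>Where the linear form is negative the left side is nonpositive, and
      nonnegativity of the relative entropy suffices.\<close>
    proof (cases "0 \<le> 9 / 2 * n - 11 * (\<alpha> + \<beta>)")
      case False
      have "k * (9 / 2 * n - 11 * (\<alpha> + \<beta>)) \<le> 0" using False k by (intro mult_nonneg_nonpos) auto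
      moreover have "0 \<le> 2 * k\<^sup>2 * (n / 10)" using n by simp
      moreover have "x \<le> 0 \<Longrightarrow> 0 \<le> y \<Longrightarrow> x / 1000 - y \<le> 0" for x y :: real by linarith
      ultimately have "?l \<le> 0" by blast
      also have "0 \<le> ?I" using I[of 0] Q by simp
      finally show ?thesis .
    next
      case True
      have ln1: "k - 2 * k\<^sup>2 \<le> ln (1 + k)"
      proof -
        have "k - k\<^sup>2 \<le> ln (1 + k)" using k by (intro ln_one_plus_pos_lower_bound) auto
        moreover have "0 \<le> k\<^sup>2" by simp
        ultimately show ?thesis by linarith
      qed
      have ln2: "- k - 2 * k\<^sup>2 \<le> ln (1 - k)" by (rule ln_one_minus_pos_lower_bound) (use k in auto)
      have S: "a - b - b + d - S = (21 * n\<^sup>2 - 121 * (\<alpha> - \<beta>)\<^sup>2) / (4410 * n)"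
      proof -
        have "S = (a - d)\<^sup>2 / (n / 10)"
          by (simp add: S_def power2_eq_square diff_divide_distrib[symmetric] add_divide_distrib[symmetric]) (simp add: algebra_simps)
        also have "a - d = 11 * (\<alpha> - \<beta>) / 210" by (simp add: a_def d_def field_simps)
        finally have S: "S = (11 * (\<alpha> - \<beta>) / 210)\<^sup>2 / (n / 10)" .
        have e: "a - b - b + d = n / 210" by (simp add: a_def b_def d_def n_def field_simps)
        show ?thesis unfolding S e using n by (simp add: field_simps power2_eq_square)
      qed
      have "(\<alpha> - \<beta>)\<^sup>2 \<le> (\<alpha> + \<beta>)\<^sup>2" using nn by (intro power2_le_iff_abs_le[THEN iffD2]) auto
      \<comment> \<open>9/2 lies just below sqrt 21, so a multiple of the linear form stays below
        the quadratic expression. Division by 4410 n then gives the factor 1/980, rounded to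
        1/1000.\<close>
      hence "9 / 2 * n * (9 / 2 * n - 11 * (\<alpha> + \<beta>)) \<le> 21 * n\<^sup>2 - 121 * (\<alpha> - \<beta>)\<^sup>2"
      proof -
        have "121 * (\<alpha> + \<beta>)\<^sup>2 \<le> (11 * (\<alpha> + \<beta>)) * (9 / 2 * n)"
        proof -
          have "121 * (\<alpha> + \<beta>)\<^sup>2 = (11 * (\<alpha> + \<beta>)) * (11 * (\<alpha> + \<beta>))" by (simp add: power2_eq_square algebra_simps)
          also have "\<dots> \<le> (11 * (\<alpha> + \<beta>)) * (9 / 2 * n)" using True nn by (intro mult_left_mono) auto
          finally show ?thesis .
        qed
        moreover have "0 \<le> n\<^sup>2" by simp
        moreover have "9 / 2 * n * (9 / 2 * n - 11 * (\<alpha> + \<beta>)) = 81 / 4 * n\<^sup>2 - (11 * (\<alpha> + \<beta>)) * (9 / 2 * n)"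
          by (simp add: power2_eq_square algebra_simps)
        moreover have "121 * s \<le> x \<Longrightarrow> 0 \<le> y \<Longrightarrow> z = 81 / 4 * y - x \<Longrightarrow> r \<le> s \<Longrightarrow> z \<le> 21 * y - 121 * r"
          for s x y z r :: real by linarith
        ultimately show ?thesis using \<open>(\<alpha> - \<beta>)\<^sup>2 \<le> (\<alpha> + \<beta>)\<^sup>2\<close> by blast
      qed
      hence "9 / 2 * n * (9 / 2 * n - 11 * (\<alpha> + \<beta>)) / (4410 * n) \<le> a - b - b + d - S"
        unfolding S using n by (intro divide_right_mono) auto
      moreover have "9 / 2 * n * (9 / 2 * n - 11 * (\<alpha> + \<beta>)) / (4410 * n) = (9 / 2 * n - 11 * (\<alpha> + \<beta>)) / 980"
        using n by (simp add: field_simps)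
      moreover have "0 \<le> x \<Longrightarrow> x / 980 \<le> y \<Longrightarrow> x / 1000 \<le> y" for x y :: real by linarith
      ultimately have "(9 / 2 * n - 11 * (\<alpha> + \<beta>)) / 1000 \<le> a - b - b + d - S" using True by simp
      hence "k * ((9 / 2 * n - 11 * (\<alpha> + \<beta>)) / 1000) \<le> k * (a - b - b + d - S)"
        using k by (intro mult_left_mono) auto
      moreover have "a * (k - 2 * k\<^sup>2) + b * (- k - 2 * k\<^sup>2) + b * (- k - 2 * k\<^sup>2) + d * (k - 2 * k\<^sup>2) \<le>
          a * ln (1 + k) + b * ln (1 - k) + b * ln (1 - k) + d * ln (1 + k)"
        using abd ln1 ln2 by (intro add_mono mult_left_mono) auto
      moreover have "a * (k - 2 * k\<^sup>2) + b * (- k - 2 * k\<^sup>2) + b * (- k - 2 * k\<^sup>2) + d * (k - 2 * k\<^sup>2) =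
          k * (a - b - b + d) - 2 * k\<^sup>2 * (n / 10)" unfolding m by (simp add: algebra_simps)
      moreover have "k * (a - b - b + d - S) = k * (a - b - b + d) - k * S" by (simp add: algebra_simps)
      moreover have "(1 + k) * ((a + b) * (a + b) / (n / 10)) + 2 * (1 - k) * ((a + b) * (b + d) / (n / 10))
          + (1 + k) * ((b + d) * (b + d) / (n / 10)) = n / 10 + k * S"
      proof -
        have "(1 + k) * x + 2 * (1 - k) * y + (1 + k) * z = (x + 2 * y + z) + k * (x - 2 * y + z)" for x y z
          by (simp add: algebra_simps)
        thus ?thesis by (simp only: Q S_def)
      qed
      moreover have "k * (L / 1000) \<le> k * v' \<Longrightarrow> x \<le> y \<Longrightarrow> x = k * v - z \<Longrightarrow> k * v' = k * v - r \<Longrightarrow>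
          p + q + q' = m + r \<Longrightarrow> y + m - p - q - q' \<le> i \<Longrightarrow> k * L / 1000 - z \<le> i"
        for L v v' x y z r p q q' m i :: real by (simp only: times_divide_eq_right)
      ultimately show ?thesis using I[OF k] by blast
    qed
  qed
qed

lemma sum_bool_times:
  fixes f :: "bool \<times> bool \<times> 'c \<Rightarrow> 'a::comm_monoid_add"
  shows "(\<Sum>s\<in>UNIV \<times> UNIV \<times> C. f s) = (\<Sum>c\<in>C. \<Sum>x\<in>UNIV. \<Sum>y\<in>UNIV. f (x, y, c))"
  unfolding sum.cartesian_product' by (subst sum.swap[where A = C]) (intro sum.cong refl sum.swap)

lemma mass_bool_times:
  fixes U :: "bool \<times> bool \<times> 'c \<Rightarrow> 'v"
  assumes "finite C"
  shows "mass (UNIV \<times> UNIV \<times> C) f U u = (\<Sum>c\<in>C. \<Sum>x\<in>UNIV. \<Sum>y\<in>UNIV. if U (x, y, c) = u then f (x, y, c) else 0)"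
proof -
  have "mass (UNIV \<times> UNIV \<times> C) f U u = (\<Sum>s\<in>UNIV \<times> UNIV \<times> C. if U s = u then f s else 0)"
    unfolding mass_def by (rule sum.inter_filter) (use assms in simp)
  thus ?thesis by (simp only: sum_bool_times)
qed

text \<open>The local bounds are linear in the transition probabilities, so their sum forgets the
  channel and its output size. At k = 1/200 it is (45 - 22) / 200000 - 2 / 40000 = 13/200000, in
  nats.\<close>

lemma pcmi3_channel_ge:
  fixes W :: "eve_outcome \<Rightarrow> nat pmf"
  assumes W: "finite_channel W"
  shows "13 / 200000 / ln 2 \<le> pcmi3 (apply_channel P_pmf W)"
proof -
  let ?D = "apply_channel P_pmf W"
  define C where "C = (\<Union>z. set_pmf (W z))"
  have finC: "finite C" using W by (simp add: C_def finite_channel_def)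
  define a where "a c = (11 * pmf (W E0) c + 44 * pmf (W EBot) c) / 210" for c
  define b where "b c = (5 * pmf (W E0) c + 5 * pmf (W E1) c + 40 * pmf (W EBot) c) / 210" for c
  define d where "d c = (11 * pmf (W E1) c + 44 * pmf (W EBot) c) / 210" for c
  define n where "n c = pmf (W E0) c + pmf (W E1) c + 8 * pmf (W EBot) c" for c
  have n: "a c + b c + b c + d c = n c / 10" for c by (simp add: a_def b_def d_def n_def field_simps)
  have D: "pmf ?D (x, y, c) = (if x then if y then d c else b c else if y then b c else a c)" for x y c
    by (cases x; cases y) (simp_all add: pmf_apply_channel UNIV_eve_sum pmf_P a_def b_def d_def field_simps)
  let ?A = "UNIV \<times> UNIV \<times> C"
  let ?X = "\<lambda>(x :: bool, y :: bool, c :: nat). x" and ?Y = "\<lambda>(x :: bool, y :: bool, c :: nat). y"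
    and ?C = "\<lambda>(x :: bool, y :: bool, c :: nat). c"
  have "pcmi3 ?D = cmi ?A (pmf ?D) ?X ?Y ?C"
    unfolding pcmi3_def pcmi_cmi
  proof (rule cmi_superset[symmetric])
    show "set_pmf ?D \<subseteq> ?A" by (auto simp: C_def apply_channel_def)
  qed (simp_all add: finC set_pmf_iff)
  also have "\<dots> = (\<Sum>c\<in>C. \<Sum>x\<in>UNIV. \<Sum>y\<in>UNIV. pmf ?D (x, y, c) * (log 2 (mass ?A (pmf ?D) (\<lambda>s. (?X s, ?Y s, ?C s)) (x, y, c))
      + log 2 (mass ?A (pmf ?D) ?C c) - log 2 (mass ?A (pmf ?D) (\<lambda>s. (?X s, ?C s)) (x, c)) - log 2 (mass ?A (pmf ?D) (\<lambda>s. (?Y s, ?C s)) (y, c))))"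
    unfolding cmi_def ent_def sum_bool_times
    by (simp add: sum.distrib sum_subtractf algebra_simps)
  also have "\<dots> = (\<Sum>c\<in>C. (a c * (ln (a c) + ln (n c / 10) - ln (a c + b c) - ln (a c + b c)) +
     b c * (ln (b c) + ln (n c / 10) - ln (a c + b c) - ln (b c + d c)) +
     b c * (ln (b c) + ln (n c / 10) - ln (b c + d c) - ln (a c + b c)) +
     d c * (ln (d c) + ln (n c / 10) - ln (b c + d c) - ln (b c + d c))) / ln 2)"
  proof (rule sum.cong[OF refl])
    fix c assume c: "c \<in> C"
    have e: "mass ?A (pmf ?D) (\<lambda>s. (?X s, ?C s)) (x, c) = (if x then b c + d c else a c + b c)"
      "mass ?A (pmf ?D) (\<lambda>s. (?Y s, ?C s)) (x, c) = (if x then b c + d c else a c + b c)"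
      "mass ?A (pmf ?D) (\<lambda>s. (?X s, ?Y s, ?C s)) (x, y, c) = pmf ?D (x, y, c)"
      "mass ?A (pmf ?D) ?C c = n c / 10" for x y
      unfolding mass_bool_times[OF finC] n[symmetric] using c finC
      by (cases x; cases y; simp add: D UNIV_bool sum.distrib)+
    show "(\<Sum>x\<in>UNIV. \<Sum>y\<in>UNIV. pmf ?D (x, y, c) * (log 2 (mass ?A (pmf ?D) (\<lambda>s. (?X s, ?Y s, ?C s)) (x, y, c))
      + log 2 (mass ?A (pmf ?D) ?C c) - log 2 (mass ?A (pmf ?D) (\<lambda>s. (?X s, ?C s)) (x, c)) - log 2 (mass ?A (pmf ?D) (\<lambda>s. (?Y s, ?C s)) (y, c)))) =
     (a c * (ln (a c) + ln (n c / 10) - ln (a c + b c) - ln (a c + b c)) +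
     b c * (ln (b c) + ln (n c / 10) - ln (a c + b c) - ln (b c + d c)) +
     b c * (ln (b c) + ln (n c / 10) - ln (b c + d c) - ln (a c + b c)) +
     d c * (ln (d c) + ln (n c / 10) - ln (b c + d c) - ln (b c + d c))) / ln 2"
      unfolding e by (simp add: UNIV_bool D log_def add_divide_distrib diff_divide_distrib right_diff_distrib distrib_left mult.left_commute)
  qed
  also have "\<dots> \<ge> (\<Sum>c\<in>C. (1/200 * (9 / 2 * n c - 11 * (pmf (W E0) c + pmf (W E1) c)) / 1000 - 2 * (1/200)\<^sup>2 * (n c / 10)) / ln 2)"
    unfolding a_def b_def d_def n_def
    by (intro sum_mono divide_right_mono local_information_ge) auto
  also have "(\<Sum>c\<in>C. (1/200 * (9 / 2 * n c - 11 * (pmf (W E0) c + pmf (W E1) c)) / 1000 - 2 * (1/200)\<^sup>2 * (n c / 10)) / ln 2) = 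
     (1/200 * (9 / 2 * sum n C - 11 * ((\<Sum>c\<in>C. pmf (W E0) c) + (\<Sum>c\<in>C. pmf (W E1) c))) / 1000 - 2 * (1/200)\<^sup>2 * (sum n C / 10)) / ln 2"
    by (simp add: sum_subtractf sum.distrib power2_eq_square flip: sum_distrib_left sum_distrib_right sum_divide_distrib)
  also have "\<dots> = 13 / 200000 / ln 2"
  proof -
    have 1: "(\<Sum>c\<in>C. pmf (W z) c) = 1" for z
      using finC by (intro sum_pmf_eq_1) (auto simp: C_def)
    have "sum n C = 10" by (simp add: n_def sum.distrib 1 flip: sum_distrib_left)
    thus ?thesis by (simp add: 1 power2_eq_square)
  qed
  finally show ?thesis .
qed

theorem intrinsic_information_P_pos: "0 < intrinsic_information P_pmf"
proof -
  have "0 < 13 / 200000 / ln (2::real)" by simp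
  also have "\<dots> \<le> intrinsic_information P_pmf"
    unfolding intrinsic_information_eq
  proof (rule cINF_greatest)
    have "finite_channel (\<lambda>_. return_pmf 0 :: nat pmf)" by (simp add: finite_channel_def)
    thus "{W :: eve_outcome \<Rightarrow> nat pmf. finite_channel W} \<noteq> {}" by blast
  qed (use pcmi3_channel_ge in auto)
  finally show ?thesis .
qed

section \<open>Undistillability of states with positive partial transpose\<close>

text \<open>The quadratic form of the partial transpose of \<open>\<rho>\<close>.\<close>

definition pt_form :: "'i set \<Rightarrow> 'j set \<Rightarrow> ('i, 'j) kernel \<Rightarrow> ('i \<Rightarrow> 'j \<Rightarrow> complex) \<Rightarrow> complex" where
  "pt_form I J \<rho> x = (\<Sum>i\<in>I. \<Sum>i'\<in>I. \<Sum>j\<in>J. \<Sum>j'\<in>J. cnj (x i j) * \<rho> (i, j') (i', j) * x i' j')"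

definition ppt :: "'i set \<Rightarrow> 'j set \<Rightarrow> ('i, 'j) kernel \<Rightarrow> bool" where
  "ppt I J \<rho> \<longleftrightarrow> (\<forall>x. 0 \<le> Re (pt_form I J \<rho> x))"

definition ktrace :: "'i set \<Rightarrow> 'j set \<Rightarrow> ('i, 'j) kernel \<Rightarrow> complex" where
  "ktrace I J \<rho> = (\<Sum>i\<in>I. \<Sum>j\<in>J. \<rho> (i, j) (i, j))"

lemma sum4_swap:
  "(\<Sum>i\<in>I. \<Sum>i'\<in>I'. \<Sum>j\<in>J. \<Sum>j'\<in>J'. f i i' j j') = (\<Sum>j\<in>J. \<Sum>j'\<in>J'. \<Sum>i\<in>I. \<Sum>i'\<in>I'. f i i' j j')"
proof -
  have "(\<Sum>(i, i')\<in>I \<times> I'. \<Sum>(j, j')\<in>J \<times> J'. f i i' j j') = (\<Sum>(j, j')\<in>J \<times> J'. \<Sum>(i, i')\<in>I \<times> I'. f i i' j j')"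
    unfolding case_prod_unfold by (rule sum.swap)
  thus ?thesis by (simp add: sum.cartesian_product' case_prod_unfold)
qed

lemma sum_sandwich:
  fixes a b :: "'w \<Rightarrow> complex"
  shows "(\<Sum>w\<in>A. \<Sum>w'\<in>A. a w * (\<Sum>u\<in>B. \<Sum>v\<in>B. k w u * R u v * l w' v) * b w') =
    (\<Sum>u\<in>B. \<Sum>v\<in>B. (\<Sum>w\<in>A. a w * k w u) * R u v * (\<Sum>w'\<in>A. l w' v * b w'))"
proof -
  have "(\<Sum>w\<in>A. \<Sum>w'\<in>A. a w * (\<Sum>u\<in>B. \<Sum>v\<in>B. k w u * R u v * l w' v) * b w') =
     (\<Sum>w\<in>A. \<Sum>w'\<in>A. \<Sum>u\<in>B. \<Sum>v\<in>B. a w * k w u * R u v * (l w' v * b w'))"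
    by (simp add: sum_distrib_left sum_distrib_right mult_ac)
  also have "\<dots> = (\<Sum>u\<in>B. \<Sum>v\<in>B. \<Sum>w\<in>A. \<Sum>w'\<in>A. a w * k w u * R u v * (l w' v * b w'))"
    by (rule sum4_swap)
  also have "\<dots> = (\<Sum>u\<in>B. \<Sum>v\<in>B. (\<Sum>w\<in>A. a w * k w u) * R u v * (\<Sum>w'\<in>A. l w' v * b w'))"
    by (simp add: sum_distrib_left sum_distrib_right mult_ac)
  finally show ?thesis .
qed

text \<open>Local operations act on the partial transpose by pulling back the test vector, here with
  the adjoint of \<open>K\<close>, so positivity is inherited branch by branch.\<close>

lemma pt_form_alice:
  "pt_form I1 J (apply_alice I K \<rho>) x = pt_form I J \<rho> (\<lambda>v j. \<Sum>w\<in>I1. cnj (K w v) * x w j)"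
proof -
  have "pt_form I1 J (apply_alice I K \<rho>) x = (\<Sum>j\<in>J. \<Sum>j'\<in>J. \<Sum>w\<in>I1. \<Sum>w'\<in>I1. cnj (x w j) *
      (\<Sum>u\<in>I. \<Sum>v\<in>I. K w u * \<rho> (u, j') (v, j) * cnj (K w' v)) * x w' j')"
    unfolding pt_form_def apply_alice_def by (subst sum4_swap) simp
  also have "\<dots> = (\<Sum>j\<in>J. \<Sum>j'\<in>J. \<Sum>u\<in>I. \<Sum>v\<in>I. (\<Sum>w\<in>I1. cnj (x w j) * K w u) * \<rho> (u, j') (v, j) *
      (\<Sum>w'\<in>I1. cnj (K w' v) * x w' j'))"
    by (intro sum.cong refl sum_sandwich)
  also have "\<dots> = pt_form I J \<rho> (\<lambda>v j. \<Sum>w\<in>I1. cnj (K w v) * x w j)"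
    unfolding pt_form_def by (subst (2) sum4_swap) (simp add: mult.commute)
  finally show ?thesis .
qed

text \<open>The transposition is on Bob's side, so \<open>L\<close> enters without
  conjugation.\<close>

lemma pt_form_bob:
  "pt_form I J1 (apply_bob J L \<rho>) x = pt_form I J \<rho> (\<lambda>i u. \<Sum>w\<in>J1. L w u * x i w)"
proof -
  have "pt_form I J1 (apply_bob J L \<rho>) x = (\<Sum>i\<in>I. \<Sum>i'\<in>I. \<Sum>w'\<in>J1. \<Sum>w\<in>J1. x i' w' *
      (\<Sum>u\<in>J. \<Sum>v\<in>J. L w' u * \<rho> (i, u) (i', v) * cnj (L w v)) * cnj (x i w))"
    unfolding pt_form_def apply_bob_def
    by (rule sum.cong[OF refl], rule sum.cong[OF refl], subst sum.swap) (simp add: mult_ac)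
  also have "\<dots> = (\<Sum>i\<in>I. \<Sum>i'\<in>I. \<Sum>u\<in>J. \<Sum>v\<in>J. (\<Sum>w\<in>J1. x i' w * L w u) * \<rho> (i, u) (i', v) *
      (\<Sum>w\<in>J1. cnj (L w v) * cnj (x i w)))"
    by (intro sum.cong refl sum_sandwich)
  also have "\<dots> = pt_form I J \<rho> (\<lambda>i u. \<Sum>w\<in>J1. L w u * x i w)"
    unfolding pt_form_def
    by (rule sum.cong[OF refl], rule sum.cong[OF refl], subst sum.swap) (simp add: mult_ac)
  finally show ?thesis .
qed

lemma pt_form_sum: "pt_form I J (\<lambda>p q. \<Sum>m<k. \<tau> m p q) x = (\<Sum>m<k. pt_form I J (\<tau> m) x)"
  unfolding pt_form_def
  by (simp add: sum_distrib_left sum_distrib_right sum.swap[of _ "{..<k}"])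

lemma ppt_sum:
  fixes k :: nat
  shows "(\<And>m. m < k \<Longrightarrow> ppt I J (\<tau> m)) \<Longrightarrow> ppt I J (\<lambda>p q. \<Sum>m<k. \<tau> m p q)"
  unfolding ppt_def pt_form_sum Re_sum by (auto intro!: sum_nonneg)

lemma ktrace_sum: "ktrace I J (\<lambda>p q. \<Sum>m<k. \<tau> m p q) = (\<Sum>m<(k::nat). ktrace I J (\<tau> m))"
  unfolding ktrace_def sum.swap[of _ "{..<k}"] ..

lemma ktrace_alice:
  assumes K: "kraus_complete I k I1 K" and fin: "finite I"
  shows "(\<Sum>m<k. ktrace (I1 m) J (apply_alice I (K m) \<rho>)) = ktrace I J \<rho>"
proof -
  have "(\<Sum>m<k. ktrace (I1 m) J (apply_alice I (K m) \<rho>)) =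
      (\<Sum>m<k. \<Sum>w\<in>I1 m. \<Sum>j\<in>J. \<Sum>u\<in>I. \<Sum>v\<in>I. \<rho> (u, j) (v, j) * (cnj (K m w v) * K m w u))"
    by (simp add: ktrace_def apply_alice_def mult_ac)
  also have "\<dots> = (\<Sum>j\<in>J. \<Sum>u\<in>I. \<Sum>v\<in>I. \<Sum>m<k. \<Sum>w\<in>I1 m. \<rho> (u, j) (v, j) * (cnj (K m w v) * K m w u))"
  proof -
    have "(\<Sum>m<k. \<Sum>w\<in>I1 m. \<Sum>t\<in>J \<times> I \<times> I. g m w t) = (\<Sum>t\<in>J \<times> I \<times> I. \<Sum>m<k. \<Sum>w\<in>I1 m. g m w t)" for g :: "nat \<Rightarrow> _ \<Rightarrow> _ \<Rightarrow> complex"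
      by (subst sum.swap[of _ _ "{..<k}", symmetric]) (intro sum.cong refl sum.swap)
    from this[of "\<lambda>m w t. \<rho> (fst (snd t), fst t) (snd (snd t), fst t) * (cnj (K m w (snd (snd t))) * K m w (fst (snd t)))"]
    show ?thesis by (simp add: sum.cartesian_product')
  qed
  also have "\<dots> = (\<Sum>j\<in>J. \<Sum>u\<in>I. \<Sum>v\<in>I. \<rho> (u, j) (v, j) * (if v = u then 1 else 0))"
    using K unfolding kraus_complete_def by (intro sum.cong refl) (simp flip: sum_distrib_left)
  also have "\<dots> = ktrace I J \<rho>"
    using fin by (simp add: ktrace_def if_distrib sum.swap[of _ J] cong: if_cong)
  finally show ?thesis .
qed

text \<open>Exchanging the parties transfers Alice's trace identity to Bob.\<close>

definition flip_kernel :: "('i, 'j) kernel \<Rightarrow> ('j, 'i) kernel" where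
  "flip_kernel \<rho> = (\<lambda>(j, i) (j', i'). \<rho> (i, j) (i', j'))"

lemma ktrace_flip: "ktrace J I (flip_kernel \<rho>) = ktrace I J \<rho>"
  unfolding ktrace_def flip_kernel_def by (subst sum.swap) simp

lemma flip_apply_bob: "flip_kernel (apply_bob J L \<rho>) = apply_alice J L (flip_kernel \<rho>)"
  by (auto simp: fun_eq_iff flip_kernel_def apply_bob_def apply_alice_def)

lemma ktrace_bob:
  assumes "kraus_complete J k J1 L" "finite J"
  shows "(\<Sum>m<k. ktrace I (J1 m) (apply_bob J (L m) \<rho>)) = ktrace I J \<rho>"
  using ktrace_alice[OF assms, of I "flip_kernel \<rho>"]
  by (simp add: ktrace_flip flip: flip_apply_bob)

lemma locc_ktrace:
  assumes "locc I J \<rho> I' J' \<tau>" "finite I" "finite J"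
  shows "ktrace I' J' \<tau> = ktrace I J \<rho>"
  using assms
proof (induction rule: locc.induct)
  case (stop I J \<rho>)
  show ?case ..
next
  case (alice I k I1 K J \<rho> I' J' \<tau>)
  have "finite (I1 m)" if "m < k" for m using alice.hyps that by (simp add: kraus_complete_def)
  thus ?case using alice by (simp add: ktrace_sum ktrace_alice)
next
  case (bob J k J1 L I \<rho> I' J' \<tau>)
  have "finite (J1 m)" if "m < k" for m using bob.hyps that by (simp add: kraus_complete_def)
  thus ?case using bob by (simp add: ktrace_sum ktrace_bob)
qed

lemma locc_ppt:
  assumes "locc I J \<rho> I' J' \<tau>" "ppt I J \<rho>"
  shows "ppt I' J' \<tau>"
  using assms
proof (induction rule: locc.induct)
  case (alice I k I1 K J \<rho> I' J' \<tau>)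
  have "ppt (I1 m) J (apply_alice I (K m) \<rho>)" for m
    using alice.prems by (auto simp: ppt_def pt_form_alice)
  thus ?case using alice by (intro ppt_sum) auto
next
  case (bob J k J1 L I \<rho> I' J' \<tau>)
  have "ppt I (J1 m) (apply_bob J (L m) \<rho>)" for m
    using bob.prems by (auto simp: ppt_def pt_form_bob)
  thus ?case using bob by (intro ppt_sum) auto
qed

lemma ppt_fidelity_le:
  assumes ppt: "ppt {a0, a1} {b0, b1} \<tau>" and ne: "a0 \<noteq> a1" "b0 \<noteq> b1"
  shows "Re (\<tau> (a0, b0) (a0, b0) + \<tau> (a0, b0) (a1, b1) + \<tau> (a1, b1) (a0, b0) + \<tau> (a1, b1) (a1, b1))
     \<le> Re (ktrace {a0, a1} {b0, b1} \<tau>)"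
proof -
  \<comment> \<open>The vector |a0 b1> - |a1 b0>. The partial transpose of the maximally entangled
    projector is half the swap, and this is its negative eigenvector.\<close>
  define x :: "'a \<Rightarrow> 'b \<Rightarrow> complex" where
    "x i j = (if i = a0 \<and> j = b1 then 1 else if i = a1 \<and> j = b0 then -1 else 0)" for i j
  have "0 \<le> Re (pt_form {a0, a1} {b0, b1} \<tau> x)" using ppt by (simp add: ppt_def)
  also have "pt_form {a0, a1} {b0, b1} \<tau> x =
     \<tau> (a0, b1) (a0, b1) + \<tau> (a1, b0) (a1, b0) - \<tau> (a0, b0) (a1, b1) - \<tau> (a1, b1) (a0, b0)"
    using ne ne[symmetric] by (simp add: pt_form_def x_def)
  finally show ?thesis using ne by (simp add: ktrace_def)
qed

section \<open>Tensor powers and undistillability\<close>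

lemma sum_lists_Suc:
  fixes f :: "'a::finite list \<Rightarrow> 'b::comm_monoid_add"
  shows "(\<Sum>xs\<in>{xs. length xs = Suc n}. f xs) = (\<Sum>x\<in>UNIV. \<Sum>xs\<in>{xs. length xs = n}. f (x # xs))"
proof -
  have "{xs :: 'a list. length xs = Suc n} = (\<lambda>(x, xs). x # xs) ` (UNIV \<times> {xs. length xs = n})"
    by (auto simp: length_Suc_conv)
  thus ?thesis
    by (simp add: sum.reindex inj_on_def sum.cartesian_product' case_prod_unfold)
qed

lemma sum_lists_prod:
  fixes h :: "'a::finite \<Rightarrow> 'b::finite \<Rightarrow> complex"
  shows "(\<Sum>xs\<in>{xs. length xs = n}. \<Sum>ys\<in>{ys. length ys = n}. \<Prod>m<n. h (xs ! m) (ys ! m)) = (\<Sum>a\<in>UNIV. \<Sum>b\<in>UNIV. h a b) ^ n"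
proof (induction n)
  case (Suc n)
  have "(\<Sum>xs\<in>{xs. length xs = Suc n}. \<Sum>ys\<in>{ys. length ys = Suc n}. \<Prod>m<Suc n. h (xs ! m) (ys ! m)) =
     (\<Sum>a\<in>UNIV. \<Sum>xs\<in>{xs. length xs = n}. \<Sum>b\<in>UNIV. \<Sum>ys\<in>{ys. length ys = n}. h a b * (\<Prod>m<n. h (xs ! m) (ys ! m)))"
    unfolding sum_lists_Suc by (simp add: prod.lessThan_Suc_shift del: prod.lessThan_Suc)
  also have "\<dots> = (\<Sum>a\<in>UNIV. \<Sum>b\<in>UNIV. h a b * (\<Sum>xs\<in>{xs. length xs = n}. \<Sum>ys\<in>{ys. length ys = n}. \<Prod>m<n. h (xs ! m) (ys ! m)))"
    by (intro sum.cong refl, subst sum.swap) (simp add: sum_distrib_left)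
  also have "\<dots> = (\<Sum>a\<in>UNIV. \<Sum>b\<in>UNIV. h a b) ^ Suc n"
    by (simp add: Suc.IH flip: sum_distrib_right)
  finally show ?case .
qed simp

lemma ktrace_copies:
  assumes "trace \<sigma> = 1"
  shows "ktrace {xs. length xs = n} {ys. length ys = n} (copies n \<sigma>) = 1"
proof -
  have "(\<Sum>a\<in>UNIV. \<Sum>b\<in>UNIV. \<sigma> $ (a, b) $ (a, b)) = trace \<sigma>"
    unfolding trace_def UNIV_Times_UNIV[symmetric] by (simp only: sum.cartesian_product')
  thus ?thesis
    using sum_lists_prod[where n = n and h = "\<lambda>a b. \<sigma> $ (a, b) $ (a, b)"] assms by (simp add: ktrace_def copies_def)
qed

text \<open>The hypothesis writes the partial transpose as a sum of rank-one terms. Such a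
  decomposition passes to tensor powers by multiplying out, with one term for each choice of an
  index per copy.\<close>

lemma ppt_copies:
  fixes \<sigma> :: "complex^('a::finite \<times> 'b::finite)^('a \<times> 'b)" and f :: "'k \<Rightarrow> 'a \<Rightarrow> 'b \<Rightarrow> complex"
  assumes fin: "finite K"
    and f: "\<And>a b c d. \<sigma> $ (a, d) $ (c, b) = (\<Sum>k\<in>K. f k a b * cnj (f k c d))"
  shows "ppt {xs. length xs = n} {ys. length ys = n} (copies n \<sigma>)"
  unfolding ppt_def
proof
  fix x :: "'a list \<Rightarrow> 'b list \<Rightarrow> complex"
  let ?I = "{xs :: 'a list. length xs = n}" and ?J = "{ys :: 'b list. length ys = n}"
  let ?G = "PiE {..<n} (\<lambda>_. K)"
  define F where "F g xs ys = (\<Prod>m<n. f (g m) (xs ! m) (ys ! m))" for g xs ys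
  define T where "T g = (\<Sum>xs\<in>?I. \<Sum>ys\<in>?J. cnj (x xs ys) * F g xs ys)" for g
  have c: "copies n \<sigma> (xs, ys') (xs', ys) = (\<Sum>g\<in>?G. F g xs ys * cnj (F g xs' ys'))" for xs ys xs' ys'
    using fin by (simp add: copies_def f F_def prod.distrib prod_sum_PiE)
  have "pt_form ?I ?J (copies n \<sigma>) x =
     (\<Sum>xs\<in>?I. \<Sum>xs'\<in>?I. \<Sum>ys\<in>?J. \<Sum>ys'\<in>?J. \<Sum>g\<in>?G. (cnj (x xs ys) * F g xs ys) * cnj (cnj (x xs' ys') * F g xs' ys'))"
    unfolding pt_form_def c by (simp add: sum_distrib_left sum_distrib_right mult_ac)
  also have "\<dots> = (\<Sum>g\<in>?G. \<Sum>xs\<in>?I. \<Sum>xs'\<in>?I. \<Sum>ys\<in>?J. \<Sum>ys'\<in>?J. (cnj (x xs ys) * F g xs ys) * cnj (cnj (x xs' ys') * F g xs' ys'))"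
    by (simp only: sum.swap[of _ ?G])
  also have "\<dots> = (\<Sum>g\<in>?G. T g * cnj (T g))"
  proof (rule sum.cong[OF refl])
    fix g
    have "(\<Sum>xs\<in>?I. \<Sum>xs'\<in>?I. \<Sum>ys\<in>?J. \<Sum>ys'\<in>?J. (cnj (x xs ys) * F g xs ys) * cnj (cnj (x xs' ys') * F g xs' ys')) =
      (\<Sum>xs\<in>?I. \<Sum>xs'\<in>?I. (\<Sum>ys\<in>?J. cnj (x xs ys) * F g xs ys) * (\<Sum>ys'\<in>?J. cnj (cnj (x xs' ys') * F g xs' ys')))"
      by (simp only: sum_product)
    also have "\<dots> = T g * cnj (T g)"
      unfolding T_def by (simp only: sum_product[symmetric] cnj_sum)
    finally show "(\<Sum>xs\<in>?I. \<Sum>xs'\<in>?I. \<Sum>ys\<in>?J. \<Sum>ys'\<in>?J. (cnj (x xs ys) * F g xs ys) * cnj (cnj (x xs' ys') * F g xs' ys')) = T g * cnj (T g)" .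
  qed
  finally have eq: "pt_form ?I ?J (copies n \<sigma>) x = (\<Sum>g\<in>?G. T g * cnj (T g))" .
  have "0 \<le> Re (T g * cnj (T g))" for g by simp
  thus "0 \<le> Re (pt_form ?I ?J (copies n \<sigma>) x)"
    unfolding eq Re_sum by (intro sum_nonneg)
qed

theorem ppt_not_distillable:
  fixes \<sigma> :: "complex^('a::finite \<times> 'b::finite)^('a \<times> 'b)" and f :: "'k \<Rightarrow> 'a \<Rightarrow> 'b \<Rightarrow> complex"
  assumes "finite K" "\<And>a b c d. \<sigma> $ (a, d) $ (c, b) = (\<Sum>k\<in>K. f k a b * cnj (f k c d))"
    and tr: "trace \<sigma> = 1"
  shows "\<not> distillable \<sigma>"
proof
  assume "distillable \<sigma>"
  \<comment> \<open>Fidelity 3/4 already contradicts the bound 1/2.\<close>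
  hence "\<exists>n a0 a1 b0 b1 \<tau>. a0 \<noteq> a1 \<and> b0 \<noteq> b1 \<and>
     locc {xs. length xs = n} {ys. length ys = n} (copies n \<sigma>) {a0, a1} {b0, b1} \<tau> \<and>
     Re (\<tau> (a0, b0) (a0, b0) + \<tau> (a0, b0) (a1, b1) + \<tau> (a1, b1) (a0, b0) + \<tau> (a1, b1) (a1, b1)) / 2
       \<ge> 1 - (1/4::real)"
    unfolding distillable_def by (rule allE[of _ "1/4"]) simp
  then obtain n a0 a1 b0 b1 \<tau> where ne: "a0 \<noteq> a1" "b0 \<noteq> b1"
    and locc: "locc {xs. length xs = n} {ys. length ys = n} (copies n \<sigma>) {a0, a1} {b0, b1} \<tau>"
    and F: "Re (\<tau> (a0, b0) (a0, b0) + \<tau> (a0, b0) (a1, b1) + \<tau> (a1, b1) (a0, b0) + \<tau> (a1, b1) (a1, b1)) / 2 \<ge> 1 - (1/4::real)"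
    by blast
  have fin: "finite {xs :: 'a list. length xs = n}" "finite {ys :: 'b list. length ys = n}"
    using finite_lists_length_eq[of "UNIV :: 'a set" n] finite_lists_length_eq[of "UNIV :: 'b set" n] by simp_all
  have "ppt {a0, a1} {b0, b1} \<tau>" by (rule locc_ppt[OF locc ppt_copies[OF assms(1,2)]])
  moreover have "ktrace {a0, a1} {b0, b1} \<tau> = 1"
    using locc_ktrace[OF locc fin] ktrace_copies[OF tr] by simp
  ultimately have "Re (\<tau> (a0, b0) (a0, b0) + \<tau> (a0, b0) (a1, b1) + \<tau> (a1, b1) (a0, b0) + \<tau> (a1, b1) (a1, b1)) \<le> 1"
    using ppt_fidelity_le[OF _ ne, of \<tau>] by simp
  with F show False by linarith
qed

section \<open>The states and the measurements\<close>

lemma ket_nth: "ket i $ j = (if j = i then 1 else 0)"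
  by (simp add: ket_def axis_def)

lemma ket2_nth: "ket2 i j $ (a, b) = (if a = i \<and> b = j then 1 else 0)"
  by (simp add: ket2_def tensor_vec_def ket_nth)

lemma ketbra_nth: "ketbra v w $ i $ j = v $ i * cnj (w $ j)"
  by (simp add: ketbra_def)

lemma tensor_nth: "tensor M N $ (a, b) $ (c, d) = M $ a $ c * N $ b $ d"
  by (simp add: tensor_def)

lemma diag_nth: "diag d $ i $ j = (if i = j then d i else 0)"
  by (simp add: diag_def)

text \<open>\<open>forall_3\<close> lists the type as 1, 2, 3; modulo three the last is 0.\<close>

lemma all_3: "(\<forall>i::3. P i) \<longleftrightarrow> P 0 \<and> P 1 \<and> P 2"
proof -
  have "(3::3) = 0" by simp
  thus ?thesis unfolding forall_3 by metis
qed

lemma sum_UNIV_3: "(\<Sum>i\<in>UNIV. f i) = f 0 + f 1 + f (2::3)"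
proof -
  have "(3::3) = 0" by simp
  thus ?thesis unfolding sum_3 by (metis add.commute add.left_commute)
qed

lemma sum_UNIV_prod: "(\<Sum>p\<in>UNIV. f p) = (\<Sum>a\<in>UNIV. \<Sum>b\<in>UNIV. f (a, b))"
  unfolding UNIV_Times_UNIV[symmetric] by (simp only: sum.cartesian_product')

lemma sum_UNIV_env: "(\<Sum>e\<in>UNIV. f e) = f EPhi + (\<Sum>i\<in>UNIV. f (EUp i)) + (\<Sum>i\<in>UNIV. f (EDown i))"
proof -
  have "(\<Sum>e\<in>UNIV. f e) = f EPhi + (sum f (range EUp) + sum f (range EDown))"
    unfolding UNIV_env by (subst sum.insert, simp, force, subst sum.union_disjoint) auto
  also have "sum f (range EUp) = (\<Sum>i\<in>UNIV. f (EUp i))" by (subst sum.reindex) (auto simp: inj_def)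
  also have "sum f (range EDown) = (\<Sum>i\<in>UNIV. f (EDown i))" by (subst sum.reindex) (auto simp: inj_def)
  finally show ?thesis by (simp add: add.assoc)
qed

lemma Phi_nth: "Phi $ (a, b) = (if a = b then complex_of_real (1 / sqrt 3) else 0)"
proof -
  have "a = 0 \<or> a = 1 \<or> a = 2" using all_3[of "\<lambda>i. i = 0 \<or> i = 1 \<or> i = 2"] by blast
  moreover have "b = 0 \<or> b = 1 \<or> b = 2" using all_3[of "\<lambda>i. i = 0 \<or> i = 1 \<or> i = 2"] by blast
  ultimately show ?thesis
    unfolding Phi_def vector_scaleR_component vector_add_component ket2_nth
    by (auto simp: scaleR_conv_of_real)
qed

lemma Psi_nth:
  "Psi \<alpha> $ ((a, b), k) = complex_of_real (case k of
      EPhi \<Rightarrow> if a = b then sqrt (2/7) / sqrt 3 else 0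
    | EUp i \<Rightarrow> if a = i \<and> b = i + 1 then sqrt (\<alpha>/21) else 0
    | EDown i \<Rightarrow> if a = i + 1 \<and> b = i then sqrt ((5 - \<alpha>)/21) else 0)"
proof -
  have 1: "(\<Sum>i\<in>UNIV. tensor_vec (ket2 i (i + 1)) (ket (EUp i))) $ ((a, b), k) =
      (case k of EUp i \<Rightarrow> if a = i \<and> b = i + 1 then 1 else 0 | _ \<Rightarrow> 0)"
    by (cases k) (simp_all add: tensor_vec_def ket2_nth ket_nth if_distrib[where f = "\<lambda>x. _ * x"] cong: if_cong)
  have 2: "(\<Sum>i\<in>UNIV. tensor_vec (ket2 (i + 1) i) (ket (EDown i))) $ ((a, b), k) =
      (case k of EDown i \<Rightarrow> if a = i + 1 \<and> b = i then 1 else 0 | _ \<Rightarrow> 0)"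
    by (cases k) (simp_all add: tensor_vec_def ket2_nth ket_nth if_distrib[where f = "\<lambda>x. _ * x"] cong: if_cong)
  have 3: "tensor_vec Phi (ket EPhi) $ ((a, b), k) = (if k = EPhi \<and> a = b then complex_of_real (1 / sqrt 3) else 0)"
    by (simp add: tensor_vec_def Phi_nth ket_nth)
  show ?thesis
    unfolding Psi_def Let_def vector_add_component vector_scaleR_component 1 2 3
    by (cases k) (simp_all add: scaleR_conv_of_real)
qed

lemma sum_3_delta: "(\<Sum>i\<in>UNIV. if (i::3) = x \<and> Q i then y else 0) = (if Q x then y else 0)"
  by (subst sum.mono_neutral_right[of UNIV "{x}"]) auto

lemma sum_ketbra_up:
  "(\<Sum>i\<in>UNIV. ketbra (ket2 i (i + 1)) (ket2 i (i + 1))) $ (a, b) $ (c, d) =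
    (if a = c \<and> b = d \<and> b = a + 1 then 1 else 0)"
proof -
  have "(\<Sum>i\<in>UNIV. ketbra (ket2 i (i + 1)) (ket2 i (i + 1))) $ (a, b) $ (c, d) =
     (\<Sum>i\<in>UNIV. if i = a \<and> (b = i + 1 \<and> c = i \<and> d = i + 1) then 1 else 0)"
    by (auto simp: ketbra_nth ket2_nth intro!: sum.cong)
  thus ?thesis unfolding sum_3_delta by auto
qed

lemma sum_ketbra_down:
  "(\<Sum>i\<in>UNIV. ketbra (ket2 (i + 1) i) (ket2 (i + 1) i)) $ (a, b) $ (c, d) =
    (if a = c \<and> b = d \<and> a = b + 1 then 1 else 0)"
proof -
  have "(\<Sum>i\<in>UNIV. ketbra (ket2 (i + 1) i) (ket2 (i + 1) i)) $ (a, b) $ (c, d) =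
     (\<Sum>i\<in>UNIV. if i = b \<and> (a = i + 1 \<and> c = i + 1 \<and> d = i) then 1 else 0)"
    by (auto simp: ketbra_nth ket2_nth intro!: sum.cong)
  thus ?thesis unfolding sum_3_delta by auto
qed

lemma sigma_nth:
  "sigma_state \<alpha> $ (a, b) $ (c, d) = complex_of_real ((if a = b \<and> c = d then 2/21 else 0) +
     (if a = c \<and> b = d then (if b = a + 1 then \<alpha>/21 else 0) + (if a = b + 1 then (5 - \<alpha>)/21 else 0) else 0))"
proof -
  have 0: "ketbra Phi Phi $ (a, b) $ (c, d) = (if a = b \<and> c = d then 1/3 else 0)"
    by (simp add: ketbra_nth Phi_nth) (simp flip: of_real_mult)
  show ?thesis
    unfolding sigma_state_def Let_def vector_add_component vector_scaleR_component 0 sum_ketbra_up sum_ketbra_down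
    by (simp add: scaleR_conv_of_real)
qed

lemma purification:
  assumes "0 \<le> \<alpha>" "\<alpha> \<le> 5"
  shows "is_purification (Psi \<alpha>) (sigma_state \<alpha>)"
proof -
  have s: "sqrt (2/7) / sqrt 3 * (sqrt (2/7) / sqrt 3) = 2/21" "sqrt (\<alpha>/21) * sqrt (\<alpha>/21) = \<alpha>/21"
    "sqrt ((5 - \<alpha>)/21) * sqrt ((5 - \<alpha>)/21) = (5 - \<alpha>)/21"
    using assms by simp_all
  have "ptrace_snd (ketbra (Psi \<alpha>) (Psi \<alpha>)) $ (a, b) $ (c, d) = sigma_state \<alpha> $ (a, b) $ (c, d)" for a b c d
  proof -
    have 1: "(\<Sum>i\<in>UNIV. (if a = i \<and> b = i + 1 then sqrt (\<alpha>/21) else 0) * (if c = i \<and> d = i + 1 then sqrt (\<alpha>/21) else 0)) =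
       (\<Sum>i\<in>UNIV. if i = a \<and> (b = i + 1 \<and> c = i \<and> d = i + 1) then \<alpha>/21 else 0)"
      by (intro sum.cong refl) (auto simp: s assms)
    have 2: "(\<Sum>i\<in>UNIV. (if a = i + 1 \<and> b = i then sqrt ((5 - \<alpha>)/21) else 0) * (if c = i + 1 \<and> d = i then sqrt ((5 - \<alpha>)/21) else 0)) =
       (\<Sum>i\<in>UNIV. if i = b \<and> (a = i + 1 \<and> c = i + 1 \<and> d = i) then (5 - \<alpha>)/21 else 0)"
      by (intro sum.cong refl) (auto simp: s assms)
    have 0: "(if a = b then sqrt (2/7) / sqrt 3 else 0) * (if c = d then sqrt (2/7) / sqrt 3 else 0) = (if a = b \<and> c = d then 2/21 else 0)"
      using s(1) by simp
    have "ptrace_snd (ketbra (Psi \<alpha>) (Psi \<alpha>)) $ (a, b) $ (c, d) = complex_of_real (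
       (if a = b then sqrt (2/7) / sqrt 3 else 0) * (if c = d then sqrt (2/7) / sqrt 3 else 0) +
       (\<Sum>i\<in>UNIV. (if a = i \<and> b = i + 1 then sqrt (\<alpha>/21) else 0) * (if c = i \<and> d = i + 1 then sqrt (\<alpha>/21) else 0)) +
       (\<Sum>i\<in>UNIV. (if a = i + 1 \<and> b = i then sqrt ((5 - \<alpha>)/21) else 0) * (if c = i + 1 \<and> d = i then sqrt ((5 - \<alpha>)/21) else 0)))"
      unfolding ptrace_snd_def ketbra_def vec_lambda_beta sum_UNIV_env Psi_nth env.case complex_cnj_complex_of_real of_real_add of_real_mult of_real_sum ..
    thus ?thesis unfolding 0 1 2 sum_3_delta sigma_nth by (auto simp del: of_real_add)
  qed
  thus ?thesis by (auto simp: is_purification_def vec_eq_iff)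
qed

lemma expval_diag: "expval v (diag d) = (\<Sum>i\<in>UNIV. d i * complex_of_real ((cmod (v $ i))\<^sup>2))"
proof -
  have "(diag d *v v) $ i = d i * v $ i" for i
    by (simp add: matrix_vector_mult_def diag_nth if_distrib[where f = "\<lambda>x. x * _"] cong: if_cong)
  thus ?thesis
    unfolding expval_def by (intro sum.cong refl) (simp only: complex_norm_square, simp add: mult_ac)
qed

lemma positive_diag:
  assumes "\<And>i. 0 \<le> r i"
  shows "positive_op (diag (\<lambda>i. complex_of_real (r i)))"
  unfolding positive_op_def expval_diag
  by (auto simp: assms sum_nonneg simp flip: of_real_mult of_real_sum)

definition a_eff :: "bool \<Rightarrow> 3 \<Rightarrow> real" where
  "a_eff x i = (if x then 1 - (if i = 0 then 0 else if i = 1 then 1/2 else 1) else (if i = 0 then 0 else if i = 1 then 1/2 else 1))"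

definition b_eff :: "bool \<Rightarrow> 3 \<Rightarrow> real" where
  "b_eff y i = (if y then 1 - (if i = 0 then 1 else if i = 1 then 1/2 else 0) else (if i = 0 then 1 else if i = 1 then 1/2 else 0))"

lemma alice_povm_diag: "alice_povm x = diag (\<lambda>i. complex_of_real (a_eff x i))"
  by (auto simp: alice_povm_def vec_eq_iff diag_nth mat_def Let_def a_eff_def)

lemma bob_povm_diag: "bob_povm y = diag (\<lambda>i. complex_of_real (b_eff y i))"
  by (auto simp: bob_povm_def vec_eq_iff diag_nth mat_def Let_def b_eff_def)

lemma eve_povm_diag: "eve_povm \<alpha> z = diag (\<lambda>k. complex_of_real (q_eve \<alpha> z k))"
proof -
  have "eve_povm \<alpha> z $ i $ j = (\<Sum>k\<in>UNIV. if k = i then (if i = j then complex_of_real (q_eve \<alpha> z k) else 0) else 0)" for i j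
    unfolding eve_povm_def sum_component vector_scaleR_component ketbra_nth ket_nth
    by (rule sum.cong[OF refl]) (auto simp: scaleR_conv_of_real)
  thus ?thesis by (simp add: vec_eq_iff diag_nth)
qed

lemma alice_is_povm: "is_povm alice_povm"
  unfolding is_povm_def alice_povm_diag
  by (auto intro!: positive_diag simp: a_eff_def UNIV_bool vec_eq_iff diag_nth mat_def)

lemma bob_is_povm: "is_povm bob_povm"
  unfolding is_povm_def bob_povm_diag
  by (auto intro!: positive_diag simp: b_eff_def UNIV_bool vec_eq_iff diag_nth mat_def)

lemma q_eve_nonneg:
  assumes "2 \<le> \<alpha>" "\<alpha> \<le> 4"
  shows "0 \<le> q_eve \<alpha> z k"
  using assms by (cases z) (auto simp: q_eve_def Let_def field_simps)

lemma eve_is_povm: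
  assumes "2 \<le> \<alpha>" "\<alpha> \<le> 4"
  shows "is_povm (eve_povm \<alpha>)"
  unfolding is_povm_def eve_povm_diag
proof (intro conjI allI)
  show "positive_op (diag (\<lambda>k. complex_of_real (q_eve \<alpha> z k)))" for z
    by (rule positive_diag) (rule q_eve_nonneg[OF assms])
  have "q_eve \<alpha> E0 k + q_eve \<alpha> E1 k + q_eve \<alpha> EBot k = 1" for k
    by (simp add: q_eve_def Let_def)
  hence "complex_of_real (q_eve \<alpha> E0 k) + complex_of_real (q_eve \<alpha> E1 k) + complex_of_real (q_eve \<alpha> EBot k) = 1" for k
    by (metis of_real_add of_real_1)
  thus "(\<Sum>z\<in>UNIV. diag (\<lambda>k. complex_of_real (q_eve \<alpha> z k))) = mat 1"
    by (auto simp: UNIV_eve_outcome vec_eq_iff diag_nth mat_def add.assoc)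
qed

lemma tensor_diag: "tensor (diag a) (diag b) = diag (\<lambda>(i, j). a i * b j)"
  by (auto simp: vec_eq_iff tensor_nth diag_nth)

text \<open>All effects are diagonal, so only squared amplitudes matter. For outcomes 0 and 1 the
  factors alpha and beta cancel against those in \<open>q_eve\<close>. For the third outcome the two
  cycles of labels have equal weight under each pair of effects, so alpha enters only through alpha
  + beta = 5.\<close>

lemma outcome_law:
  assumes \<alpha>: "2 \<le> \<alpha>" "\<alpha> \<le> 4" and P: "\<And>x y z. pmf P (x, y, z) = M_law z x y"
  shows "has_outcome_law (Psi \<alpha>) alice_povm bob_povm (eve_povm \<alpha>) P"
  unfolding has_outcome_law_def
proof (intro allI)
  fix x y z
  let ?a = "a_eff x" and ?b = "b_eff y" and ?q = "q_eve \<alpha> z"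
  have s: "(sqrt (2/7) / sqrt 3)\<^sup>2 = 2/21" "(sqrt (\<alpha>/21))\<^sup>2 = \<alpha>/21" "(sqrt ((5 - \<alpha>)/21))\<^sup>2 = (5 - \<alpha>)/21"
    using \<alpha> by (simp_all add: power_divide)
  have "expval (Psi \<alpha>) (tensor (tensor (alice_povm x) (bob_povm y)) (eve_povm \<alpha> z)) =
     complex_of_real (\<Sum>i\<in>UNIV. \<Sum>j\<in>UNIV. \<Sum>k\<in>UNIV. ?a i * ?b j * ?q k * (cmod (Psi \<alpha> $ ((i, j), k)))\<^sup>2)"
    unfolding alice_povm_diag bob_povm_diag eve_povm_diag tensor_diag expval_diag sum_UNIV_prod
    by simp
  also have "(\<Sum>i\<in>UNIV. \<Sum>j\<in>UNIV. \<Sum>k\<in>UNIV. ?a i * ?b j * ?q k * (cmod (Psi \<alpha> $ ((i, j), k)))\<^sup>2) =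
     ?q EPhi * (2/21) * (?a 0 * ?b 0 + ?a 1 * ?b 1 + ?a 2 * ?b 2) +
     ((\<alpha> * ?q (EUp 0)) * ?a 0 * ?b 1 + (\<alpha> * ?q (EUp 1)) * ?a 1 * ?b 2 + (\<alpha> * ?q (EUp 2)) * ?a 2 * ?b 0) / 21 +
     (((5 - \<alpha>) * ?q (EDown 0)) * ?a 1 * ?b 0 + ((5 - \<alpha>) * ?q (EDown 1)) * ?a 2 * ?b 1 + ((5 - \<alpha>) * ?q (EDown 2)) * ?a 0 * ?b 2) / 21"
    unfolding sum_UNIV_env sum_UNIV_3 Psi_nth norm_of_real power2_abs
    by (simp add: s) (simp add: algebra_simps add_divide_distrib diff_divide_distrib)
  also have "\<dots> = M_law z x y"
  proof -
    have up: "\<alpha> * ?q (EUp i) = (case z of E0 \<Rightarrow> if i = 2 then 1/10 else 0 | E1 \<Rightarrow> if i = 0 \<or> i = 1 then 1 else 0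
        | EBot \<Rightarrow> \<alpha> - (if i = 2 then 1/10 else 0) - (if i = 0 \<or> i = 1 then 1 else 0))" for i
      using \<alpha> by (cases z) (auto simp: q_eve_def Let_def right_diff_distrib)
    have down: "(5 - \<alpha>) * ?q (EDown i) = (case z of E0 \<Rightarrow> if i = 0 \<or> i = 1 then 1 else 0 | E1 \<Rightarrow> if i = 2 then 1/10 else 0
        | EBot \<Rightarrow> (5 - \<alpha>) - (if i = 0 \<or> i = 1 then 1 else 0) - (if i = 2 then 1/10 else 0))" for i
    proof -
      have "5 - \<alpha> \<noteq> 0" using \<alpha> by simp
      thus ?thesis by (cases z) (auto simp: q_eve_def Let_def right_diff_distrib simp del: right_minus_eq eq_iff_diff_eq_0)
    qed
    have phi: "?q EPhi = (if z = EBot then 1 else 0)"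
      by (cases z) (auto simp: q_eve_def Let_def)
    show ?thesis unfolding up down phi
      by (cases z; cases x; cases y) (simp_all add: a_eff_def b_eff_def field_simps)
  qed
  finally show "expval (Psi \<alpha>) (tensor (tensor (alice_povm x) (bob_povm y)) (eve_povm \<alpha> z)) = complex_of_real (pmf P (x, y, z))"
    by (simp add: P)
qed

section \<open>Separability and entanglement\<close>

lemma matrix_eq_3x3:
  fixes M N :: "complex^(3 \<times> 3)^(3 \<times> 3)"
  assumes "\<And>a b c d. M $ (a, b) $ (c, d) = N $ (a, b) $ (c, d)"
  shows "M = N"
  using assms by (auto simp: vec_eq_iff)

lemma expval_add: "expval v (M + N) = expval v M + expval v N"
  by (simp add: expval_def matrix_vector_mult_add_rdistrib distrib_left sum.distrib)

lemma expval_scaleR: "expval v (c *\<^sub>R M) = complex_of_real c * expval v M"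
proof -
  have "((c *\<^sub>R M) *v v) $ i = complex_of_real c * (M *v v) $ i" for i
    unfolding matrix_vector_mult_def vec_lambda_beta vector_scaleR_component
    by (simp add: scaleR_conv_of_real sum_distrib_left mult_ac)
  thus ?thesis by (simp add: expval_def sum_distrib_left mult_ac)
qed

lemma expval_ketbra: "expval v (ketbra w w) = complex_of_real ((cmod (\<Sum>i\<in>UNIV. cnj (v $ i) * w $ i))\<^sup>2)"
proof -
  have "expval v (ketbra w w) = (\<Sum>i\<in>UNIV. cnj (v $ i) * w $ i) * (\<Sum>j\<in>UNIV. cnj (w $ j) * v $ j)"
    by (simp add: expval_def matrix_vector_mult_def ketbra_nth sum_product sum_distrib_left mult_ac)
  also have "(\<Sum>j\<in>UNIV. cnj (w $ j) * v $ j) = cnj (\<Sum>i\<in>UNIV. cnj (v $ i) * w $ i)"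
    by (simp add: mult.commute)
  finally show ?thesis by (simp only: complex_norm_square)
qed

lemma positive_add: "positive_op M \<Longrightarrow> positive_op N \<Longrightarrow> positive_op (M + N)"
  by (simp add: positive_op_def expval_add)

lemma positive_scaleR: "positive_op M \<Longrightarrow> 0 \<le> c \<Longrightarrow> positive_op (c *\<^sub>R M)"
  by (simp add: positive_op_def expval_scaleR)

lemma positive_ketbra: "positive_op (ketbra w w)"
  by (simp add: positive_op_def expval_ketbra)

lemma positive_zero: "positive_op 0"
  by (simp add: positive_op_def expval_def)

lemma positive_sum: "(\<And>i. i \<in> I \<Longrightarrow> positive_op (M i)) \<Longrightarrow> positive_op (\<Sum>i\<in>I. M i)"
  by (induction I rule: infinite_finite_induct) (auto simp: positive_zero positive_add)

lemma trace_sigma: "trace (sigma_state \<alpha>) = 1"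
proof -
  have "trace (sigma_state \<alpha>) = complex_of_real (\<Sum>a\<in>UNIV. \<Sum>b\<in>UNIV. (if a = (b::3) then 2/21 else 0) +
     ((if b = a + 1 then \<alpha>/21 else 0) + (if a = b + 1 then (5 - \<alpha>)/21 else 0)))"
    unfolding trace_def sum_UNIV_prod sigma_nth by simp
  also have "(\<Sum>a\<in>UNIV. \<Sum>b\<in>UNIV. (if a = b then 2/21 else 0) +
     ((if b = a + 1 then \<alpha>/21 else 0) + (if a = (b::3) + 1 then (5 - \<alpha>)/21 else 0))) = 1"
    unfolding sum_UNIV_3 by (simp add: field_simps)
  finally show ?thesis by simp
qed

lemma density_sigma:
  assumes "0 \<le> \<alpha>" "\<alpha> \<le> 5"
  shows "density_op (sigma_state \<alpha>)"
  unfolding density_op_def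
proof
  show "positive_op (sigma_state \<alpha>)"
    unfolding sigma_state_def Let_def
    by (intro positive_add positive_scaleR positive_sum positive_ketbra) (use assms in auto)
qed (rule trace_sigma)

lemma density_ketbra:
  assumes "(\<Sum>i\<in>UNIV. (cmod (v $ i))\<^sup>2) = 1"
  shows "density_op (ketbra v v)"
proof -
  have "trace (ketbra v v) = complex_of_real (\<Sum>i\<in>UNIV. (cmod (v $ i))\<^sup>2)"
    by (simp add: trace_def ketbra_nth complex_norm_square del: of_real_power)
  thus ?thesis using assms by (simp add: density_op_def positive_ketbra)
qed

section \<open>Separability for alpha up to 3\<close>

lemma separable_stateI:
  assumes "finite S" "\<And>s. s \<in> S \<Longrightarrow> 0 \<le> p s \<and> density_op (\<rho> s) \<and> density_op (\<tau> s)" "(\<Sum>s\<in>S. p s) = 1"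
    and "\<sigma> = (\<Sum>s\<in>S. p s *\<^sub>R tensor (\<rho> s) (\<tau> s))"
  shows "separable_state \<sigma>"
proof -
  obtain h where h: "bij_betw h {..<card S} S"
    using ex_bij_betw_nat_finite[OF assms(1)] by (auto simp: atLeast0LessThan)
  have "h i \<in> S" if "i < card S" for i using h that by (auto simp: bij_betw_def)
  thus ?thesis
    unfolding separable_state_def assms(4) using assms(2,3)
    by (intro exI[of _ "card S"] exI[of _ "p \<circ> h"] exI[of _ "\<rho> \<circ> h"] exI[of _ "\<tau> \<circ> h"])
      (auto simp: sum.reindex_bij_betw[OF h] sum.reindex_bij_betw[OF h, of "\<lambda>s. p s *\<^sub>R tensor (\<rho> s) (\<tau> s)"])
qed

text \<open>Averaging \<open>|v v*><v v*|\<close> over the phases kills all entries of \<open>|ab><cd|\<close> except those with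
  \<open>a = b, c = d\<close> or \<open>a = c, b = d\<close>; fourth roots of unity suffice.\<close>

definition phase_vec :: "nat \<Rightarrow> nat \<Rightarrow> complex^3" where
  "phase_vec s t = (\<chi> i. (if i = 0 then 1 else if i = 1 then \<i> ^ s else \<i> ^ t) / complex_of_real (sqrt 3))"

definition phase_vec_cnj :: "nat \<Rightarrow> nat \<Rightarrow> complex^3" where
  "phase_vec_cnj s t = (\<chi> i. cnj (phase_vec s t $ i))"

lemma density_phase: "density_op (ketbra (phase_vec s t) (phase_vec s t))"
  "density_op (ketbra (phase_vec_cnj s t) (phase_vec_cnj s t))"
  by (rule density_ketbra; simp add: sum_UNIV_3 phase_vec_def phase_vec_cnj_def norm_divide norm_power power_divide)+

lemma density_ket: "density_op (ketbra (ket i) (ket i))"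
proof (rule density_ketbra)
  have "(cmod (ket i $ j))\<^sup>2 = (if j = i then 1 else 0)" for j by (simp add: ket_nth)
  thus "(\<Sum>j\<in>UNIV. (cmod (ket i $ j))\<^sup>2) = 1" by simp
qed

lemma tensor_ket: "tensor (ketbra (ket i) (ket i)) (ketbra (ket j) (ket j)) = ketbra (ket2 i j) (ket2 i j)"
  by (auto simp: vec_eq_iff tensor_nth ketbra_nth ket_nth ket2_nth)

lemma phase_average:
  "(\<Sum>s<4. \<Sum>t<4. tensor (ketbra (phase_vec s t) (phase_vec s t)) (ketbra (phase_vec_cnj s t) (phase_vec_cnj s t)) $ (a, b) $ (c, d))
   = (if a = b \<and> c = d \<or> a = c \<and> b = d then 16/9 else 0)"
proof -
  define \<phi> where "\<phi> s t i = (if i = (0::3) then 1 else if i = 1 then \<i> ^ s else \<i> ^ t)" for s t :: nat and i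
  have s3: "complex_of_real (sqrt 3) * complex_of_real (sqrt 3) = 3" by (simp flip: of_real_mult)
  have 9: "complex_of_real (sqrt 3) * complex_of_real (sqrt 3) * (complex_of_real (sqrt 3) * complex_of_real (sqrt 3)) = 9"
    unfolding s3 by simp
  have "tensor (ketbra (phase_vec s t) (phase_vec s t)) (ketbra (phase_vec_cnj s t) (phase_vec_cnj s t)) $ (a, b) $ (c, d) =
     \<phi> s t a * cnj (\<phi> s t c) * (cnj (\<phi> s t b) * \<phi> s t d) / 9" for s t
    using 9 by (simp add: tensor_nth ketbra_nth phase_vec_def phase_vec_cnj_def \<phi>_def[symmetric] mult_ac)
  note entry = this
  have "(\<Sum>s<4. \<Sum>t<4. tensor (ketbra (phase_vec s t) (phase_vec s t)) (ketbra (phase_vec_cnj s t) (phase_vec_cnj s t)) $ (a, b) $ (c, d))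
    = (\<Sum>s<4. \<Sum>t<4. \<phi> s t a * cnj (\<phi> s t c) * (cnj (\<phi> s t b) * \<phi> s t d)) / 9"
    unfolding entry sum_divide_distrib ..
  also have "(\<Sum>s<4. \<Sum>t<4. \<phi> s t a * cnj (\<phi> s t c) * (cnj (\<phi> s t b) * \<phi> s t d)) =
     (if a = b \<and> c = d \<or> a = c \<and> b = d then 16 else 0)"
  proof -
    have i: "\<i> ^ 2 = -1" "\<i> ^ 3 = - \<i>" by (simp_all add: power3_eq_cube)
    have 4: "{..<4::nat} = {0, 1, 2, 3}" by auto
    have "\<forall>a b c d. (\<Sum>s<4. \<Sum>t<4. \<phi> s t a * cnj (\<phi> s t c) * (cnj (\<phi> s t b) * \<phi> s t d)) =
     (if a = b \<and> c = d \<or> a = c \<and> b = d then 16 else 0)"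
      unfolding all_3 4 by (simp add: \<phi>_def i)
    thus ?thesis by blast
  qed
  also have "(if a = b \<and> c = d \<or> a = c \<and> b = d then 16 else 0) / 9 =
     (if a = b \<and> c = d \<or> a = c \<and> b = d then 16/9 else 0 :: complex)" by simp
  finally show ?thesis .
qed

text \<open>The phase average, of total weight 16 * 3/56 = 6/7, supplies all coherences and 2/21 on
  every diagonal entry. What remains is (alpha - 2)/21 on one cycle of product states and (3 -
  alpha)/21 on the other, and both are nonnegative exactly in the stated range.\<close>

theorem separable_sigma:
  assumes "2 \<le> \<alpha>" "\<alpha> \<le> 3"
  shows "separable_state (sigma_state \<alpha>)"
proof -
  let ?S = "({..<4::nat} \<times> {..<4::nat}) <+> ((UNIV :: 3 set) <+> (UNIV :: 3 set))"
  define p :: "nat \<times> nat + 3 + 3 \<Rightarrow> real" where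
    "p s = (case s of Inl _ \<Rightarrow> 3/56 | Inr (Inl _) \<Rightarrow> (\<alpha> - 2)/21 | Inr (Inr _) \<Rightarrow> (3 - \<alpha>)/21)" for s
  define \<rho> :: "nat \<times> nat + 3 + 3 \<Rightarrow> complex^3^3" where
    "\<rho> s = (case s of Inl (j, k) \<Rightarrow> ketbra (phase_vec j k) (phase_vec j k)
      | Inr (Inl i) \<Rightarrow> ketbra (ket i) (ket i) | Inr (Inr i) \<Rightarrow> ketbra (ket (i + 1)) (ket (i + 1)))" for s
  define \<tau> :: "nat \<times> nat + 3 + 3 \<Rightarrow> complex^3^3" where
    "\<tau> s = (case s of Inl (j, k) \<Rightarrow> ketbra (phase_vec_cnj j k) (phase_vec_cnj j k)
      | Inr (Inl i) \<Rightarrow> ketbra (ket (i + 1)) (ket (i + 1)) | Inr (Inr i) \<Rightarrow> ketbra (ket i) (ket i))" for s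
  have sum: "sum g ?S = (\<Sum>j<4. \<Sum>k<4. g (Inl (j, k))) + ((\<Sum>i\<in>UNIV. g (Inr (Inl i))) + (\<Sum>i\<in>UNIV. g (Inr (Inr i))))"
    for g :: "_ \<Rightarrow> 'g::comm_monoid_add"
    by (simp add: sum.Plus sum.cartesian_product' del: UNIV_Plus_UNIV)
  have "(\<Sum>s\<in>?S. p s *\<^sub>R tensor (\<rho> s) (\<tau> s)) = sigma_state \<alpha>"
  proof (rule matrix_eq_3x3)
    fix a b c d :: 3
    let ?U = "\<Sum>i\<in>UNIV. ketbra (ket2 i (i + 1)) (ket2 i (i + 1))" and ?D = "\<Sum>i\<in>UNIV. ketbra (ket2 (i + 1) i) (ket2 (i + 1) i)"
    have "(\<Sum>s\<in>?S. p s *\<^sub>R tensor (\<rho> s) (\<tau> s)) = (3/56) *\<^sub>R (\<Sum>s<4. \<Sum>t<4. tensor (ketbra (phase_vec s t) (phase_vec s t)) (ketbra (phase_vec_cnj s t) (phase_vec_cnj s t)))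
        + (((\<alpha> - 2)/21) *\<^sub>R ?U + ((3 - \<alpha>)/21) *\<^sub>R ?D)"
      unfolding sum by (simp add: p_def \<rho>_def \<tau>_def tensor_ket flip: scaleR_right.sum)
    also have "\<dots> $ (a, b) $ (c, d) = complex_of_real (3/56) * (if a = b \<and> c = d \<or> a = c \<and> b = d then 16/9 else 0) +
        (complex_of_real ((\<alpha> - 2)/21) * (if a = c \<and> b = d \<and> b = a + 1 then 1 else 0)
        + complex_of_real ((3 - \<alpha>)/21) * (if a = c \<and> b = d \<and> a = b + 1 then 1 else 0))"
    proof -
      have "(\<Sum>s<4. \<Sum>t<4. tensor (ketbra (phase_vec s t) (phase_vec s t)) (ketbra (phase_vec_cnj s t) (phase_vec_cnj s t))) $ (a, b) $ (c, d)
        = (if a = b \<and> c = d \<or> a = c \<and> b = d then 16/9 else 0)"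
        unfolding sum_component by (rule phase_average)
      moreover have "?U $ (a, b) $ (c, d) = (if a = c \<and> b = d \<and> b = a + 1 then 1 else 0)"
        by (rule sum_ketbra_up)
      moreover have "?D $ (a, b) $ (c, d) = (if a = c \<and> b = d \<and> a = b + 1 then 1 else 0)"
        by (rule sum_ketbra_down)
      ultimately show ?thesis
        unfolding vector_add_component vector_scaleR_component by (simp add: scaleR_conv_of_real)
    qed
    also have "\<dots> = sigma_state \<alpha> $ (a, b) $ (c, d)"
    proof -
      have *: "\<forall>a b c d :: 3. 3/56 * (if a = b \<and> c = d \<or> a = c \<and> b = d then 16/9 else 0) +
        ((\<alpha> - 2)/21 * (if a = c \<and> b = d \<and> b = a + 1 then 1 else 0)
        + (3 - \<alpha>)/21 * (if a = c \<and> b = d \<and> a = b + 1 then 1 else 0)) = (if a = b \<and> c = d then 2/21 else 0) +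
        (if a = c \<and> b = d then (if b = a + 1 then \<alpha>/21 else 0) + (if a = b + 1 then (5 - \<alpha>)/21 else 0) else 0)"
        unfolding all_3 by (simp add: field_simps)
      show ?thesis unfolding sigma_nth *[rule_format, symmetric] by simp
    qed
    finally show "(\<Sum>s\<in>?S. p s *\<^sub>R tensor (\<rho> s) (\<tau> s)) $ (a, b) $ (c, d) = sigma_state \<alpha> $ (a, b) $ (c, d)" .
  qed
  moreover have "(\<Sum>s\<in>?S. p s) = 1"
    unfolding sum by (simp add: p_def sum_UNIV_3 field_simps)
  moreover have "0 \<le> p s \<and> density_op (\<rho> s) \<and> density_op (\<tau> s)" for s
    using assms by (auto simp: p_def \<rho>_def \<tau>_def density_phase density_ket split: sum.split)
  ultimately show ?thesis by (intro separable_stateI[of ?S p \<rho> \<tau>]) auto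
qed

section \<open>Entanglement for alpha above 3\<close>

lemma sq_le_of_quadratic_nonneg:
  fixes r s m :: real
  assumes "\<And>t. 0 \<le> t\<^sup>2 * r - 2 * t * m + s" "0 \<le> r" "0 \<le> m"
  shows "m\<^sup>2 \<le> r * s"
proof (cases "r = 0")
  case True
  have "m = 0"
  proof (rule ccontr)
    assume "m \<noteq> 0"
    thus False using assms(1)[of "(s + 1) / (2 * m)"] True by simp
  qed
  thus ?thesis using True by simp
next
  case False
  hence "0 < r" using assms by simp
  have "(m / r)\<^sup>2 * r - 2 * (m / r) * m + s = s - m\<^sup>2 / r"
    using \<open>0 < r\<close> by (simp add: power2_eq_square field_simps)
  with assms(1)[of "m / r"] have "m\<^sup>2 / r \<le> s" by simp
  thus ?thesis using \<open>0 < r\<close> by (simp add: field_simps)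
qed

lemma expval_two:
  assumes "i \<noteq> j"
  shows "expval (\<chi> k. if k = i then x else if k = j then y else 0) M =
    cnj x * (M $ i $ i * x + M $ i $ j * y) + cnj y * (M $ j $ i * x + M $ j $ j * y)"
proof -
  let ?v = "\<chi> k. if k = i then x else if k = j then y else 0"
  have s: "(\<Sum>k\<in>UNIV. f k (?v $ k)) = f i x + f j y" if "\<And>k. f k 0 = 0" for f :: "'a \<Rightarrow> complex \<Rightarrow> complex"
  proof -
    have "(\<Sum>k\<in>UNIV. f k (?v $ k)) = (\<Sum>k\<in>{i, j}. f k (?v $ k))"
      by (rule sum.mono_neutral_right) (auto simp: that)
    thus ?thesis using assms by simp
  qed
  have "(M *v ?v) $ k = M $ k $ i * x + M $ k $ j * y" for k
    unfolding matrix_vector_mult_def vec_lambda_beta[of "\<lambda>i. \<Sum>j\<in>UNIV. M $ i $ j * ?v $ j"]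
    by (rule s[of "\<lambda>l z. M $ k $ l * z"]) simp
  thus ?thesis unfolding expval_def using s[of "\<lambda>k z. cnj z * (M *v ?v) $ k"] by simp
qed

lemma positive_entries:
  fixes M :: "complex^'n^'n"
  assumes "positive_op M"
  shows "Im (M $ i $ i) = 0" "0 \<le> Re (M $ i $ i)"
    "(cmod (M $ i $ j))\<^sup>2 \<le> Re (M $ i $ i) * Re (M $ j $ j)"
proof -
  have ex1: "expval (ket i) M = M $ i $ i" for i
    by (simp add: expval_def ket_nth matrix_vector_mult_def if_distrib[where f = "\<lambda>x. _ * x"] if_distrib[where f = "\<lambda>x. x * _"] if_distrib[where f = cnj] cong: if_cong)
  show d: "Im (M $ i $ i) = 0" "0 \<le> Re (M $ i $ i)" for i
    using assms unfolding positive_op_def by (metis ex1)+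
  show "(cmod (M $ i $ j))\<^sup>2 \<le> Re (M $ i $ i) * Re (M $ j $ j)"
  proof (cases "i = j")
    case True
    thus ?thesis using d[of j] by (simp add: cmod_def power2_eq_square)
  next
    case False
    note e = expval_two[OF False, of _ _ M]
    have p: "Im (expval v M) = 0" "0 \<le> Re (expval v M)" for v using assms by (auto simp: positive_op_def)
    \<comment> \<open>Hermiticity of the 2 by 2 block follows from reality of the form at the
      vectors (1, 1) and (1, i).\<close>
    have "Im (M $ i $ j + M $ j $ i) = 0" using p(1)[of "\<chi> k. if k = i then 1 else if k = j then 1 else 0"] d
      unfolding e by simp
    moreover have "Re (M $ i $ j - M $ j $ i) = 0" using p(1)[of "\<chi> k. if k = i then 1 else if k = j then \<i> else 0"] d
      unfolding e by simp
    ultimately have herm: "M $ j $ i = cnj (M $ i $ j)" by (simp add: complex_eq_iff)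
    define m where "m = cmod (M $ i $ j)"
    \<comment> \<open>This phase turns the entry into its modulus, so the form at
      \<open>(t, - w)\<close> is a real quadratic in \<open>t\<close>.\<close>
    define w where "w = (if m = 0 then 1 else cnj (M $ i $ j) / m)"
    have mw: "M $ i $ j * w = m" "cnj w * cnj (M $ i $ j) = m"
      by (auto simp: w_def m_def complex_norm_square[symmetric] power2_eq_square mult.commute)
    have "cmod w = 1" by (simp add: w_def m_def norm_divide)
    hence ww: "cnj w * w = 1" using complex_norm_square[of w] by (simp add: mult.commute)
    show ?thesis unfolding m_def[symmetric]
    proof (rule sq_le_of_quadratic_nonneg)
      fix t :: real
      have "expval (\<chi> k. if k = i then complex_of_real t else if k = j then - w else 0) M =
         t\<^sup>2 * M $ i $ i - t * (M $ i $ j * w) - t * (cnj w * cnj (M $ i $ j)) + (cnj w * w) * M $ j $ j"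
        unfolding e herm by (simp add: power2_eq_square algebra_simps)
      also have "\<dots> = t\<^sup>2 * M $ i $ i - 2 * t * m + M $ j $ j" unfolding mw ww by simp
      finally show "0 \<le> t\<^sup>2 * Re (M $ i $ i) - 2 * t * m + Re (M $ j $ j)"
        using p(2)[of "\<chi> k. if k = i then complex_of_real t else if k = j then - w else 0"]
        by (simp flip: of_real_power)
    qed (use d in \<open>auto simp: m_def\<close>)
  qed
qed

text \<open>The arithmetic-geometric mean inequality for three terms with product (x y z)^3. The
  difference equals z (x - y)^2 + y (z - x) (z - y), nonnegative when z is smallest; the other cases
  are cyclic shifts.\<close>

lemma cyclic_cubic_ge:
  fixes x y z :: real
  assumes "0 \<le> x" "0 \<le> y" "0 \<le> z"
  shows "3 * x * y * z \<le> y * z\<^sup>2 + x\<^sup>2 * z + x * y\<^sup>2"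
proof -
  have *: "3 * x * y * z \<le> y * z\<^sup>2 + x\<^sup>2 * z + x * y\<^sup>2" if "0 \<le> x" "0 \<le> y" "0 \<le> z" "0 \<le> (z - x) * (z - y)" for x y z :: real
  proof -
    have "0 \<le> z * (x - y)\<^sup>2 + y * ((z - x) * (z - y))" using that by simp
    thus ?thesis by (simp add: power2_eq_square algebra_simps)
  qed
  consider "z \<le> x" "z \<le> y" | "x \<le> y" "x \<le> z" | "y \<le> x" "y \<le> z" by linarith
  thus ?thesis
  proof cases
    case 1
    hence "0 \<le> (z - x) * (z - y)" by (intro mult_nonpos_nonpos) auto
    from *[OF assms this] show ?thesis .
  next
    case 2
    hence "0 \<le> (x - y) * (x - z)" by (intro mult_nonpos_nonpos) auto
    from *[OF assms(2,3,1) this] show ?thesis by (simp add: algebra_simps)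
  next
    case 3
    hence "0 \<le> (y - z) * (y - x)" by (intro mult_nonpos_nonpos) auto
    from *[OF assms(3,1,2) this] show ?thesis by (simp add: algebra_simps)
  qed
qed

text \<open>After clearing denominators, the difference of the two sides is exactly the cyclic cubic
  above.\<close>

lemma choi_ratio_le:
  fixes x y z :: real
  assumes nn: "0 \<le> x" "0 \<le> y" "0 \<le> z"
  shows "x / (2 * x + y) + y / (2 * y + z) + z / (2 * z + x) \<le> 1"
proof -
  consider "2 * x + y = 0" | "2 * y + z = 0" | "2 * z + x = 0" | "0 < 2 * x + y" "0 < 2 * y + z" "0 < 2 * z + x"
    using nn by linarith
  thus ?thesis
  proof cases
    case 4
    have "x * ((2 * y + z) * (2 * z + x)) + y * ((2 * x + y) * (2 * z + x)) + z * ((2 * x + y) * (2 * y + z))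
       \<le> (2 * x + y) * (2 * y + z) * (2 * z + x)"
      using cyclic_cubic_ge[OF nn] by (simp add: power2_eq_square algebra_simps)
    moreover have "x / (2 * x + y) + y / (2 * y + z) + z / (2 * z + x) =
      (x * ((2 * y + z) * (2 * z + x)) + y * ((2 * x + y) * (2 * z + x)) + z * ((2 * x + y) * (2 * y + z))) /
      ((2 * x + y) * (2 * y + z) * (2 * z + x))"
      using 4 by (simp add: add_frac_eq less_imp_neq[symmetric]) (simp add: algebra_simps)
    ultimately show ?thesis using 4 by (simp add: divide_le_eq_1)
  next
    case 1
    hence "x = 0" "y = 0" using nn by auto
    thus ?thesis by simp
  next
    case 2
    hence "y = 0" "z = 0" using nn by auto
    thus ?thesis by simp
  next
    case 3
    hence "x = 0" "z = 0" using nn by auto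
    thus ?thesis by simp
  qed
qed

text \<open>Positivity of Choi's map, for matrices whose entries have the largest modulus that positivity allows.\<close>

lemma choi_inequality:
  fixes A B :: "3 \<Rightarrow> real"
  assumes A: "\<And>i. 0 \<le> A i" and B: "\<And>i. 0 \<le> B i"
  shows "(\<Sum>i\<in>UNIV. sqrt (A i * B i))\<^sup>2 \<le> (\<Sum>i\<in>UNIV. 2 * (A i * B i) + A (i + 1) * B i)"
proof -
  \<comment> \<open>Weighting the Cauchy-Schwarz inequality by \<open>?D\<close> splits off the
    right-hand side and leaves the sum of ratios \<open>A i / ?D i\<close>.\<close>
  let ?D = "\<lambda>i. 2 * A i + A (i + 1)"
  have "(\<Sum>i\<in>UNIV. sqrt (A i * B i))\<^sup>2 = (\<Sum>i\<in>UNIV. sqrt (?D i * B i) * sqrt (A i / ?D i))\<^sup>2"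
  proof -
    have "sqrt (A i * B i) = sqrt (?D i * B i) * sqrt (A i / ?D i)" for i
    proof (cases "?D i = 0")
      case True
      hence "A i = 0" using A[of i] A[of "i + 1"] by linarith
      thus ?thesis by simp
    next
      case False
      thus ?thesis by (simp flip: real_sqrt_mult)
    qed
    thus ?thesis by simp
  qed
  also have "\<dots> \<le> (\<Sum>i\<in>UNIV. (sqrt (?D i * B i))\<^sup>2) * (\<Sum>i\<in>UNIV. (sqrt (A i / ?D i))\<^sup>2)"
    by (rule Cauchy_Schwarz_ineq_sum)
  also have "\<dots> = (\<Sum>i\<in>UNIV. ?D i * B i) * (\<Sum>i\<in>UNIV. A i / ?D i)"
    using A B by simp
  also have "\<dots> \<le> (\<Sum>i\<in>UNIV. ?D i * B i) * 1"
  proof (rule mult_left_mono)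
    have [simp]: "(3::3) = 0" by simp
    show "(\<Sum>i\<in>UNIV. A i / ?D i) \<le> 1"
      using choi_ratio_le[of "A 0" "A 1" "A 2"] A by (simp add: sum_UNIV_3)
  qed (use A B in \<open>auto intro!: sum_nonneg mult_nonneg_nonneg add_nonneg_nonneg\<close>)
  finally show ?thesis by (simp add: algebra_simps)
qed

text \<open>The expectation of the entanglement witness that belongs to Choi's map: linear,
  nonnegative on products, and equal to (9 - 3 alpha) / 21 on \<open>sigma_state\<close>.\<close>

definition choi_witness :: "complex^(3 \<times> 3)^(3 \<times> 3) \<Rightarrow> real" where
  "choi_witness M = (\<Sum>i\<in>UNIV. 2 * Re (M $ (i, i) $ (i, i)) + Re (M $ (i + 1, i) $ (i + 1, i)))
     - (\<Sum>i\<in>UNIV. \<Sum>j\<in>UNIV. Re (M $ (i, i) $ (j, j)))"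

lemma choi_witness_sum:
  "choi_witness (\<Sum>s\<in>S. p s *\<^sub>R M s) = (\<Sum>s\<in>S. p s * choi_witness (M s))"
proof -
  have c: "Re ((\<Sum>s\<in>S. p s *\<^sub>R M s) $ x $ y) = (\<Sum>s\<in>S. p s * Re (M s $ x $ y))" for x y
    by simp
  show ?thesis unfolding choi_witness_def c sum_UNIV_3
    by (simp add: sum.distrib sum_subtractf sum_distrib_left algebra_simps)
qed

text \<open>Off-diagonal entries are at most geometric means of diagonal ones, which reduces the
  claim to \<open>choi_inequality\<close> for the diagonals.\<close>

lemma choi_witness_product:
  assumes "density_op \<rho>" "density_op \<tau>"
  shows "0 \<le> choi_witness (tensor \<rho> \<tau>)"
proof -
  have pos: "positive_op \<rho>" "positive_op \<tau>" using assms by (auto simp: density_op_def)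
  note r = positive_entries[OF pos(1)] and t = positive_entries[OF pos(2)]
  let ?A = "\<lambda>i. Re (\<rho> $ i $ i)" and ?B = "\<lambda>i. Re (\<tau> $ i $ i)"
  have "(\<Sum>i\<in>UNIV. \<Sum>j\<in>UNIV. Re (tensor \<rho> \<tau> $ (i, i) $ (j, j))) \<le> (\<Sum>i\<in>UNIV. \<Sum>j\<in>UNIV. sqrt (?A i * ?B i) * sqrt (?A j * ?B j))"
  proof (intro sum_mono)
    fix i j :: 3
    have "Re (tensor \<rho> \<tau> $ (i, i) $ (j, j)) \<le> cmod (\<rho> $ i $ j) * cmod (\<tau> $ i $ j)"
      unfolding tensor_nth norm_mult[symmetric] by (rule complex_Re_le_cmod)
    also have "\<dots> \<le> sqrt (?A i * ?A j) * sqrt (?B i * ?B j)"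
      by (intro mult_mono real_le_rsqrt r t) (auto intro!: mult_nonneg_nonneg r t)
    also have "\<dots> = sqrt (?A i * ?B i) * sqrt (?A j * ?B j)"
      by (simp add: real_sqrt_mult)
    finally show "Re (tensor \<rho> \<tau> $ (i, i) $ (j, j)) \<le> sqrt (?A i * ?B i) * sqrt (?A j * ?B j)" .
  qed
  also have "\<dots> = (\<Sum>i\<in>UNIV. sqrt (?A i * ?B i))\<^sup>2"
    by (simp add: power2_eq_square sum_product)
  also have "\<dots> \<le> (\<Sum>i\<in>UNIV. 2 * (?A i * ?B i) + ?A (i + 1) * ?B i)"
    by (rule choi_inequality) (rule r t)+
  finally show ?thesis by (simp add: choi_witness_def tensor_nth r t)
qed

lemma not_separable_sigma:
  assumes "3 < \<alpha>"
  shows "\<not> separable_state (sigma_state \<alpha>)"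
proof
  assume "separable_state (sigma_state \<alpha>)"
  then obtain n :: nat and p \<rho> \<tau> where n: "\<And>i. i < n \<Longrightarrow> 0 \<le> p i \<and> density_op (\<rho> i) \<and> density_op (\<tau> i)"
    and \<sigma>: "sigma_state \<alpha> = (\<Sum>i<n. p i *\<^sub>R tensor (\<rho> i) (\<tau> i))"
    unfolding separable_state_def by blast
  have "0 \<le> choi_witness (sigma_state \<alpha>)"
    unfolding \<sigma> choi_witness_sum using n by (intro sum_nonneg mult_nonneg_nonneg choi_witness_product) auto
  also have "choi_witness (sigma_state \<alpha>) = (9 - 3 * \<alpha>) / 21"
    unfolding choi_witness_def sigma_nth sum_UNIV_3 by (simp add: field_simps)
  finally show False using assms by simp
qed

text \<open>The partial transpose is block diagonal with blocks \<open>2/21\<close> and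
  \<open>(\<alpha>, 2; 2, 5 - \<alpha>)/21\<close>; the second block is positive since \<open>\<alpha> (5 - \<alpha>) \<ge> 4\<close>.\<close>

lemma not_distillable_sigma:
  assumes \<alpha>: "1 \<le> \<alpha>" "\<alpha> \<le> 4"
  shows "\<not> distillable (sigma_state \<alpha>)"
proof -
  \<comment> \<open>The Cholesky factor of the 2 by 2 block: \<open>(u, v)\<close> is its first
    column and w^2 its Schur complement.\<close>
  define u v w :: real where "u = sqrt (\<alpha>/21)" and "v = 2 / (21 * sqrt (\<alpha>/21))" and "w = sqrt ((5 - \<alpha> - 4/\<alpha>)/21)"
  have "0 \<le> (\<alpha> - 1) * (4 - \<alpha>)" using \<alpha> by simp
  hence "4 \<le> (5 - \<alpha>) * \<alpha>" by (simp add: algebra_simps)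
  hence w0: "0 \<le> 5 - \<alpha> - 4/\<alpha>" using \<alpha> by (simp add: field_simps)
  have uu: "u * u = \<alpha>/21" and uv: "u * v = 2/21" using \<alpha> by (simp_all add: u_def v_def)
  have "v * v = 4 / (441 * (sqrt (\<alpha>/21) * sqrt (\<alpha>/21)))" by (simp add: v_def)
  hence vw: "v * v + w * w = (5 - \<alpha>)/21" using \<alpha> w0 by (simp add: w_def field_simps)
  define f :: "nat \<times> 3 \<Rightarrow> 3 \<Rightarrow> 3 \<Rightarrow> real" where
    "f = (\<lambda>(k, i) a b. if k = 0 then (if a = i \<and> b = i then sqrt (2/21) else 0)
      else if k = 1 then (if a = i \<and> b = i + 1 then u else if a = i + 1 \<and> b = i then v else 0)
      else (if a = i + 1 \<and> b = i then w else 0))"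
  let ?K = "{0, 1, 2::nat} \<times> (UNIV :: 3 set)"
  have f: "sigma_state \<alpha> $ (a, d) $ (c, b) = (\<Sum>k\<in>?K. complex_of_real (f k a b) * cnj (complex_of_real (f k c d)))" for a b c d
  proof -
    have "\<forall>a b c d. (if a = d \<and> c = b then 2/21 else 0) +
     (if a = c \<and> d = b then (if d = a + 1 then \<alpha>/21 else 0) + (if a = d + 1 then (5 - \<alpha>)/21 else 0) else 0) =
     (\<Sum>k\<in>?K. f k a b * f k c d)"
      unfolding sum.cartesian_product' sum_UNIV_3 all_3
      by (simp add: f_def uu uv vw uv[unfolded mult.commute[of u v]])
    hence "(if a = d \<and> c = b then 2/21 else 0) +
     (if a = c \<and> d = b then (if d = a + 1 then \<alpha>/21 else 0) + (if a = d + 1 then (5 - \<alpha>)/21 else 0) else 0) =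
     (\<Sum>k\<in>?K. f k a b * f k c d)" by blast
    thus ?thesis unfolding sigma_nth complex_cnj_complex_of_real of_real_mult[symmetric] of_real_sum[symmetric] by simp
  qed
  show ?thesis
    by (rule ppt_not_distillable[of ?K _ "\<lambda>k a b. complex_of_real (f k a b)", OF _ f trace_sigma]) simp
qed

theorem bound_entangled_sigma:
  assumes "3 < \<alpha>" "\<alpha> \<le> 4"
  shows "bound_entangled (sigma_state \<alpha>)"
  unfolding bound_entangled_def
  using density_sigma[of \<alpha>] not_separable_sigma[of \<alpha>] not_distillable_sigma[of \<alpha>] assms by simp

lemma produces_P:
  assumes "2 \<le> \<alpha>" "\<alpha> \<le> 4"
  shows "purification_produces (sigma_state \<alpha>) P_pmf"
  unfolding purification_produces_def
  using purification[of \<alpha>] alice_is_povm bob_is_povm eve_is_povm[OF assms] outcome_law[OF assms pmf_P] assms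
  by (intro exI[of _ "Psi \<alpha>"] exI[of _ alice_povm] exI[of _ bob_povm] exI[of _ "eve_povm \<alpha>"]) simp

theorem mainTheorem4:
  shows "\<exists>P :: (bool \<times> bool \<times> eve_outcome) pmf.
    (\<forall>\<alpha>::real. 2 \<le> \<alpha> \<and> \<alpha> \<le> 4 \<longrightarrow>
       is_purification (Psi \<alpha>) (sigma_state \<alpha>) \<and>
       is_povm alice_povm \<and> is_povm bob_povm \<and> is_povm (eve_povm \<alpha>) \<and>
       has_outcome_law (Psi \<alpha>) alice_povm bob_povm (eve_povm \<alpha>) P) \<and>
    (\<forall>x y z. pmf P (x, y, z) = M_law z x y) \<and>
    secret_key_rate P = 0 \<and>
    0 < intrinsic_information P \<and>
    ereal (intrinsic_information P) \<le> formation_cost P \<and>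
    (\<forall>\<alpha>::real. 3 < \<alpha> \<and> \<alpha> \<le> 4 \<longrightarrow> bound_entangled (sigma_state \<alpha>) \<and> purification_produces (sigma_state \<alpha>) P) \<and>
    (\<forall>\<alpha>::real. 2 \<le> \<alpha> \<and> \<alpha> \<le> 3 \<longrightarrow> separable_state (sigma_state \<alpha>) \<and> purification_produces (sigma_state \<alpha>) P)"
proof (intro exI[of _ P_pmf] conjI allI impI; (elim conjE)?)
  fix \<alpha> :: real
  assume \<alpha>: "2 \<le> \<alpha>" "\<alpha> \<le> 4"
  show "is_purification (Psi \<alpha>) (sigma_state \<alpha>)" using \<alpha> by (intro purification) auto
  show "is_povm alice_povm" by (rule alice_is_povm)
  show "is_povm bob_povm" by (rule bob_is_povm)
  show "is_povm (eve_povm \<alpha>)" by (rule eve_is_povm[OF \<alpha>])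
  show "has_outcome_law (Psi \<alpha>) alice_povm bob_povm (eve_povm \<alpha>) P_pmf"
    by (rule outcome_law[OF \<alpha> pmf_P])
next
  show "pmf P_pmf (x, y, z) = M_law z x y" for x y z by (rule pmf_P)
  show "secret_key_rate P_pmf = 0" by (rule secret_key_rate_P)
  show "0 < intrinsic_information P_pmf" by (rule intrinsic_information_P_pos)
  show "ereal (intrinsic_information P_pmf) \<le> formation_cost P_pmf"
    by (rule intrinsic_information_le_formation_cost)
next
  fix \<alpha> :: real
  assume \<alpha>: "3 < \<alpha>" "\<alpha> \<le> 4"
  show "bound_entangled (sigma_state \<alpha>)" by (rule bound_entangled_sigma[OF \<alpha>])
  show "purification_produces (sigma_state \<alpha>) P_pmf" using \<alpha> by (intro produces_P) auto
next
  fix \<alpha> :: real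
  assume \<alpha>: "2 \<le> \<alpha>" "\<alpha> \<le> 3"
  show "separable_state (sigma_state \<alpha>)" by (rule separable_sigma[OF \<alpha>])
  show "purification_produces (sigma_state \<alpha>) P_pmf" using \<alpha> by (intro produces_P) auto
qed

end
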